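(* Let $n \ge 1$ and let $w = w_1 \cdots w_n \in \mathfrak{S}_n$ (one-line notation) be a permutation which avoids the pattern $4231$, does not avoid the pattern $3412$, and satisfies $\mathrm{gap}_{3412}(w) > 1$. Then the (modified, signless) Kazhdan--Lusztig basis element $\widetilde{C}_w$ of the type-$A$ Hecke algebra $H_n(q)$ has no parabolic factorization; that is, there is no finite sequence of intervals $\mathcal{A} = ([a_1,b_1],\ldots,[a_m,b_m])$, each contained in $[n]=\{1,\ldots,n\}$, such that $$\widetilde{C}_w = \frac{1}{f_{\mathcal{A}}(q)}\, \widetilde{C}_{s_{[a_1,b_1]}} \cdots \widetilde{C}_{s_{[a_m,b_m]}}.$$
   Context: Permutations and patterns. $\mathfrak{S}_n$ is the symmetric group with standard generators $s_1,\ldots,s_{n-1}$ (adjacent transpositions), length function $\ell$, Bruhat order $\le$, and identity $e$. A word $y_1\cdots y_k$ of distinct letters matches the pattern $u = u_1 \cdots u_k \in \mathfrak{S}_k$ if for all $i,j$ we have $u_i<u_j \iff y_i<y_j$. A permutation $w\in\mathfrak{S}_n$ avoids the pattern $u$ if no subword $w_{i_1}\cdots w_{i_k}$ ($i_1<\cdots<i_k$) matches $u$. For $w$ not avoiding $3412$, $$\mathrm{gap}_{3412}(w) = \min\{ w_{i_1}-w_{i_4} \mid i_1<i_2<i_3<i_4,\ w_{i_1}w_{i_2}w_{i_3}w_{i_4} \text{ matches the pattern } 3412\}.$$ For $1\le a\le b\le n$, the reversal $s_{[a,b]} \in \mathfrak{S}_n$ is the permutation with one-line notation $1\cdots(a-1)\,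 b\,(b-1)\cdots a\,(b+1)\cdots n$. Hecke algebra. $H_n(q)$ is the $\mathbb{Z}[q^{1/2},q^{-1/2}]$-algebra which is free as a module with natural basis $\{T_w \mid w\in\mathfrak{S}_n\}$, with identity $T_e$ and multiplication determined by $T_{s_i}T_w = T_{s_iw}$ if $s_iw>w$, and $T_{s_i}T_w = (q-1)T_w + qT_{s_iw}$ if $s_iw<w$. The bar involution is the semilinear ring involution with $\overline{q^{1/2}} = q^{-1/2}$ and $\overline{T_w} = (T_{w^{-1}})^{-1}$. The Kazhdan--Lusztig basis $\{C'_w \mid w\in\mathfrak{S}_n\}$ is the unique basis satisfying $\overline{C'_w} = C'_w$ and $$\widetilde{C}_w := q^{\ell(w)/2} C'_w = \sum_{v\le w} P_{v,w}(q)\, T_v,$$ where $P_{v,w}(q)\in\mathbb{Z}[q]$, $P_{w,w}(q)=1$, and $\deg P_{v,w}(q) \le \frac{\ell(w)-\ell(v)-1}{2}$ for $v<w$. The $P_{v,w}(q)$ are the Kazhdan--Lusztig polynomials. In particular $\widetilde{C}_{s_{[a,b]}} = \sum_{u\le s_{[a,b]}} T_u$. Parabolic factorization. Given a sequence of intervals $\mathcal{A} = ([a_1,b_1],\ldots,[a_m,b_m])$ contained in $[n]$, define for $1\le i<j\le m$ $$I_{i,j} = \bigl([a_i,b_i]\cap[a_j,b_j]\bigr) \setminus \bigl([a_{i+1},b_{i+1}]\cup\cdots\cup[a_{j-1},b_{j-1}]\bigr), \qquad f_{\mathcal{A}}(q) = \prod_{i<j} |I_{i,j}|_q!,$$ where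 $k_q! = \prod_{i=1}^{k}(1+q+\cdots+q^{i-1})$ and $0_q!=1$. The element $\widetilde{C}_w$ has a parabolic factorization if there is such a sequence $\mathcal{A}$ with $\widetilde{C}_w = \frac{1}{f_{\mathcal{A}}(q)}\widetilde{C}_{s_{[a_1,b_1]}}\cdots\widetilde{C}_{s_{[a_m,b_m]}}$ (equivalently, $f_{\mathcal{A}}(q)\,\widetilde{C}_w = \widetilde{C}_{s_{[a_1,b_1]}}\cdots\widetilde{C}_{s_{[a_m,b_m]}}$). *)

theory Defs
  imports
    "HOL-Library.Poly_Mapping"
    "HOL-Computational_Algebra.Polynomial"
    "HOL-Combinatorics.Permutations"
begin

section \<open>The symmetric group\<close>

text \<open>
  A permutation of \<open>{1..n}\<close> is a function \<open>nat \<Rightarrow> nat\<close> fixing everything outside \<open>{1..n}\<close>.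
  The one-line notation of \<open>w\<close> is \<open>w 1, \<dots>, w n\<close>, and the product is composition,
  \<open>u v = u \<circ> v\<close>.
\<close>

type_synonym perm = "nat \<Rightarrow> nat"

definition Sym :: "nat \<Rightarrow> perm set" where
  "Sym n = {w. w permutes {1..n}}"

definition adj :: "nat \<Rightarrow> perm" where
  "adj i = transpose i (Suc i)"

definition word_perm :: "nat list \<Rightarrow> perm" where
  "word_perm is = foldr (\<lambda>i w. adj i \<circ> w) is id"

definition word_for :: "nat \<Rightarrow> perm \<Rightarrow> nat list \<Rightarrow> bool" where
  "word_for n w is \<longleftrightarrow> set is \<subseteq> {1..<n} \<and> word_perm is = w"

definition len :: "nat \<Rightarrow> perm \<Rightarrow> nat" where
  "len n w = (LEAST k. \<exists>is. word_for n w is \<and> length is = k)"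

definition reduced_word :: "nat \<Rightarrow> perm \<Rightarrow> nat list \<Rightarrow> bool" where
  "reduced_word n w is \<longleftrightarrow> word_for n w is \<and> length is = len n w"

text \<open>
  Bruhat order: the reflexive-transitive closure of \<open>v \<rightarrow> v t\<close>, for \<open>t\<close> a reflection
  (transposition) with \<open>len v < len (v t)\<close>.
\<close>

definition bruhat_step :: "nat \<Rightarrow> perm \<Rightarrow> perm \<Rightarrow> bool" where
  "bruhat_step n v w \<longleftrightarrow> v \<in> Sym n \<and> len n v < len n w \<and>
     (\<exists>a b. 1 \<le> a \<and> a < b \<and> b \<le> n \<and> w = v \<circ> transpose a b)"

definition bruhat_le :: "nat \<Rightarrow> perm \<Rightarrow> perm \<Rightarrow> bool" where
  "bruhat_le n = (bruhat_step n)\<^sup>*\<^sup>*"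

definition bruhat_less :: "nat \<Rightarrow> perm \<Rightarrow> perm \<Rightarrow> bool" where
  "bruhat_less n v w \<longleftrightarrow> bruhat_le n v w \<and> v \<noteq> w"

definition matches :: "nat list \<Rightarrow> nat list \<Rightarrow> bool" where
  "matches ys u \<longleftrightarrow> length ys = length u \<and>
     (\<forall>i<length u. \<forall>j<length u. u ! i < u ! j \<longleftrightarrow> ys ! i < ys ! j)"

definition avoids :: "nat \<Rightarrow> perm \<Rightarrow> nat list \<Rightarrow> bool" where
  "avoids n w u \<longleftrightarrow>
     \<not> (\<exists>is. set is \<subseteq> {1..n} \<and> sorted_wrt (<) is \<and> matches (map w is) u)"

definition gap3412 :: "nat \<Rightarrow> perm \<Rightarrow> int" where
  "gap3412 n w = Min {int (w i1) - int (w i4) | i1 i2 i3 i4.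
     1 \<le> i1 \<and> i1 < i2 \<and> i2 < i3 \<and> i3 < i4 \<and> i4 \<le> n \<and>
     matches [w i1, w i2, w i3, w i4] [3, 4, 1, 2]}"

definition reversal :: "nat \<Rightarrow> nat \<Rightarrow> perm" where
  "reversal a b = (\<lambda>x. if a \<le> x \<and> x \<le> b then a + b - x else x)"


section \<open>The Hecke algebra\<close>

text \<open>
  The coefficient ring of Laurent polynomials in \<open>q\<^sup>1\<^sup>/\<^sup>2\<close>: the coefficient of
  \<open>(q\<^sup>1\<^sup>/\<^sup>2)\<^sup>k\<close> is stored at \<open>k\<close>.
\<close>

type_synonym laurent = "int \<Rightarrow>\<^sub>0 int"

definition q_half :: laurent where
  "q_half = Poly_Mapping.single 1 1"

definition q :: laurent where
  "q = q_half ^ 2"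

definition laurent_bar :: "laurent \<Rightarrow> laurent" where
  "laurent_bar = Poly_Mapping.map_key uminus"

text \<open>
  An element of the algebra is its coordinate function with respect to the natural basis
  \<open>T\<^sub>w\<close>, and vanishes outside \<open>Sym n\<close>.
\<close>

type_synonym hecke = "perm \<Rightarrow> laurent"

definition Hecke :: "nat \<Rightarrow> hecke set" where
  "Hecke n = {h. \<forall>w. w \<notin> Sym n \<longrightarrow> h w = 0}"

definition T :: "perm \<Rightarrow> hecke" where
  "T w = (\<lambda>u. if u = w then 1 else 0)"

definition scale :: "laurent \<Rightarrow> hecke \<Rightarrow> hecke" where
  "scale c h = (\<lambda>u. c * h u)"

text \<open>The family is indexed by permutations, and so are the coefficients \<open>c\<close>.\<close>

definition lincomb :: "nat \<Rightarrow> hecke \<Rightarrow> (perm \<Rightarrow> hecke) \<Rightarrow> hecke" where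
  "lincomb n c B = (\<lambda>u. \<Sum>w\<in>Sym n. c w * B w u)"

definition gen_T :: "nat \<Rightarrow> nat \<Rightarrow> perm \<Rightarrow> hecke" where
  "gen_T n i w =
     (if bruhat_less n w (adj i \<circ> w) then T (adj i \<circ> w)
      else (\<lambda>u. (q - 1) * T w u + q * T (adj i \<circ> w) u))"

definition gen_mult :: "nat \<Rightarrow> nat \<Rightarrow> hecke \<Rightarrow> hecke" where
  "gen_mult n i h = lincomb n h (gen_T n i)"

text \<open>
  Left multiplication by \<open>T\<^sub>u\<close> is forced to be the composite of the left multiplications by
  the generators along a reduced word of \<open>u\<close>. The choice of word is immaterial, because the
  maps \<open>gen_mult n i\<close> satisfy the braid relations (Matsumoto).
\<close>

definition T_mult :: "nat \<Rightarrow> perm \<Rightarrow> hecke \<Rightarrow> hecke" where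
  "T_mult n u h = foldr (gen_mult n) (SOME is. reduced_word n u is) h"

definition hmult :: "nat \<Rightarrow> hecke \<Rightarrow> hecke \<Rightarrow> hecke" where
  "hmult n x y = lincomb n x (\<lambda>u. T_mult n u y)"

definition hone :: hecke where
  "hone = T id"

definition hprod :: "nat \<Rightarrow> hecke list \<Rightarrow> hecke" where
  "hprod n xs = foldr (hmult n) xs hone"

definition hinverse :: "nat \<Rightarrow> hecke \<Rightarrow> hecke" where
  "hinverse n x = (THE y. y \<in> Hecke n \<and> hmult n x y = hone \<and> hmult n y x = hone)"

definition hbar :: "nat \<Rightarrow> hecke \<Rightarrow> hecke" where
  "hbar n h = lincomb n (\<lambda>w. laurent_bar (h w)) (\<lambda>w. hinverse n (T (inv w)))"


subsection \<open>The defining relations of the multiplication\<close>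

lemma finite_Sym: "finite (Sym n)"
  by (simp add: Sym_def finite_permutations)

lemma lincomb_T: "w \<in> Sym n \<Longrightarrow> lincomb n (T w) B = B w"
  by (rule ext) (simp add: lincomb_def T_def finite_Sym if_distrib [of "\<lambda>c. c * _"] cong: if_cong)

lemma reduced_word_id: "reduced_word n id is \<longleftrightarrow> is = []"
proof -
  have "word_for n id []" by (simp add: word_for_def word_perm_def)
  then have "len n id = 0"
    unfolding len_def by (intro Least_equality) auto
  with \<open>word_for n id []\<close> show ?thesis by (auto simp: reduced_word_def)
qed

lemma adj_in_Sym: "1 \<le> i \<Longrightarrow> i < n \<Longrightarrow> adj i \<in> Sym n"
  by (auto simp: Sym_def adj_def intro: permutes_swap_id)

lemma adj_eq_iff: "adj i = adj j \<longleftrightarrow> i = j"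
proof
  assume "adj i = adj j"
  then have "transpose i (Suc i) i = transpose j (Suc j) i"
    "transpose i (Suc i) (Suc i) = transpose j (Suc j) (Suc i)"
    by (simp_all add: adj_def)
  then show "i = j" by (auto simp: transpose_def split: if_splits)
qed simp

lemma reduced_word_adj:
  assumes "1 \<le> i" "i < n"
  shows "reduced_word n (adj i) is \<longleftrightarrow> is = [i]"
proof -
  have w: "word_for n (adj i) [i]"
    using assms by (simp add: word_for_def word_perm_def)
  have ne: "adj i \<noteq> id"
  proof
    assume "adj i = id"
    then have "transpose i (Suc i) i = i" by (simp add: adj_def)
    then show False by simp
  qed
  have "len n (adj i) = 1"
    unfolding len_def
  proof (rule Least_equality)
    show "\<exists>is. word_for n (adj i) is \<and> length is = 1" using w by force
    fix k assume "\<exists>is. word_for n (adj i) is \<and> length is = k"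
    then obtain js where js: "word_for n (adj i) js" "length js = k" by blast
    then have "js \<noteq> []" using ne by (auto simp: word_for_def word_perm_def)
    with js show "1 \<le> k" by (cases js) auto
  qed
  with w show ?thesis
    by (auto simp: reduced_word_def length_Suc_conv word_for_def word_perm_def adj_eq_iff)
qed

lemma hone_hmult: "h \<in> Hecke n \<Longrightarrow> hmult n hone h = h"
  by (simp add: hmult_def hone_def lincomb_T T_mult_def ext [of "reduced_word n id", OF reduced_word_id]
      Sym_def permutes_id)

lemma T_adj_hmult_T:
  assumes "1 \<le> i" "i < n" "w \<in> Sym n"
  shows "hmult n (T (adj i)) (T w) =
     (if bruhat_less n w (adj i \<circ> w) then T (adj i \<circ> w)
      else (\<lambda>u. (q - 1) * T w u + q * T (adj i \<circ> w) u))"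
  using assms
  by (simp add: hmult_def lincomb_T adj_in_Sym T_mult_def
      ext [of "reduced_word n (adj i)", OF reduced_word_adj] gen_mult_def flip: gen_T_def)


section \<open>The Kazhdan--Lusztig basis\<close>

definition is_basis :: "nat \<Rightarrow> (perm \<Rightarrow> hecke) \<Rightarrow> bool" where
  "is_basis n B \<longleftrightarrow> (\<forall>w\<in>Sym n. B w \<in> Hecke n) \<and>
     (\<forall>h\<in>Hecke n. \<exists>!c. c \<in> Hecke n \<and> h = lincomb n c B)"

definition at_q :: "int poly \<Rightarrow> laurent" where
  "at_q p = poly (map_poly of_int p) q"

text \<open>
  Families are set to \<open>0\<close> outside \<open>Sym n\<close>, so that the Kazhdan--Lusztig basis is
  unique as a function.
\<close>

definition is_KL_basis :: "nat \<Rightarrow> (perm \<Rightarrow> hecke) \<Rightarrow> bool" where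
  "is_KL_basis n C \<longleftrightarrow>
     is_basis n C \<and>
     (\<forall>w. w \<notin> Sym n \<longrightarrow> C w = (\<lambda>_. 0)) \<and>
     (\<forall>w\<in>Sym n. hbar n (C w) = C w) \<and>
     (\<exists>P :: perm \<Rightarrow> perm \<Rightarrow> int poly. \<forall>w\<in>Sym n.
        scale (q_half ^ len n w) (C w) =
          (\<lambda>u. \<Sum>v\<in>{v \<in> Sym n. bruhat_le n v w}. at_q (P v w) * T v u) \<and>
        P w w = 1 \<and>
        (\<forall>v\<in>Sym n. bruhat_less n v w \<longrightarrow>
           real (degree (P v w)) \<le> (real (len n w) - real (len n v) - 1) / 2))"

definition KL_basis :: "nat \<Rightarrow> perm \<Rightarrow> hecke" where
  "KL_basis n = (THE C. is_KL_basis n C)"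

definition KL_tilde :: "nat \<Rightarrow> perm \<Rightarrow> hecke" where
  "KL_tilde n w = scale (q_half ^ len n w) (KL_basis n w)"


section \<open>Parabolic factorizations\<close>

definition q_fact :: "nat \<Rightarrow> laurent" where
  "q_fact k = (\<Prod>i=1..k. \<Sum>j<i. q ^ j)"

text \<open>Sequences of intervals are lists of pairs of endpoints, so indices start at \<open>0\<close>.\<close>

definition interval :: "(nat \<times> nat) list \<Rightarrow> nat \<Rightarrow> nat set" where
  "interval A i = {fst (A ! i)..snd (A ! i)}"

definition overlap :: "(nat \<times> nat) list \<Rightarrow> nat \<Rightarrow> nat \<Rightarrow> nat set" where
  "overlap A i j = (interval A i \<inter> interval A j) - (\<Union>k\<in>{i<..<j}. interval A k)"

definition f_poly :: "(nat \<times> nat) list \<Rightarrow> laurent" where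
  "f_poly A = (\<Prod>(i, j)\<in>{(i, j). i < j \<and> j < length A}. q_fact (card (overlap A i j)))"

text \<open>
  Division by \<open>f_poly A\<close> is not available in the coefficient ring; as the algebra is a free
  module over an integral domain, the denominator is cleared.
\<close>

definition has_parabolic_factorization :: "nat \<Rightarrow> perm \<Rightarrow> bool" where
  "has_parabolic_factorization n w \<longleftrightarrow>
     (\<exists>A :: (nat \<times> nat) list.
        (\<forall>(a, b)\<in>set A. 1 \<le> a \<and> a \<le> b \<and> b \<le> n) \<and>
        scale (f_poly A) (KL_tilde n w) =
          hprod n (map (\<lambda>(a, b). KL_tilde n (reversal a b)) A))"

end

theory Submission
  imports Defs
begin

text \<open>
  Suppose that \<open>KL_tilde n w\<close>, multiplied by \<open>f_poly A\<close>, is the product of the parabolic sums of the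
  intervals of \<open>A\<close>. Evaluating \<open>T v\<close> at \<open>q ^ len n v\<close> shows that the Poincare polynomial of \<open>w\<close>, weighted
  by the Kazhdan--Lusztig polynomials, is a quotient of palindromic polynomials, hence palindromic, so its
  linear coefficient is the number of coatoms of \<open>w\<close>. Avoidance of 4231 and a gap larger than 1 bound this
  number by the number of simple reflections below \<open>w\<close>. Comparing with the linear coefficient of the
  quotient, the graph whose vertices are the factors and whose edges are the nonempty overlaps is a forest.
  On the other hand, \<open>w\<close> has maximal length in the product of the parabolic subgroups, so two wires of the
  corresponding network meet exactly if they form an inversion of \<open>w\<close>; hence the four wires of a
  pattern 3412 run through a cycle.
\<close>

section \<open>Length and Bruhat order\<close>

text \<open>The forest property is a count. Let \<open>m\<close> be the number of factors,
  \<open>E\<close> the set of index pairs with nonempty overlap, \<open>U\<close> the set of covered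
  positions, and \<open>D\<close> the set of \<open>p\<close> such that some interval contains both
  \<open>p\<close> and \<open>p + 1\<close>. Linear coefficients are additive on palindromic
  polynomials: a factor contributes \<open>b - a\<close> and \<open>q_fact k\<close> with
  \<open>k > 0\<close> contributes \<open>k - 1\<close>, so the Poincare polynomial of
  \<open>w\<close> has linear coefficient \<open>|U| - m + |E|\<close>, and this is at most
  \<open>|D|\<close>. Now \<open>|U| - |D|\<close> counts the blocks of positions, which are at
  least as many as the components of the graph; one cycle breaks the inequality. The product, the
  inverse and the basis are given by \<open>SOME\<close> and \<open>THE\<close>, so they must be
  pinned down before anything can be evaluated. The tool for the product is a right action commuting
  with the left generators: an operator commuting with it is determined by its value at
  \<open>T id\<close>, which yields both independence of the reduced word and associativity.\<close>

definition inversions :: "nat \<Rightarrow> perm \<Rightarrow> (nat \<times> nat) set" where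
  "inversions n w = {(i, j). 1 \<le> i \<and> i < j \<and> j \<le> n \<and> w j < w i}"

text \<open>The condition that \<open>adj i \<circ> w\<close> is longer than \<open>w\<close>, in
  terms of the positions of the values \<open>i\<close> and \<open>Suc i\<close>;
  \<open>len_up\<close> and \<open>len_down\<close> give the equivalence.\<close>

definition left_ascent :: "nat \<Rightarrow> perm \<Rightarrow> bool" where
  "left_ascent i w \<longleftrightarrow> inv w i < inv w (Suc i)"

lemma finite_inversions: "finite (inversions n w)"
  by (rule finite_subset [of _ "{..n} \<times> {..n}"]) (auto simp: inversions_def)

lemma adj_adj [simp]: "adj i (adj i x) = x"
  by (simp add: adj_def)

lemma adj_apply [simp]: "adj i i = Suc i" "adj i (Suc i) = i"
  by (simp_all add: adj_def)

lemma adj_comp_adj [simp]: "adj i \<circ> (adj i \<circ> w) = w" "(w \<circ> adj i) \<circ> adj i = w"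
  by (simp_all add: fun_eq_iff)

lemma inv_adj [simp]: "inv (adj i) = adj i"
  by (simp add: adj_def)

lemma bij_adj: "bij (adj i)"
  by (simp add: adj_def)

lemma adj_less: "adj i a < adj i b \<longleftrightarrow> \<not> (a = i \<and> b = Suc i) \<and> (a = Suc i \<and> b = i \<or> a < b)"
  by (auto simp: adj_def transpose_def)

lemma Sym_bij: "w \<in> Sym n \<Longrightarrow> bij w"
  by (simp add: Sym_def permutes_bij)

lemma Sym_inv: "w \<in> Sym n \<Longrightarrow> inv w \<in> Sym n"
  by (simp add: Sym_def permutes_inv)

lemma Sym_comp: "v \<in> Sym n \<Longrightarrow> w \<in> Sym n \<Longrightarrow> v \<circ> w \<in> Sym n"
  by (simp add: Sym_def permutes_compose)

lemma Sym_id: "id \<in> Sym n"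
  by (simp add: Sym_def permutes_id)

lemma Sym_adj_left: "1 \<le> i \<Longrightarrow> i < n \<Longrightarrow> adj i \<circ> w \<in> Sym n \<longleftrightarrow> w \<in> Sym n"
  using Sym_comp [of "adj i" n w] Sym_comp [of "adj i" n "adj i \<circ> w"] adj_in_Sym [of i n] by auto

lemma Sym_adj_right: "1 \<le> i \<Longrightarrow> i < n \<Longrightarrow> w \<circ> adj i \<in> Sym n \<longleftrightarrow> w \<in> Sym n"
  using Sym_comp [of w n "adj i"] Sym_comp [of "w \<circ> adj i" n "adj i"] adj_in_Sym [of i n] by auto

lemma inv_adj_comp: "bij w \<Longrightarrow> inv (adj i \<circ> w) = inv w \<circ> adj i"
  by (simp add: o_inv_distrib bij_adj)

lemma inv_comp_adj: "bij w \<Longrightarrow> inv (w \<circ> adj i) = adj i \<circ> inv w"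
  by (simp add: o_inv_distrib bij_adj)

lemma left_ascent_adj: "bij w \<Longrightarrow> left_ascent i (adj i \<circ> w) \<longleftrightarrow> \<not> left_ascent i w"
proof -
  assume b: "bij w"
  then have "inv w i \<noteq> inv w (Suc i)"
    by (metis bij_inv_eq_iff n_not_Suc_n)
  then show ?thesis by (auto simp: left_ascent_def inv_adj_comp [OF b])
qed

lemma left_ascent_inv: "bij w \<Longrightarrow> left_ascent i (inv w) \<longleftrightarrow> w i < w (Suc i)"
  by (simp add: left_ascent_def inv_inv_eq)

text \<open>Left multiplication by \<open>adj i\<close> alters only the comparison of the
  neighbouring values \<open>i\<close> and \<open>Suc i\<close>, so exactly one pair of positions
  joins the inversions.\<close>

lemma inversions_adj_left:
  assumes w: "w \<in> Sym n" and i: "1 \<le> i" "i < n" and "left_ascent i w"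
  shows "inversions n (adj i \<circ> w) = insert (inv w i, inv w (Suc i)) (inversions n w)"
    and "(inv w i, inv w (Suc i)) \<notin> inversions n w"
proof -
  have b: "bij w" using w by (rule Sym_bij)
  have eq: "w x = y \<longleftrightarrow> x = inv w y" for x y
    using bij_inv_eq_iff [OF b, of x y] by auto
  have r: "inv w i \<in> {1..n}" "inv w (Suc i) \<in> {1..n}"
    using Sym_inv [OF w] i by (simp_all add: Sym_def permutes_in_image del: atLeastAtMost_iff) auto
  have less: "(adj i \<circ> w) y < (adj i \<circ> w) x \<longleftrightarrow> w y < w x \<or> x = inv w i \<and> y = inv w (Suc i)"
    if "x < y" for x y
  proof -
    have "\<not> (w y = i \<and> w x = Suc i)"
      using that \<open>left_ascent i w\<close> by (auto simp: eq left_ascent_def)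
    then show ?thesis by (auto simp: adj_less simp flip: eq)
  qed
  show "inversions n (adj i \<circ> w) = insert (inv w i, inv w (Suc i)) (inversions n w)"
    using r \<open>left_ascent i w\<close> by (auto simp: inversions_def less [unfolded o_apply] left_ascent_def)
  have "w (inv w i) = i" "w (inv w (Suc i)) = Suc i" using eq by blast+
  then show "(inv w i, inv w (Suc i)) \<notin> inversions n w" by (simp add: inversions_def)
qed

lemma card_inversions_up:
  assumes "w \<in> Sym n" "1 \<le> i" "i < n" "left_ascent i w"
  shows "card (inversions n (adj i \<circ> w)) = Suc (card (inversions n w))"
  using inversions_adj_left [OF assms] by (simp add: finite_inversions)

lemma card_inversions_down:
  assumes "w \<in> Sym n" "1 \<le> i" "i < n" "\<not> left_ascent i w"
  shows "card (inversions n w) = Suc (card (inversions n (adj i \<circ> w)))"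
  using card_inversions_up [of "adj i \<circ> w" n i] assms
  by (simp add: Sym_adj_left left_ascent_adj Sym_bij [of w n] flip: o_assoc)

lemma inversions_id [simp]: "inversions n id = {}"
  by (auto simp: inversions_def)

lemma ascending_permutes_id:
  fixes w :: perm
  assumes w: "w permutes {a..b}" and asc: "\<And>i. a \<le> i \<Longrightarrow> i < b \<Longrightarrow> w i < w (Suc i)"
  shows "w = id"
proof -
  have mono: "w i < w j" if "a \<le> i" "i < j" "j \<le> b" for i j
    using that(2,1,3)
  proof (induction j rule: less_Suc_induct)
    case (1 j) then show ?case using asc by simp
  next
    case (2 i j k) then show ?case by force
  qed
  have "w i = i" if "i \<in> {a..b}" for i
    using that
  proof (induction i rule: less_induct)
    case (less i)
    have "w i \<in> {a..b}" using w less.prems permutes_in_image by metis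
    have "\<not> w i < i"
    proof
      assume "w i < i"
      then have "w (w i) = w i" using less \<open>w i \<in> {a..b}\<close> by auto
      then show False using \<open>w i < i\<close> w by (metis permutes_inj injD less_irrefl)
    qed
    moreover have "\<not> i < w i"
    proof
      assume "i < w i"
      obtain j where j: "w j = i" "j \<in> {a..b}"
        using w less.prems by (metis permutes_def permutes_in_image)
      show False
      proof (cases "j < i")
        case True with less j \<open>i < w i\<close> show False by force
      next
        case False
        then have "i < j" using j \<open>i < w i\<close> by (metis linorder_neqE_nat less_irrefl)
        then show False using mono [of i j] j less.prems \<open>i < w i\<close> by auto
      qed
    qed
    ultimately show ?case by simp
  qed
  then show ?thesis using w by (auto simp: fun_eq_iff permutes_def)
qed

lemma permutes_adj: "a \<le> i \<Longrightarrow> i < b \<Longrightarrow> adj i permutes {a..b}"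
  by (auto simp: adj_def intro: permutes_swap_id)

lemma permutes_subset_Sym: "w permutes {a..b} \<Longrightarrow> 1 \<le> a \<Longrightarrow> b \<le> n \<Longrightarrow> w \<in> Sym n"
  by (auto simp: Sym_def intro: permutes_subset)

text \<open>A permutation of \<open>{a..b}\<close> other than \<open>id\<close> has a left descent
  inside \<open>{a..<b}\<close>, because its inverse cannot be ascending there; removing it stays in
  the parabolic subgroup and lowers the inversion count. With \<open>a = 1\<close> and
  \<open>b = n\<close> this is induction on length in \<open>Sym n\<close>.\<close>

lemma permutes_left_induct [consumes 3, case_names id step]:
  assumes w: "w permutes {a..b}" and ab: "1 \<le> a" "b \<le> n"
    and "P id"
    and step: "\<And>i v. a \<le> i \<Longrightarrow> i < b \<Longrightarrow> v permutes {a..b} \<Longrightarrow> left_ascent i v \<Longrightarrow> P v \<Longrightarrow> P (adj i \<circ> v)"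
  shows "P w"
  using w
proof (induction "card (inversions n w)" arbitrary: w rule: less_induct)
  case less
  show ?case
  proof (cases "w = id")
    case True with \<open>P id\<close> show ?thesis by simp
  next
    case False
    then have "inv w \<noteq> id" using permutes_inv_inv [OF less.prems] by auto
    then obtain i where i: "a \<le> i" "i < b" "\<not> left_ascent i w"
      using ascending_permutes_id [OF permutes_inv [OF less.prems]] unfolding left_ascent_def by blast
    let ?v = "adj i \<circ> w"
    have "?v permutes {a..b}" using permutes_compose [OF less.prems permutes_adj] i by simp
    moreover have "left_ascent i ?v" using i less.prems by (simp add: left_ascent_adj permutes_bij)
    moreover have "card (inversions n ?v) < card (inversions n w)"
      using card_inversions_down [of w n i] permutes_subset_Sym [OF less.prems ab] ab i by simp
    ultimately show ?thesis using step [of i ?v] less.hyps [of ?v] i by simp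
  qed
qed

lemma word_perm_Cons: "word_perm (i # is) = adj i \<circ> word_perm is"
  by (simp add: word_perm_def)

text \<open>Each letter changes the inversion count by exactly one, which bounds word lengths from
  below; \<open>exists_parabolic_word\<close> attains the bound with letters from the interval
  alone.\<close>

lemma word_forD:
  assumes "word_for n w is" shows "w \<in> Sym n" "card (inversions n w) \<le> length is"
proof -
  have "set is \<subseteq> {1..<n} \<Longrightarrow> word_perm is \<in> Sym n \<and> card (inversions n (word_perm is)) \<le> length is"
  proof (induction "is")
    case Nil
    have "word_perm [] = id" by (simp add: word_perm_def)
    then show "word_perm [] \<in> Sym n \<and> card (inversions n (word_perm [])) \<le> length []"
      by (simp add: Sym_id)
  next
    case (Cons i "is")
    let ?v = "word_perm is"
    have i: "1 \<le> i" "i < n" using Cons.prems by auto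
    from Cons have "?v \<in> Sym n" "card (inversions n ?v) \<le> length is" by auto
    with i card_inversions_up [of ?v n i] card_inversions_down [of ?v n i]
    show "word_perm (i # is) \<in> Sym n \<and> card (inversions n (word_perm (i # is))) \<le> length (i # is)"
      by (cases "left_ascent i ?v") (auto simp: Sym_adj_left word_perm_Cons)
  qed
  then show "w \<in> Sym n" "card (inversions n w) \<le> length is" using assms by (auto simp: word_for_def)
qed

lemma exists_parabolic_word:
  assumes "w permutes {a..b}" "1 \<le> a" "b \<le> n"
  shows "\<exists>is. set is \<subseteq> {a..<b} \<and> word_for n w is \<and> length is = card (inversions n w)"
  using assms
proof (induction rule: permutes_left_induct)
  case id
  show "\<exists>is. set is \<subseteq> {a..<b} \<and> word_for n id is \<and> length is = card (inversions n id)"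
    by (intro exI [of _ "[]"]) (simp add: word_for_def word_perm_def)
next
  case (step i v)
  then obtain "is" where "set is \<subseteq> {a..<b}" "word_for n v is" "length is = card (inversions n v)" by blast
  then show "\<exists>is. set is \<subseteq> {a..<b} \<and> word_for n (adj i \<circ> v) is \<and> length is = card (inversions n (adj i \<circ> v))"
    using step assms card_inversions_up [of v n i] permutes_subset_Sym [of v a b n]
    by (intro exI [of _ "i # is"]) (auto simp: word_for_def word_perm_Cons)
qed

lemma len_eq_card_inversions:
  assumes "w \<in> Sym n" shows "len n w = card (inversions n w)"
  unfolding len_def
  using assms exists_parabolic_word [of w 1 n n] word_forD(2)
  by (intro Least_equality) (auto simp: Sym_def)

lemma reduced_word_parabolic:
  assumes "w permutes {a..b}" "1 \<le> a" "b \<le> n"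
  shows "\<exists>is. set is \<subseteq> {a..<b} \<and> reduced_word n w is"
  using exists_parabolic_word [OF assms] len_eq_card_inversions permutes_subset_Sym [OF assms]
  by (auto simp: reduced_word_def)

lemma len_up:
  assumes "w \<in> Sym n" "1 \<le> i" "i < n" "left_ascent i w"
  shows "len n (adj i \<circ> w) = Suc (len n w)"
  using assms by (simp add: len_eq_card_inversions Sym_adj_left card_inversions_up)

lemma len_down:
  assumes "w \<in> Sym n" "1 \<le> i" "i < n" "\<not> left_ascent i w"
  shows "len n w = Suc (len n (adj i \<circ> w))"
  using assms by (simp add: len_eq_card_inversions Sym_adj_left flip: card_inversions_down)

lemma len_id: "len n id = 0"
  by (simp add: len_eq_card_inversions Sym_id)

lemma len_inv:
  assumes w: "w \<in> Sym n" shows "len n (inv w) = len n w"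
proof -
  have b: "bij w" using w by (rule Sym_bij)
  have in_range: "w x \<in> {1..n} \<longleftrightarrow> x \<in> {1..n}" for x
    using w by (simp add: Sym_def permutes_in_image del: atLeastAtMost_iff)
  have "bij_betw (\<lambda>(i, j). (w j, w i)) (inversions n w) (inversions n (inv w))"
  proof (rule bij_betw_imageI)
    show "inj_on (\<lambda>(i, j). (w j, w i)) (inversions n w)"
      using b by (auto simp: inj_on_def bij_def)
    show "(\<lambda>(i, j). (w j, w i)) ` inversions n w = inversions n (inv w)"
    proof (intro equalityI subsetI)
      fix x assume "x \<in> (\<lambda>(i, j). (w j, w i)) ` inversions n w"
      then obtain i j where ij: "(i, j) \<in> inversions n w" "x = (w j, w i)" by auto
      then have "w i \<in> {1..n}" "w j \<in> {1..n}" unfolding in_range by (auto simp: inversions_def)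
      with ij b show "x \<in> inversions n (inv w)" by (auto simp: inversions_def bij_def inv_f_f)
    next
      fix x assume "x \<in> inversions n (inv w)"
      then obtain i j where ij: "(i, j) \<in> inversions n (inv w)" "x = (i, j)" by (cases x) auto
      have "w (inv w y) = y" for y using b by (simp add: bij_def surj_f_inv_f)
      moreover from this ij have "inv w i \<in> {1..n}" "inv w j \<in> {1..n}"
        using in_range [of "inv w i"] in_range [of "inv w j"] by (auto simp: inversions_def)
      ultimately show "x \<in> (\<lambda>(i, j). (w j, w i)) ` inversions n w"
        using ij by (intro image_eqI [of _ _ "(inv w j, inv w i)"]) (auto simp: inversions_def)
    qed
  qed
  then show ?thesis using w by (simp add: len_eq_card_inversions Sym_inv bij_betw_same_card)
qed

lemma len_right_up:
  assumes "w \<in> Sym n" "1 \<le> i" "i < n" "w i < w (Suc i)"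
  shows "len n (w \<circ> adj i) = Suc (len n w)"
  using len_up [of "inv w" n i] assms
  by (simp add: Sym_inv left_ascent_inv Sym_bij [of w n] len_inv Sym_adj_right flip: inv_comp_adj)

lemma len_right_down:
  assumes "w \<in> Sym n" "1 \<le> i" "i < n" "w (Suc i) < w i"
  shows "len n w = Suc (len n (w \<circ> adj i))"
  using len_down [of "inv w" n i] assms
  by (simp add: Sym_inv left_ascent_inv Sym_bij [of w n] len_inv Sym_adj_right flip: inv_comp_adj)

lemma Sym_transpose: "1 \<le> a \<Longrightarrow> a \<le> n \<Longrightarrow> 1 \<le> b \<Longrightarrow> b \<le> n \<Longrightarrow> w \<in> Sym n \<Longrightarrow> w \<circ> transpose a b \<in> Sym n"
  by (rule Sym_comp) (auto simp: Sym_def intro: permutes_swap_id)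

lemma len_transpose:
  assumes "w \<in> Sym n" "1 \<le> a" "a < b" "b \<le> n" "w a < w b"
  shows "len n w < len n (w \<circ> transpose a b)"
  using assms
proof (induction "b - a" arbitrary: a w)
  case 0 then show ?case by simp
next
  case (Suc d)
  show ?case
  proof (cases "b = Suc a")
    case True
    then show ?thesis using len_right_up [of w n a] Suc.prems by (simp flip: adj_def)
  next
    case False
    then have ab: "Suc a < b" using Suc.prems by simp
    let ?s = "adj a"
    have wne: "w (Suc a) \<noteq> w a" "w (Suc a) \<noteq> w b"
      using ab Sym_bij [OF Suc.prems(1)] by (auto simp: bij_def dest: injD)
    let ?x = "w \<circ> ?s" and ?y = "w \<circ> ?s \<circ> transpose (Suc a) b"
    have x: "?x \<in> Sym n" "?x (Suc a) = w a" "?x b = w b" "?x a = w (Suc a)"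
      using Suc.prems ab by (simp_all add: Sym_adj_right) (simp add: adj_def transpose_def)
    then have 1: "len n ?x < len n ?y"
      using Suc.hyps(1) [of "Suc a" ?x] Suc.hyps(2) Suc.prems ab by simp
    have y: "?y \<in> Sym n" "?y a = w (Suc a)" "?y (Suc a) = w b"
      using Sym_transpose [of "Suc a" n b ?x] x(1) Suc.prems ab
      by (auto simp: adj_def transpose_def)
    have z: "w \<circ> transpose a b = ?y \<circ> ?s"
      using ab by (auto simp: fun_eq_iff adj_def transpose_def)
    have a: "1 \<le> a" "a < n" using Suc.prems by auto
    \<comment> \<open>The outer factors \<open>adj a\<close> change the length by one each. If the
      first one shortens, then \<open>w (Suc a) < w a < w b\<close> makes the last one lengthen;
      otherwise the first gain pays for a possible loss at the end. The middle step is a strict gain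
      by induction.\<close>
    have "w (Suc a) < w a \<Longrightarrow> len n w = Suc (len n ?x) \<and> len n (?y \<circ> ?s) = Suc (len n ?y)"
      using len_right_down [of w n a] len_right_up [of ?y n a] Suc.prems a y by auto
    moreover have "w a < w (Suc a) \<Longrightarrow> len n ?x = Suc (len n w)"
      using len_right_up [of w n a] Suc.prems a by auto
    moreover have "len n (?y \<circ> ?s) = Suc (len n ?y) \<or> len n ?y = Suc (len n (?y \<circ> ?s))"
      using len_right_down [of ?y n a] len_right_up [of ?y n a] a y wne
      by (metis linorder_neqE_nat)
    ultimately show ?thesis unfolding z using 1 wne by linarith
  qed
qed

lemma len_transpose_down:
  assumes "w \<in> Sym n" "1 \<le> a" "a < b" "b \<le> n" "w b < w a"
  shows "len n (w \<circ> transpose a b) < len n w"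
  using len_transpose [of "w \<circ> transpose a b" n a b] assms
  by (simp add: Sym_transpose o_assoc [symmetric])

lemma len_transpose_iff:
  assumes "w \<in> Sym n" "1 \<le> a" "a < b" "b \<le> n"
  shows "len n w < len n (w \<circ> transpose a b) \<longleftrightarrow> w a < w b"
proof -
  have "w a \<noteq> w b" using Sym_bij assms by (auto simp: bij_def dest: injD)
  then show ?thesis using len_transpose [OF assms] len_transpose_down [OF assms] by (meson linorder_neqE_nat not_less_iff_gr_or_eq)
qed

text \<open>Three successive length-decreasing transpositions realise \<open>w \<circ> transpose a b\<close> when a value lies in between.\<close>

lemma len_transpose_not_cover:
  assumes w: "w \<in> Sym n" and "1 \<le> a" "a < c" "c < b" "b \<le> n" "w b < w c" "w c < w a"
  shows "len n (w \<circ> transpose a b) + 3 \<le> len n w"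
proof -
  let ?x = "w \<circ> transpose a c" let ?y = "?x \<circ> transpose c b" let ?z = "?y \<circ> transpose a c"
  have "?x \<in> Sym n" "?y \<in> Sym n" using assms by (auto intro!: Sym_transpose)
  moreover have "?x b < ?x c" "?y c < ?y a" using assms by (auto simp: transpose_def)
  ultimately have "len n ?z < len n ?y" "len n ?y < len n ?x" "len n ?x < len n w"
    using assms by (auto intro!: len_transpose_down)
  moreover have "?z = w \<circ> transpose a b" using assms by (auto simp: fun_eq_iff transpose_def)
  ultimately show ?thesis by simp
qed

section \<open>Chains in Bruhat order and the lifting property\<close>

lemma bruhat_le_len: "bruhat_le n v w \<Longrightarrow> len n v \<le> len n w"
  unfolding bruhat_le_def
  by (induction rule: rtranclp_induct) (auto simp: bruhat_step_def)

lemma bruhat_less_len: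
  assumes "bruhat_less n v w" shows "len n v < len n w"
proof -
  have "(bruhat_step n)\<^sup>*\<^sup>* v w" "v \<noteq> w"
    using assms by (simp_all add: bruhat_less_def bruhat_le_def)
  then obtain u where "bruhat_step n v u" "bruhat_le n u w"
    by (metis bruhat_le_def converse_rtranclpE)
  then show ?thesis using bruhat_le_len [of n u w] by (simp add: bruhat_step_def)
qed

lemma bruhat_stepI:
  assumes "v \<in> Sym n" "1 \<le> a" "a < b" "b \<le> n" "v a < v b"
  shows "bruhat_step n v (v \<circ> transpose a b)"
  using assms len_transpose unfolding bruhat_step_def by blast

lemma transpose_conj: "bij w \<Longrightarrow> transpose i j \<circ> w = w \<circ> transpose (inv w i) (inv w j)"
  by (auto simp: fun_eq_iff transpose_def bij_def inv_f_f surj_f_inv_f)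

lemma bruhat_step_adj:
  assumes w: "w \<in> Sym n" and i: "1 \<le> i" "i < n" and left_ascent: "left_ascent i w"
  shows "bruhat_step n w (adj i \<circ> w)"
proof -
  have b: "bij w" using w by (rule Sym_bij)
  have "inv w i \<in> {1..n}" "inv w (Suc i) \<in> {1..n}"
    using Sym_inv [OF w] i by (simp_all add: Sym_def permutes_in_image del: atLeastAtMost_iff) auto
  moreover have "w (inv w y) = y" for y using b by (simp add: bij_def surj_f_inv_f)
  ultimately show ?thesis
    unfolding adj_def transpose_conj [OF b] using left_ascent w by (intro bruhat_stepI) (auto simp: left_ascent_def)
qed

lemma bruhat_less_adj_iff:
  assumes "w \<in> Sym n" "1 \<le> i" "i < n"
  shows "bruhat_less n w (adj i \<circ> w) \<longleftrightarrow> left_ascent i w"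
proof
  assume "bruhat_less n w (adj i \<circ> w)"
  then show "left_ascent i w" using bruhat_less_len [of n w] len_down [of w n i] assms by fastforce
next
  assume "left_ascent i w"
  then have "bruhat_step n w (adj i \<circ> w)" using bruhat_step_adj assms by blast
  moreover from this have "w \<noteq> adj i \<circ> w" by (auto simp: bruhat_step_def)
  ultimately show "bruhat_less n w (adj i \<circ> w)"
    unfolding bruhat_less_def bruhat_le_def by blast
qed

text \<open>Left multiplication by \<open>adj i\<close> keeps the order of the two exchanged values
  unless they are \<open>i\<close> and \<open>Suc i\<close>; in that case the reflection on the
  right equals \<open>adj i\<close> on the left.\<close>

lemma bruhat_step_lift:
  assumes st: "bruhat_step n x y" and i: "1 \<le> i" "i < n"
  shows "adj i \<circ> x = y \<or> bruhat_step n (adj i \<circ> x) (adj i \<circ> y)"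
proof -
  from st obtain a b where ab: "1 \<le> a" "a < b" "b \<le> n" "y = x \<circ> transpose a b" and x: "x \<in> Sym n"
    by (auto simp: bruhat_step_def)
  have lt: "x a < x b" using len_transpose_iff [of x n a b] st ab x by (simp add: bruhat_step_def)
  show ?thesis
  proof (cases "x a = i \<and> x b = Suc i")
    case True
    have "inv x i = a" "inv x (Suc i) = b"
      using True Sym_bij [OF x] by (auto simp: bij_def inv_f_eq)
    then have "y = adj i \<circ> x"
      using transpose_conj [OF Sym_bij [OF x], of i "Suc i"] ab by (simp add: adj_def)
    then show ?thesis by simp
  next
    case False
    then have "(adj i \<circ> x) a < (adj i \<circ> x) b" using lt by (auto simp: adj_less)
    then show ?thesis
      using bruhat_stepI [of "adj i \<circ> x" n a b] ab x i by (simp add: Sym_adj_left comp_assoc)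
  qed
qed

lemma bruhat_le_refl [simp]: "bruhat_le n w w"
  by (simp add: bruhat_le_def)

lemma bruhat_le_trans: "bruhat_le n u v \<Longrightarrow> bruhat_le n v w \<Longrightarrow> bruhat_le n u w"
  by (simp add: bruhat_le_def)

lemma bruhat_step_le: "bruhat_step n v w \<Longrightarrow> bruhat_le n v w"
  by (simp add: bruhat_le_def)

text \<open>Induction down the chain from \<open>w\<close>: a step either lifts, or it is
  exceptional and \<open>adj i \<circ> x\<close> is the next chain element, which already lies below
  \<open>adj i \<circ> w\<close>.\<close>

lemma bruhat_le_lift:
  assumes "bruhat_le n x w" and w: "w \<in> Sym n" "left_ascent i w" and i: "1 \<le> i" "i < n"
  shows "bruhat_le n x (adj i \<circ> w) \<and> bruhat_le n (adj i \<circ> x) (adj i \<circ> w)"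
  using assms(1) unfolding bruhat_le_def
proof (induction rule: converse_rtranclp_induct)
  case base
  show ?case using bruhat_step_adj [OF w(1) i w(2)] by blast
next
  case (step x y)
  show ?case
  proof
    show "(bruhat_step n)\<^sup>*\<^sup>* x (adj i \<circ> w)" using step by (meson converse_rtranclp_into_rtranclp)
    from bruhat_step_lift [OF step(1) i]
    show "(bruhat_step n)\<^sup>*\<^sup>* (adj i \<circ> x) (adj i \<circ> w)"
      using step by (metis converse_rtranclp_into_rtranclp)
  qed
qed

section \<open>The Hecke algebra as a bimodule\<close>

abbreviation qp :: "int \<Rightarrow> laurent" where
  "qp k \<equiv> Poly_Mapping.single k 1"

abbreviation coef :: "laurent \<Rightarrow> int \<Rightarrow> int" where
  "coef \<equiv> Poly_Mapping.lookup"

lemma q_half_power: "q_half ^ m = qp (int m)"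
  by (induction m) (simp_all add: q_half_def mult_single)

lemma q_eq: "q = qp 2"
  by (simp add: q_def q_half_power)

lemma qp_mult [simp]: "qp a * qp b = qp (a + b)"
  by (simp add: mult_single)

lemma qp_mult_left [simp]: "qp a * (qp b * x) = qp (a + b) * x"
  by (simp flip: mult.assoc)

lemma lookup_qp_mult: "coef (qp k * x) j = coef x (j - k)"
proof -
  have 1: "(\<lambda>l. (1 when k = l) * c l) = (\<lambda>l. c l when l = k)" for c :: "int \<Rightarrow> int"
    by (auto simp: when_def)
  have 2: "(\<lambda>m. coef x m when j = k + m) = (\<lambda>m. coef x m when m = j - k)"
    by (auto simp: when_def)
  show ?thesis unfolding lookup_mult lookup_single 1 Sum_any_when_equal 2 ..
qed

lemma lookup_laurent_bar: "coef (laurent_bar x) k = coef x (- k)"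
  by (simp add: laurent_bar_def map_key.rep_eq)

lemma laurent_bar_add: "laurent_bar (x + y) = laurent_bar x + laurent_bar y"
  by (rule poly_mapping_eqI) (simp only: lookup_laurent_bar lookup_add)

lemma laurent_bar_diff: "laurent_bar (x - y) = laurent_bar x - laurent_bar y"
  by (rule poly_mapping_eqI) (simp only: lookup_laurent_bar lookup_minus)

lemma laurent_bar_single: "laurent_bar (Poly_Mapping.single k c) = Poly_Mapping.single (- k) c"
  by (rule poly_mapping_eqI) (auto simp: lookup_laurent_bar lookup_single when_def)

lemma laurent_bar_simps [simp]:
  "laurent_bar (qp k) = qp (- k)" "laurent_bar 0 = 0" "laurent_bar 1 = 1"
  using laurent_bar_single [of _ 1] laurent_bar_single [of 0 0] laurent_bar_single [of 0 1] by simp_all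

lemma laurent_bar_of_int [simp]: "laurent_bar (of_int c) = of_int c"
  by (simp add: laurent_bar_single flip: single_of_int)

lemma laurent_induct [case_names single add]:
  fixes x :: laurent
  assumes "\<And>k c. P (Poly_Mapping.single k c)" "\<And>x y. P x \<Longrightarrow> P y \<Longrightarrow> P (x + y)"
  shows "P x"
proof (induction x rule: Poly_Mapping.update_induct)
  case const
  show ?case using assms(1) [of 0 0] by simp
next
  case (update f a b)
  have "Poly_Mapping.update a b f = f + Poly_Mapping.single a b"
    using update by (auto intro!: poly_mapping_eqI simp: lookup_update lookup_add lookup_single in_keys_iff)
  then show ?case using assms(2) [OF update(3) assms(1)] by simp
qed

lemma laurent_bar_mult: "laurent_bar (x * y) = laurent_bar x * laurent_bar y"
proof (induction x rule: laurent_induct)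
  case (single k c)
  show ?case
    by (induction y rule: laurent_induct)
      (simp_all add: mult_single laurent_bar_single distrib_left laurent_bar_add)
qed (simp add: distrib_right laurent_bar_add)

text \<open>The coefficient of \<open>T u\<close> in \<open>T (adj i)\<close> times
  \<open>h\<close>, collected from the basis elements at \<open>u\<close> and at
  \<open>adj i \<circ> u\<close>; only the longer of the two brings in \<open>q\<close> or
  \<open>q - 1\<close>. \<open>right_T\<close> is the mirror image.\<close>

definition left_T :: "nat \<Rightarrow> nat \<Rightarrow> hecke \<Rightarrow> hecke" where
  "left_T n i h = (\<lambda>u. if u \<in> Sym n then
     (if left_ascent i u then q * h (adj i \<circ> u) else h (adj i \<circ> u) + (q - 1) * h u) else 0)"

definition right_T :: "nat \<Rightarrow> nat \<Rightarrow> hecke \<Rightarrow> hecke" where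
  "right_T n j h = (\<lambda>u. if u \<in> Sym n then
     (if u j < u (Suc j) then q * h (u \<circ> adj j) else h (u \<circ> adj j) + (q - 1) * h u) else 0)"

lemma adj_comp_eq_iff: "u = adj i \<circ> w \<longleftrightarrow> w = adj i \<circ> u" "u = w \<circ> adj i \<longleftrightarrow> w = u \<circ> adj i"
  by auto

lemma adj_comp_neq: "bij u \<Longrightarrow> adj i \<circ> u \<noteq> u" "bij u \<Longrightarrow> u \<noteq> u \<circ> adj i"
proof -
  assume b: "bij u"
  then show "adj i \<circ> u \<noteq> u" using left_ascent_adj [of u i] by metis
  have "u i \<noteq> u (Suc i)" using b by (auto simp: bij_def dest: injD)
  then show "u \<noteq> u \<circ> adj i" using adj_apply(1) [of i] by (metis comp_apply)
qed

lemma gen_mult_eq: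
  assumes i: "1 \<le> i" "i < n"
  shows "gen_mult n i h = left_T n i h"
proof
  fix u
  have "gen_mult n i h u = (\<Sum>w\<in>Sym n.
      (if w = adj i \<circ> u then h w * (if left_ascent i w then 1 else q) else 0) +
      (if w = u then h w * (if left_ascent i w then 0 else q - 1) else 0))"
    unfolding gen_mult_def lincomb_def gen_T_def
  proof (rule sum.cong [OF refl], goal_cases)
    case (1 w)
    show ?case
      using 1 adj_comp_eq_iff(1) [of u i w] adj_comp_neq(1) [of w i] Sym_bij [of w n]
      by (simp add: bruhat_less_adj_iff [OF _ i] T_def distrib_left) auto
  qed
  also have "\<dots> = left_T n i h u"
    by (simp add: sum.distrib finite_Sym left_T_def Sym_adj_left [OF i] left_ascent_adj Sym_bij algebra_simps)
  finally show "gen_mult n i h u = left_T n i h u" .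
qed

lemma T_Hecke: "w \<in> Sym n \<Longrightarrow> T w \<in> Hecke n"
  by (auto simp: Hecke_def T_def)

lemma left_T_T:
  assumes "1 \<le> i" "i < n" "w \<in> Sym n"
  shows "left_T n i (T w) = (if left_ascent i w then T (adj i \<circ> w)
    else (\<lambda>u. (q - 1) * T w u + q * T (adj i \<circ> w) u))"
  using gen_mult_eq [OF assms(1,2), of "T w"] assms
  by (simp add: gen_mult_def lincomb_T gen_T_def bruhat_less_adj_iff)

lemma right_T_T_up:
  assumes j: "1 \<le> j" "j < n" and "w \<in> Sym n" "w j < w (Suc j)"
  shows "right_T n j (T w) = T (w \<circ> adj j)"
proof
  fix u
  show "right_T n j (T w) u = T (w \<circ> adj j) u"
    using assms adj_comp_eq_iff(2) [of u w j] Sym_adj_right [OF j, of w] adj_comp_neq(2) [of w j] Sym_bij [of w n]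
    by (auto simp: right_T_def T_def)
qed

lemma left_ascent_comp_adj:
  assumes "bij u"
  shows "left_ascent i (u \<circ> adj j) \<longleftrightarrow> \<not> (u j = i \<and> u (Suc j) = Suc i) \<and>
    (u j = Suc i \<and> u (Suc j) = i \<or> left_ascent i u)"
  using bij_inv_eq_iff [OF assms, of _ i] bij_inv_eq_iff [OF assms, of _ "Suc i"]
  by (auto simp: left_ascent_def inv_comp_adj [OF assms] adj_less eq_commute [of "inv u _"])

text \<open>Left and right ascents of \<open>u\<close> interact only if \<open>u\<close> maps
  \<open>{j, Suc j}\<close> onto \<open>{i, Suc i}\<close>, and then
  \<open>adj i \<circ> u = u \<circ> adj j\<close>. This commutation stands in for the braid
  relations.\<close>

lemma left_right_commute:
  assumes i: "1 \<le> i" "i < n" and j: "1 \<le> j" "j < n"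
  shows "left_T n i (right_T n j h) = right_T n j (left_T n i h)"
proof
  fix u
  show "left_T n i (right_T n j h) u = right_T n j (left_T n i h) u"
  proof (cases "u \<in> Sym n")
    case True
    then have b: "bij u" by (rule Sym_bij)
    have iu: "inv u i = j \<and> inv u (Suc i) = Suc j" if "u j = i" "u (Suc j) = Suc i"
      using that b by (metis bij_inv_eq_iff)
    have iu': "inv u i = Suc j \<and> inv u (Suc i) = j" if "u j = Suc i" "u (Suc j) = i"
      using that b by (metis bij_inv_eq_iff)
    have same: "adj i \<circ> u = u \<circ> adj j"
      if "u j = i \<and> u (Suc j) = Suc i \<or> u j = Suc i \<and> u (Suc j) = i"
      using that iu iu' unfolding adj_def transpose_conj [OF b] by (auto simp: transpose_commute)
    consider "u j = i" "u (Suc j) = Suc i" | "u j = Suc i" "u (Suc j) = i"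
      | "\<not> (u j = i \<and> u (Suc j) = Suc i)" "\<not> (u j = Suc i \<and> u (Suc j) = i)" by blast
    then show ?thesis
    proof cases
      case 1
      with same have s: "adj i \<circ> u = u \<circ> adj j" by auto
      then have s': "adj i \<circ> (u \<circ> adj j) = u" by (metis adj_comp_adj(1))
      have upu: "left_ascent i u" using 1 iu by (simp add: left_ascent_def)
      show ?thesis
        using 1 True i j
        by (simp add: left_T_def right_T_def Sym_adj_left Sym_adj_right s s' left_ascent_comp_adj [OF b] upu)
    next
      case 2
      with same have s: "adj i \<circ> u = u \<circ> adj j" by auto
      then have s': "adj i \<circ> (u \<circ> adj j) = u" by (metis adj_comp_adj(1))
      have upu: "\<not> left_ascent i u" using 2 iu' by (simp add: left_ascent_def)
      show ?thesis
        using 2 True i j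
        by (simp add: left_T_def right_T_def Sym_adj_left Sym_adj_right s s' left_ascent_comp_adj [OF b] upu)
    next
      case 3
      then show ?thesis
        using True i j
        by (auto simp: left_T_def right_T_def Sym_adj_left Sym_adj_right left_ascent_comp_adj [OF b] adj_less comp_assoc algebra_simps)
    qed
  qed (simp add: left_T_def right_T_def)
qed

text \<open>\<open>\<sigma>\<close> is either the identity or the bar involution of the coefficients.\<close>

definition semilinear :: "(laurent \<Rightarrow> laurent) \<Rightarrow> (hecke \<Rightarrow> hecke) \<Rightarrow> bool" where
  "semilinear \<sigma> F \<longleftrightarrow> (\<forall>x y. F (\<lambda>u. x u + y u) = (\<lambda>u. F x u + F y u)) \<and>
     (\<forall>c x. F (scale c x) = scale (\<sigma> c) (F x)) \<and> \<sigma> 0 = 0"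

lemma semilinearD:
  assumes "semilinear \<sigma> F"
  shows "F (\<lambda>u. x u + y u) = (\<lambda>u. F x u + F y u)" "F (scale c x) = scale (\<sigma> c) (F x)"
    "F (\<lambda>u. 0) = (\<lambda>u. 0)" "F (\<lambda>u. c * x u) = (\<lambda>u. \<sigma> c * F x u)"
proof -
  show "F (\<lambda>u. x u + y u) = (\<lambda>u. F x u + F y u)"
    and s: "F (scale c x) = scale (\<sigma> c) (F x)" for c x
    using assms by (auto simp: semilinear_def)
  show "F (\<lambda>u. c * x u) = (\<lambda>u. \<sigma> c * F x u)" using s by (simp add: scale_def)
  show "F (\<lambda>u. 0) = (\<lambda>u. 0)"
    using s [of 0 "\<lambda>u. 0"] assms by (simp add: scale_def semilinear_def)
qed

lemma semilinear_sum:
  assumes "semilinear \<sigma> F" "finite S"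
  shows "F (\<lambda>u. \<Sum>w\<in>S. c w * B w u) = (\<lambda>u. \<Sum>w\<in>S. \<sigma> (c w) * F (B w) u)"
  using assms(2)
  by induction (simp_all add: semilinearD [OF assms(1)])

lemma Hecke_expand: "h \<in> Hecke n \<Longrightarrow> h = (\<lambda>u. \<Sum>w\<in>Sym n. h w * T w u)"
  by (rule ext) (auto simp: T_def finite_Sym Hecke_def if_distrib [of "\<lambda>c. _ * c"] cong: if_cong)

lemma semilinear_expand:
  assumes "semilinear \<sigma> F" "h \<in> Hecke n"
  shows "F h = (\<lambda>u. \<Sum>w\<in>Sym n. \<sigma> (h w) * F (T w) u)"
  by (subst Hecke_expand [OF assms(2)]) (rule semilinear_sum [OF assms(1) finite_Sym])

lemma semilinear_eqI:
  assumes "semilinear \<sigma> F" "semilinear \<sigma> G" "\<And>w. w \<in> Sym n \<Longrightarrow> F (T w) = G (T w)" "h \<in> Hecke n"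
  shows "F h = G h"
  using semilinear_expand [OF assms(1,4)] semilinear_expand [OF assms(2,4)] assms(3) by simp

abbreviation linear_op :: "(hecke \<Rightarrow> hecke) \<Rightarrow> bool" where
  "linear_op \<equiv> semilinear (\<lambda>c. c)"

lemma linear_left_T: "linear_op (left_T n i)"
  by (auto simp: semilinear_def left_T_def scale_def fun_eq_iff algebra_simps)

lemma linear_right_T: "linear_op (right_T n i)"
  by (auto simp: semilinear_def right_T_def scale_def fun_eq_iff algebra_simps)

lemma semilinear_comp:
  "semilinear \<sigma> F \<Longrightarrow> semilinear \<tau> G \<Longrightarrow> semilinear (\<lambda>c. \<sigma> (\<tau> c)) (\<lambda>h. F (G h))"
  by (simp add: semilinear_def)

definition right_equivariant :: "nat \<Rightarrow> (hecke \<Rightarrow> hecke) \<Rightarrow> bool" where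
  "right_equivariant n F \<longleftrightarrow> linear_op F \<and> (\<forall>j h. 1 \<le> j \<longrightarrow> j < n \<longrightarrow> F (right_T n j h) = right_T n j (F h))"

text \<open>The unit \<open>T id\<close> generates the algebra as a right module.\<close>

lemma right_equivariant_eqI:
  assumes F: "right_equivariant n F" and G: "right_equivariant n G"
    and eq: "F (T id) = G (T id)" and h: "h \<in> Hecke n"
  shows "F h = G h"
proof (rule semilinear_eqI [OF _ _ _ h])
  show "linear_op F" "linear_op G" using F G by (auto simp: right_equivariant_def)
  fix w assume w: "w \<in> Sym n"
  have "F (T (inv v)) = G (T (inv v))" if "v permutes {1..n}" for v
    using that order_refl [of 1] order_refl [of n]
  proof (induction rule: permutes_left_induct [where n = n])
    case id
    show "F (T (inv id)) = G (T (inv id))" using eq by simp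
  next
    case (step i v)
    have v: "bij v" "inv v \<in> Sym n" using step Sym_inv [of v n] permutes_bij by (auto simp: Sym_def)
    have i: "1 \<le> i" "i < n" using step by auto
    have "T (inv (adj i \<circ> v)) = right_T n i (T (inv v))"
      using right_T_T_up [OF i v(2)] step by (simp add: inv_adj_comp v(1) left_ascent_def)
    then show "F (T (inv (adj i \<circ> v))) = G (T (inv (adj i \<circ> v)))"
      using F G i step by (simp add: right_equivariant_def)
  qed
  from this [of "inv w"] show "F (T w) = G (T w)"
    using Sym_bij [OF w] Sym_inv [OF w] by (simp add: inv_inv_eq Sym_def)
qed

lemma right_equivariant_left_T: "1 \<le> i \<Longrightarrow> i < n \<Longrightarrow> right_equivariant n (left_T n i)"
  by (simp add: right_equivariant_def linear_left_T left_right_commute)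

lemma right_equivariant_comp:
  "right_equivariant n F \<Longrightarrow> right_equivariant n G \<Longrightarrow> right_equivariant n (\<lambda>h. F (G h))"
  by (simp add: right_equivariant_def semilinear_def)

lemma right_equivariant_foldr_left_T: "set is \<subseteq> {1..<n} \<Longrightarrow> right_equivariant n (foldr (left_T n) is)"
proof (induction "is")
  case Nil
  then show ?case by (simp add: right_equivariant_def semilinear_def)
next
  case (Cons i "is")
  then show ?case using right_equivariant_comp [OF right_equivariant_left_T [of i n]] by (simp add: o_def)
qed

lemma left_T_Hecke: "left_T n i h \<in> Hecke n"
  by (simp add: left_T_def Hecke_def)

lemma right_T_Hecke: "right_T n i h \<in> Hecke n"
  by (simp add: right_T_def Hecke_def)

lemma foldr_left_T_Hecke: "h \<in> Hecke n \<Longrightarrow> foldr (left_T n) is h \<in> Hecke n"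
  by (cases "is") (simp_all add: left_T_Hecke)

text \<open>Suffixes of a reduced word are reduced, so every letter acts at a left ascent and merely
  moves the basis element.\<close>

lemma foldr_left_T_T_id:
  "set is \<subseteq> {1..<n} \<Longrightarrow> len n (word_perm is) = length is \<Longrightarrow> foldr (left_T n) is (T id) = T (word_perm is)"
proof (induction "is")
  case Nil
  show "foldr (left_T n) [] (T id) = T (word_perm [])" by (simp add: word_perm_def)
next
  case (Cons i "is")
  let ?v = "word_perm is"
  have i: "1 \<le> i" "i < n" using Cons.prems by auto
  have wf: "word_for n ?v is" using Cons.prems by (auto simp: word_for_def)
  then have v: "?v \<in> Sym n" "len n ?v \<le> length is" using word_forD [OF wf] by (auto simp: len_eq_card_inversions)
  have l: "len n (adj i \<circ> ?v) = Suc (length is)"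
    using Cons.prems(2) unfolding word_perm_Cons [symmetric] by simp
  then have left_ascent: "left_ascent i ?v" using len_down [OF v(1) i] v(2) by force
  then have "len n ?v = length is" using len_up [OF v(1) i] l by simp
  then have "foldr (left_T n) is (T id) = T ?v" using Cons.prems by (intro Cons.IH) auto
  then show "foldr (left_T n) (i # is) (T id) = T (word_perm (i # is))"
    using left_T_T [OF i v(1)] left_ascent by (simp add: word_perm_Cons)
qed

text \<open>Two reduced words of \<open>w\<close> give right equivariant operators with the same
  value \<open>T w\<close> at \<open>T id\<close>, hence the same operator on
  \<open>Hecke n\<close>. So the word picked by \<open>SOME\<close> is immaterial.\<close>

lemma T_mult_eq:
  assumes r: "reduced_word n w is" and h: "h \<in> Hecke n"
  shows "T_mult n w h = foldr (left_T n) is h"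
proof -
  have foldr_gen: "foldr (gen_mult n) js h = foldr (left_T n) js h" if "set js \<subseteq> {1..<n}" for js
    using that by (induction js) (simp_all add: gen_mult_eq)
  define js where "js = (SOME js. reduced_word n w js)"
  have js: "reduced_word n w js" unfolding js_def using r by (rule someI)
  have "foldr (left_T n) js h = foldr (left_T n) is h"
  proof (rule right_equivariant_eqI [OF _ _ _ h])
    show "foldr (left_T n) js (T id) = foldr (left_T n) is (T id)"
      using js r foldr_left_T_T_id [of js n] foldr_left_T_T_id [of "is" n] by (simp add: reduced_word_def word_for_def)
  qed (use js r in \<open>auto simp: reduced_word_def word_for_def intro!: right_equivariant_foldr_left_T\<close>)
  then show ?thesis
    unfolding T_mult_def js_def [symmetric] using foldr_gen [of js] js
    by (simp add: reduced_word_def word_for_def)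
qed

lemma reduced_word_exists: "w \<in> Sym n \<Longrightarrow> \<exists>is. reduced_word n w is"
  using reduced_word_parabolic [of w 1 n n] by (auto simp: Sym_def)

lemma T_mult_Hecke: "w \<in> Sym n \<Longrightarrow> h \<in> Hecke n \<Longrightarrow> T_mult n w h \<in> Hecke n"
  using reduced_word_exists T_mult_eq foldr_left_T_Hecke by metis

section \<open>Associativity and the bar involution\<close>

lemma right_equivariant_T_mult:
  assumes w: "w \<in> Sym n"
  obtains F where "right_equivariant n F" "\<And>h. h \<in> Hecke n \<Longrightarrow> T_mult n w h = F h" "F (T id) = T w"
proof -
  from reduced_word_exists [OF w] obtain "is" where r: "reduced_word n w is" ..
  then have "set is \<subseteq> {1..<n}" "len n (word_perm is) = length is" "word_perm is = w"
    by (auto simp: reduced_word_def word_for_def)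
  then show thesis
    using that [of "foldr (left_T n) is"] T_mult_eq [OF r] right_equivariant_foldr_left_T foldr_left_T_T_id by auto
qed

lemma right_equivariant_lincomb:
  assumes "\<And>w. w \<in> Sym n \<Longrightarrow> right_equivariant n (F w)"
  shows "right_equivariant n (\<lambda>h. lincomb n x (\<lambda>w. F w h))"
proof -
  have lin: "linear_op (F w)" if "w \<in> Sym n" for w
    using assms that by (simp add: right_equivariant_def)
  have "linear_op (\<lambda>h. lincomb n x (\<lambda>w. F w h))"
    unfolding semilinear_def lincomb_def
  proof (intro conjI allI ext)
    fix h g u
    show "(\<Sum>w\<in>Sym n. x w * F w (\<lambda>u. h u + g u) u) =
      (\<Sum>w\<in>Sym n. x w * F w h u) + (\<Sum>w\<in>Sym n. x w * F w g u)"
      unfolding sum.distrib [symmetric]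
      by (rule sum.cong) (simp_all add: semilinearD(1) [OF lin] distrib_left)
    fix c
    show "(\<Sum>w\<in>Sym n. x w * F w (scale c h) u) = scale c (\<lambda>u. \<Sum>w\<in>Sym n. x w * F w h u) u"
      unfolding scale_def sum_distrib_left
      by (rule sum.cong) (simp_all add: semilinearD(4) [OF lin] mult.left_commute)
  qed simp
  moreover have "lincomb n x (\<lambda>w. F w (right_T n j h)) = right_T n j (lincomb n x (\<lambda>w. F w h))"
    if "1 \<le> j" "j < n" for j h
    unfolding lincomb_def
    by (subst semilinear_sum [OF linear_right_T finite_Sym], intro ext sum.cong refl)
      (use assms that in \<open>simp add: right_equivariant_def\<close>)
  ultimately show ?thesis by (simp add: right_equivariant_def)
qed

text \<open>The operator \<open>F\<close> is needed because \<open>T_mult\<close> is identified with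
  a composite of \<open>left_T\<close> only on \<open>Hecke n\<close>, whereas
  \<open>right_equivariant\<close> speaks of all functions.\<close>

lemma right_equivariant_hmult:
  obtains F where "right_equivariant n F" "\<And>h. h \<in> Hecke n \<Longrightarrow> hmult n x h = F h"
    "x \<in> Hecke n \<Longrightarrow> F (T id) = x"
proof -
  have "\<exists>F. right_equivariant n F \<and> (\<forall>h. h \<in> Hecke n \<longrightarrow> T_mult n w h = F h) \<and> F (T id) = T w"
    if "w \<in> Sym n" for w
    by (rule right_equivariant_T_mult [OF that]) blast
  then obtain F where F: "w \<in> Sym n \<Longrightarrow> right_equivariant n (F w)"
    "w \<in> Sym n \<Longrightarrow> h \<in> Hecke n \<Longrightarrow> T_mult n w h = F w h" "w \<in> Sym n \<Longrightarrow> F w (T id) = T w" for w h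
    by metis
  have "lincomb n x (\<lambda>w. F w (T id)) = x" if "x \<in> Hecke n"
    using F(3) by (subst (2) Hecke_expand [OF that]) (simp add: lincomb_def)
  moreover have "hmult n x h = lincomb n x (\<lambda>w. F w h)" if "h \<in> Hecke n" for h
    unfolding hmult_def lincomb_def using F(2) that by simp
  ultimately show thesis using that [OF right_equivariant_lincomb [of n F x]] F(1) by blast
qed

lemma hmult_Hecke: "y \<in> Hecke n \<Longrightarrow> hmult n x y \<in> Hecke n"
  using T_mult_Hecke [of _ n y] by (auto simp: hmult_def lincomb_def Hecke_def intro!: sum.neutral)

lemma Hecke_add: "x \<in> Hecke n \<Longrightarrow> y \<in> Hecke n \<Longrightarrow> (\<lambda>u. x u + y u) \<in> Hecke n"
  by (simp add: Hecke_def)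

lemma Hecke_scale: "x \<in> Hecke n \<Longrightarrow> scale c x \<in> Hecke n"
  by (simp add: Hecke_def scale_def)

lemma hmult_T_id: "x \<in> Hecke n \<Longrightarrow> hmult n x (T id) = x"
  by (rule right_equivariant_hmult [of n x]) (simp add: T_Hecke Sym_id)

lemma hmult_right_T:
  assumes "x \<in> Hecke n" "y \<in> Hecke n" "1 \<le> j" "j < n"
  shows "hmult n x (right_T n j y) = right_T n j (hmult n x y)"
  by (rule right_equivariant_hmult [of n x]) (use assms in \<open>simp add: right_T_Hecke right_equivariant_def\<close>)

lemma linear_hmult_left: "linear_op (\<lambda>x. hmult n x y)"
  by (auto simp: semilinear_def hmult_def lincomb_def scale_def fun_eq_iff sum.distrib sum_distrib_left algebra_simps)

text \<open>Both sides are right equivariant in \<open>z\<close> and take the value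
  \<open>hmult n x y\<close> at \<open>T id\<close>.\<close>

lemma hmult_assoc:
  assumes x: "x \<in> Hecke n" and y: "y \<in> Hecke n" and z: "z \<in> Hecke n"
  shows "hmult n (hmult n x y) z = hmult n x (hmult n y z)"
proof -
  obtain F where F: "right_equivariant n F" "\<And>h. h \<in> Hecke n \<Longrightarrow> hmult n (hmult n x y) h = F h"
    "hmult n x y \<in> Hecke n \<Longrightarrow> F (T id) = hmult n x y"
    by (rule right_equivariant_hmult [of n "hmult n x y"]) blast
  obtain G where G: "right_equivariant n G" "\<And>h. h \<in> Hecke n \<Longrightarrow> hmult n x h = G h"
    by (rule right_equivariant_hmult [of n x]) blast
  obtain G' where G': "right_equivariant n G'" "\<And>h. h \<in> Hecke n \<Longrightarrow> hmult n y h = G' h"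
    "y \<in> Hecke n \<Longrightarrow> G' (T id) = y"
    by (rule right_equivariant_hmult [of n y]) blast
  have "F z = G (G' z)"
    using G(2) [OF y] G'(3) [OF y] F(3) [OF hmult_Hecke [OF y]] by (intro right_equivariant_eqI [OF F(1) right_equivariant_comp [OF G(1) G'(1)] _ z]) simp
  then show ?thesis
    using F(2) [OF z] G(2) [OF hmult_Hecke [OF z, of y]] G'(2) [OF z] by simp
qed

lemma hmult_T_adj:
  assumes "1 \<le> i" "i < n" "y \<in> Hecke n"
  shows "hmult n (T (adj i)) y = left_T n i y"
proof -
  have "reduced_word n (adj i) [i]" using reduced_word_adj assms by blast
  then show ?thesis
    using T_mult_eq [of n "adj i" "[i]" y] assms by (simp add: hmult_def lincomb_T adj_in_Sym)
qed

lemma hmult_left_T: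
  assumes "1 \<le> i" "i < n" "x \<in> Hecke n" "y \<in> Hecke n"
  shows "hmult n (left_T n i x) y = left_T n i (hmult n x y)"
  using hmult_assoc [of "T (adj i)" n x y] hmult_T_adj [OF assms(1,2)] assms
  by (simp add: T_Hecke adj_in_Sym hmult_Hecke)

section \<open>Inverses of the generators and the bar involution\<close>

lemma left_T_quadratic:
  assumes "1 \<le> i" "i < n" "h \<in> Hecke n"
  shows "left_T n i (left_T n i h) = (\<lambda>u. (q - 1) * left_T n i h u + q * h u)"
  using assms by (intro ext) (auto simp: left_T_def Sym_adj_left left_ascent_adj Sym_bij Hecke_def algebra_simps)

lemma semilinear_diff:
  assumes "semilinear \<sigma> F" shows "F (\<lambda>u. x u - y u) = (\<lambda>u. F x u - F y u)"
  using semilinearD(1) [OF assms, of "\<lambda>u. x u - y u" y] by (simp add: fun_eq_iff)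

text \<open>The quadratic relation solved for the inverse generator. Exponents count powers of
  \<open>q_half\<close>, so \<open>qp (- 2)\<close> is the inverse of \<open>q\<close>.\<close>

definition left_T_inv :: "nat \<Rightarrow> nat \<Rightarrow> hecke \<Rightarrow> hecke" where
  "left_T_inv n i h = (\<lambda>u. qp (- 2) * (left_T n i h u - (q - 1) * h u))"

lemma linear_left_T_inv: "linear_op (left_T_inv n i)"
  unfolding semilinear_def left_T_inv_def
  by (auto simp: semilinearD [OF linear_left_T] scale_def algebra_simps)

lemma left_T_inv_Hecke: "h \<in> Hecke n \<Longrightarrow> left_T_inv n i h \<in> Hecke n"
  using left_T_Hecke [of n i h] by (simp add: left_T_inv_def Hecke_def)

lemma left_T_left_T_inv:
  assumes "1 \<le> i" "i < n" "h \<in> Hecke n"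
  shows "left_T n i (left_T_inv n i h) = h" "left_T_inv n i (left_T n i h) = h"
proof -
  have qq: "qp (- 2) * (q * x) = x" for x
    by (simp add: q_eq)
  show "left_T_inv n i (left_T n i h) = h"
    unfolding left_T_inv_def left_T_quadratic [OF assms] by (simp add: qq)
  have "left_T n i (left_T_inv n i h) = (\<lambda>u. qp (- 2) * (left_T n i (left_T n i h) u - (q - 1) * left_T n i h u))"
    unfolding left_T_inv_def
    by (simp add: semilinearD(4) [OF linear_left_T] semilinear_diff [OF linear_left_T])
  then show "left_T n i (left_T_inv n i h) = h"
    unfolding left_T_quadratic [OF assms] by (simp add: qq)
qed

lemma left_T_inv_quadratic:
  assumes "1 \<le> i" "i < n" "h \<in> Hecke n"
  shows "left_T_inv n i (left_T_inv n i h) = (\<lambda>u. qp (- 2) * h u + (qp (- 2) - 1) * left_T_inv n i h u)"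
  unfolding left_T_inv_def [of n i "left_T_inv n i h"] left_T_left_T_inv(1) [OF assms]
  by (simp add: q_eq distrib_left left_diff_distrib right_diff_distrib) (simp add: algebra_simps)

lemma hmult_left_T_inv:
  assumes "1 \<le> i" "i < n" "x \<in> Hecke n" "y \<in> Hecke n"
  shows "hmult n (left_T_inv n i x) y = left_T_inv n i (hmult n x y)"
  unfolding left_T_inv_def semilinearD(4) [OF linear_hmult_left] semilinear_diff [OF linear_hmult_left] hmult_left_T [OF assms] ..

definition is_inverse :: "nat \<Rightarrow> hecke \<Rightarrow> hecke \<Rightarrow> bool" where
  "is_inverse n x y \<longleftrightarrow> y \<in> Hecke n \<and> hmult n x y = hone \<and> hmult n y x = hone"

lemma hone_Hecke: "hone \<in> Hecke n"
  by (simp add: hone_def T_Hecke Sym_id)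

lemma hinverse_eq:
  assumes x: "x \<in> Hecke n" and y: "is_inverse n x y"
  shows "hinverse n x = y"
  unfolding hinverse_def
proof (rule the_equality)
  fix z assume z: "z \<in> Hecke n \<and> hmult n x z = hone \<and> hmult n z x = hone"
  have "hmult n z (hmult n x y) = hmult n (hmult n z x) y"
    using hmult_assoc [of z n x y] x y z by (simp add: is_inverse_def)
  then show "z = y"
    using y z hmult_T_id [of z n] hone_hmult [of y n] by (simp add: is_inverse_def hone_def)
qed (use y in \<open>simp add: is_inverse_def\<close>)

definition barT :: "nat \<Rightarrow> perm \<Rightarrow> hecke" where
  "barT n v = hinverse n (T (inv v))"

lemma T_inv_adj:
  assumes "1 \<le> i" "i < n" "v \<in> Sym n" "left_ascent i v"
  shows "T (inv (adj i \<circ> v)) = hmult n (T (inv v)) (T (adj i))"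
proof -
  have "T (adj i) = right_T n i (T id)" using right_T_T_up [OF assms(1,2) Sym_id] by simp
  then show ?thesis
    using hmult_right_T [of "T (inv v)" n "T id" i] right_T_T_up [OF assms(1,2) Sym_inv [OF assms(3)]] assms
    by (simp add: T_Hecke Sym_inv Sym_id hmult_T_id inv_adj_comp Sym_bij left_ascent_def)
qed

text \<open>Passing from \<open>v\<close> to \<open>adj i \<circ> v\<close> appends
  \<open>T (adj i)\<close> on the right of \<open>T (inv v)\<close>, so the inverse acquires the
  inverse generator on the left.\<close>

lemma is_inverse_step:
  assumes i: "1 \<le> i" "i < n" and v: "v \<in> Sym n" "left_ascent i v" and y: "is_inverse n (T (inv v)) y"
  shows "is_inverse n (T (inv (adj i \<circ> v))) (left_T_inv n i y)"
proof -
  have H: "y \<in> Hecke n" "T (inv v) \<in> Hecke n" "T (adj i) \<in> Hecke n" "left_T_inv n i y \<in> Hecke n"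
    using y i v by (auto simp: is_inverse_def T_Hecke Sym_inv adj_in_Sym left_T_inv_Hecke)
  have "hmult n (T (inv (adj i \<circ> v))) (left_T_inv n i y) = hmult n (T (inv v)) (left_T n i (left_T_inv n i y))"
    unfolding T_inv_adj [OF i v] using H hmult_T_adj [OF i] by (simp add: hmult_assoc)
  also have "\<dots> = hone" using left_T_left_T_inv(1) [OF i] H y by (simp add: is_inverse_def)
  finally have 1: "hmult n (T (inv (adj i \<circ> v))) (left_T_inv n i y) = hone" .
  have "hmult n (left_T_inv n i y) (T (inv (adj i \<circ> v))) = left_T_inv n i (hmult n (hmult n y (T (inv v))) (T (adj i)))"
    unfolding T_inv_adj [OF i v] using H by (simp add: hmult_assoc hmult_left_T_inv [OF i] hmult_Hecke)
  also have "hmult n y (T (inv v)) = hone" using y by (simp add: is_inverse_def)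
  also have "hmult n hone (T (adj i)) = left_T n i (T id)"
    using H left_T_T [OF i Sym_id] by (simp add: hone_hmult left_ascent_def)
  also have "left_T_inv n i (left_T n i (T id)) = hone"
    using left_T_left_T_inv(2) [OF i T_Hecke [OF Sym_id]] by (simp add: hone_def)
  finally show ?thesis using 1 H unfolding is_inverse_def by blast
qed

lemma barT_inverse:
  assumes "v \<in> Sym n" shows "is_inverse n (T (inv v)) (barT n v)"
proof -
  have "v permutes {1..n}" "(1::nat) \<le> 1" "n \<le> n" using assms by (auto simp: Sym_def)
  then have "\<exists>y. is_inverse n (T (inv v)) y"
  proof (induction rule: permutes_left_induct)
    case id
    have "is_inverse n (T (inv id)) hone"
      using hone_hmult [OF hone_Hecke] by (simp add: is_inverse_def hone_def T_Hecke Sym_id)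
    then show "\<exists>y. is_inverse n (T (inv id)) y" by blast
  next
    case (step i v)
    then show "\<exists>y. is_inverse n (T (inv (adj i \<circ> v))) y"
      using is_inverse_step [of i n v] by (auto simp: Sym_def)
  qed
  then obtain y where "is_inverse n (T (inv v)) y" ..
  moreover from this have "barT n v = y"
    unfolding barT_def using assms by (intro hinverse_eq) (simp_all add: T_Hecke Sym_inv)
  ultimately show ?thesis by simp
qed

lemma barT_Hecke: "v \<in> Sym n \<Longrightarrow> barT n v \<in> Hecke n"
  using barT_inverse by (simp add: is_inverse_def)

lemma barT_adj:
  assumes "1 \<le> i" "i < n" "v \<in> Sym n" "left_ascent i v"
  shows "barT n (adj i \<circ> v) = left_T_inv n i (barT n v)"
proof -
  have "T (inv (adj i \<circ> v)) \<in> Hecke n" using assms by (simp add: T_Hecke Sym_inv Sym_adj_left)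
  then show ?thesis
    using hinverse_eq [OF _ is_inverse_step [OF assms barT_inverse [OF assms(3)]]]
    unfolding barT_def by blast
qed

lemma barT_id: "barT n id = T id"
proof -
  have "is_inverse n (T (inv id)) hone"
    using hone_hmult [OF hone_Hecke] by (simp add: is_inverse_def hone_def T_Hecke Sym_id)
  from hinverse_eq [OF _ this] show ?thesis
    by (simp add: barT_def T_Hecke Sym_id hone_def)
qed

lemma hbar_eq: "hbar n h = lincomb n (\<lambda>w. laurent_bar (h w)) (barT n)"
  by (simp add: hbar_def barT_def [abs_def])

lemma semilinear_hbar: "semilinear laurent_bar (hbar n)"
  unfolding semilinear_def hbar_eq lincomb_def scale_def
  by (simp add: laurent_bar_add laurent_bar_mult distrib_right sum.distrib sum_distrib_left mult.assoc)

lemma hbar_T: "w \<in> Sym n \<Longrightarrow> hbar n (T w) = barT n w"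
proof -
  assume "w \<in> Sym n"
  have "(\<lambda>v. laurent_bar (T w v)) = T w" by (auto simp: T_def)
  then show ?thesis using \<open>w \<in> Sym n\<close> by (simp add: hbar_eq lincomb_T)
qed

lemma hbar_Hecke: "hbar n h \<in> Hecke n"
  using barT_Hecke [of _ n] by (auto simp: hbar_eq lincomb_def Hecke_def intro!: sum.neutral)

text \<open>Multiplicativity of the bar involution for a generator. At an ascent this is the
  recursion \<open>barT_adj\<close>; at a descent the bar of the quadratic relation is the quadratic
  relation of the inverse generator.\<close>

lemma hbar_left_T:
  assumes i: "1 \<le> i" "i < n" and h: "h \<in> Hecke n"
  shows "hbar n (left_T n i h) = left_T_inv n i (hbar n h)"
proof (rule semilinear_eqI [OF _ _ _ h])
  show "semilinear laurent_bar (\<lambda>h. hbar n (left_T n i h))"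
    using semilinear_comp [OF semilinear_hbar linear_left_T] .
  show "semilinear laurent_bar (\<lambda>h. left_T_inv n i (hbar n h))"
    using semilinear_comp [OF linear_left_T_inv semilinear_hbar] .
  fix w assume w: "w \<in> Sym n"
  show "hbar n (left_T n i (T w)) = left_T_inv n i (hbar n (T w))"
  proof (cases "left_ascent i w")
    case True
    then show ?thesis using w i by (simp add: left_T_T hbar_T Sym_adj_left barT_adj)
  next
    case False
    let ?v = "adj i \<circ> w"
    have v: "?v \<in> Sym n" "left_ascent i ?v" using False w i by (auto simp: Sym_adj_left left_ascent_adj Sym_bij)
    have bw: "barT n w = left_T_inv n i (barT n ?v)" using barT_adj [OF i v] by simp
    have "hbar n (left_T n i (T w)) = hbar n (\<lambda>u. (q - 1) * T w u + q * T ?v u)"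
      using False w i by (simp add: left_T_T)
    also have "\<dots> = (\<lambda>u. (qp (- 2) - 1) * barT n w u + qp (- 2) * barT n ?v u)"
      using w v by (simp add: semilinearD [OF semilinear_hbar] hbar_T q_eq laurent_bar_diff)
    also have "\<dots> = left_T_inv n i (barT n w)"
      unfolding bw left_T_inv_quadratic [OF i barT_Hecke [OF v(1)]] by (simp add: add.commute)
    finally show ?thesis using w by (simp add: hbar_T)
  qed
qed

text \<open>Left multiplication by the Kazhdan--Lusztig element of \<open>adj i\<close>, which is
  \<open>T (adj i) + 1\<close> divided by \<open>q_half\<close>.\<close>

definition left_KL :: "nat \<Rightarrow> nat \<Rightarrow> hecke \<Rightarrow> hecke" where
  "left_KL n i h = (\<lambda>u. qp (- 1) * (left_T n i h u + h u))"

text \<open>By the quadratic relation, the inverse generator plus 1 is \<open>qp (- 2)\<close> times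
  the generator plus 1; the bar turns the scalar \<open>qp (- 1)\<close> into \<open>qp 1\<close>,
  and the product of the two scalars is \<open>qp (- 1)\<close> again.\<close>

lemma hbar_left_KL:
  assumes i: "1 \<le> i" "i < n" and h: "h \<in> Hecke n" and inv: "hbar n h = h"
  shows "hbar n (left_KL n i h) = left_KL n i h"
  unfolding left_KL_def semilinearD [OF semilinear_hbar] hbar_left_T [OF i h] inv left_T_inv_def
  by (simp add: q_eq distrib_left left_diff_distrib right_diff_distrib)

text \<open>Triangularity of the bar involution for length. The subgroup on \<open>{a..b}\<close> is
  tracked because the bar of a parabolic sum is computed from it; \<open>a = 1\<close>,
  \<open>b = n\<close> covers the whole group.\<close>

lemma barT_support:
  assumes ab: "1 \<le> a" "b \<le> n" and w: "w permutes {a..b}"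
  shows "(\<forall>u. barT n w u \<noteq> 0 \<longrightarrow> u permutes {a..b} \<and> (u = w \<or> len n u < len n w)) \<and>
    barT n w w = qp (- 2 * int (len n w))"
  using w ab
proof (induction rule: permutes_left_induct)
  case id
  show "(\<forall>u. barT n id u \<noteq> 0 \<longrightarrow> u permutes {a..b} \<and> (u = id \<or> len n u < len n id)) \<and>
    barT n id id = qp (- 2 * int (len n id))"
    by (simp add: barT_id T_def permutes_id len_id)
next
  case (step i v)
  have i: "1 \<le> i" "i < n" using step ab by auto
  have v: "v \<in> Sym n" using step ab permutes_subset_Sym by blast
  let ?w = "adj i \<circ> v"
  have IH: "u permutes {a..b}" "u = v \<or> len n u < len n v" if "barT n v u \<noteq> 0" for u
    using step.IH that by auto
  have val: "barT n ?w u = qp (- 2) * (left_T n i (barT n v) u - (q - 1) * barT n v u)" for u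
    by (simp add: barT_adj [OF i v \<open>left_ascent i v\<close>] left_T_inv_def)
  have lw: "len n ?w = Suc (len n v)" using len_up [OF v i \<open>left_ascent i v\<close>] .
  have "u permutes {a..b} \<and> (u = ?w \<or> len n u < len n ?w)" if nz: "barT n ?w u \<noteq> 0" for u
  proof (cases "barT n v u \<noteq> 0")
    case True
    then show ?thesis using IH [OF True] lw by auto
  next
    case False
    with nz have u: "u \<in> Sym n" "barT n v (adj i \<circ> u) \<noteq> 0"
      by (auto simp: val left_T_def split: if_splits)
    have "adj i \<circ> (adj i \<circ> u) permutes {a..b}"
      using IH(1) [OF u(2)] step permutes_adj [of a i b] permutes_compose by blast
    moreover have "u = ?w \<or> len n u < len n ?w"
    proof (cases "adj i \<circ> u = v")
      case True then show ?thesis by auto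
    next
      case False
      then have "len n (adj i \<circ> u) < len n v" using IH(2) [OF u(2)] by blast
      then show ?thesis using len_up [OF u(1) i] len_down [OF u(1) i] lw by linarith
    qed
    ultimately show ?thesis by simp
  qed
  moreover have "barT n ?w ?w = qp (- 2 * int (len n ?w))"
  proof -
    have "barT n v ?w = 0" using IH(2) [of ?w] lw adj_comp_neq(1) [OF Sym_bij [OF v], of i] by fastforce
    moreover have "barT n v v = qp (- 2 * int (len n v))" using step.IH by blast
    ultimately show ?thesis
      using \<open>left_ascent i v\<close> v by (simp add: val left_T_def Sym_adj_left [OF i] left_ascent_adj Sym_bij lw)
  qed
  ultimately show "(\<forall>u. barT n ?w u \<noteq> 0 \<longrightarrow> u permutes {a..b} \<and> (u = ?w \<or> len n u < len n ?w)) \<and>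
    barT n ?w ?w = qp (- 2 * int (len n ?w))" by blast
qed

section \<open>The Kazhdan--Lusztig basis\<close>

lemma at_q_pCons: "at_q (pCons a p) = of_int a + q * at_q p"
  by (simp add: at_q_def map_poly_pCons)

lemma at_q_0 [simp]: "at_q 0 = 0"
  by (simp add: at_q_def)

lemma at_q_1 [simp]: "at_q 1 = 1"
  using at_q_pCons [of 1 0] by (simp add: one_pCons)

lemma at_q_add: "at_q (p + r) = at_q p + at_q r"
proof (induction p arbitrary: r)
  case (pCons a p)
  obtain b r' where "r = pCons b r'" by (cases r)
  then show ?case by (simp add: at_q_pCons pCons.IH distrib_left)
qed simp

lemma at_q_minus: "at_q (- p) = - at_q p"
  using at_q_add [of p "- p"] by (simp add: add_eq_0_iff)

lemma at_q_diff: "at_q (p - r) = at_q p - at_q r"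
  using at_q_add [of p "- r"] by (simp add: at_q_minus)

lemma at_q_smult: "at_q (smult a p) = of_int a * at_q p"
  by (induction p) (simp_all add: at_q_pCons algebra_simps)

lemma at_q_mult: "at_q (p * r) = at_q p * at_q r"
  by (induction p) (simp_all add: at_q_pCons at_q_add at_q_smult algebra_simps)

lemma at_q_sum: "at_q (sum f A) = (\<Sum>x\<in>A. at_q (f x))"
  by (induction A rule: infinite_finite_induct) (simp_all add: at_q_add)

lemma at_q_prod: "at_q (prod f A) = (\<Prod>x\<in>A. at_q (f x))"
  by (induction A rule: infinite_finite_induct) (simp_all add: at_q_mult)

lemma at_q_monom: "at_q (monom c k) = of_int c * qp (2 * int k)"
  by (induction k) (simp_all add: monom_0 monom_Suc at_q_pCons q_eq mult.left_commute [of "qp 2"])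

lemma coef_of_int: "coef (of_int a) j = (if j = 0 then a else 0)"
  by (simp add: lookup_of_int when_def)

lemma coef_at_q: "coef (at_q p) j = (if even j \<and> 0 \<le> j then coeff p (nat (j div 2)) else 0)"
proof (induction p arbitrary: j)
  case (pCons a p)
  have "coef (at_q (pCons a p)) j = (if j = 0 then a else 0) + coef (at_q p) (j - 2)"
    by (simp add: at_q_pCons lookup_add coef_of_int q_eq lookup_qp_mult)
  also have "\<dots> = (if even j \<and> 0 \<le> j then coeff (pCons a p) (nat (j div 2)) else 0)"
  proof (cases "even j \<and> 2 \<le> j")
    case True
    then obtain m where m: "j = 2 * m" "1 \<le> m" by (elim conjE evenE) auto
    then have "nat m = Suc (nat (m - 1))" by simp
    then show ?thesis using m by (simp add: pCons.IH right_diff_distrib [symmetric])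
  next
    case False
    then have "j = 0 \<or> odd j \<or> j < 0" by presburger
    then show ?thesis using False by (auto simp: pCons.IH)
  qed
  finally show ?case .
qed simp

lemma at_q_inject: "at_q p = at_q r \<longleftrightarrow> p = r"
proof
  assume eq: "at_q p = at_q r"
  have "coeff s k = coef (at_q s) (2 * int k)" for s k by (simp add: coef_at_q)
  then show "p = r" using eq by (simp add: poly_eq_iff)
qed simp

definition KLelt :: "nat \<Rightarrow> perm \<Rightarrow> (perm \<Rightarrow> int poly) \<Rightarrow> hecke" where
  "KLelt n w p = (\<lambda>u. qp (- int (len n w)) * at_q (p u))"

text \<open>The conditions that determine the polynomials uniquely. The degree bound is put on
  single coefficients and without subtraction, so that it forces \<open>p u = 0\<close> whenever
  \<open>u \<noteq> w\<close> is not shorter than \<open>w\<close>.\<close>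

definition KLweak :: "nat \<Rightarrow> perm \<Rightarrow> (perm \<Rightarrow> int poly) \<Rightarrow> bool" where
  "KLweak n w p \<longleftrightarrow> hbar n (KLelt n w p) = KLelt n w p \<and> p w = 1 \<and>
     (\<forall>u k. coeff (p u) k \<noteq> 0 \<longrightarrow> u \<in> Sym n \<and> (u = w \<or> 2 * k + len n u + 1 \<le> len n w))"

text \<open>Two facts carried through the recursion: the Bruhat support, which the sum in
  \<open>is_KL_basis\<close> asks for, and constant coefficients 0 or 1, which later let each coatom
  count at most once.\<close>

definition KLpoly :: "nat \<Rightarrow> perm \<Rightarrow> (perm \<Rightarrow> int poly) \<Rightarrow> bool" where
  "KLpoly n w p \<longleftrightarrow> KLweak n w p \<and> (\<forall>u. p u \<noteq> 0 \<longrightarrow> bruhat_le n u w) \<and> (\<forall>u. coeff (p u) 0 \<in> {0, 1})"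

lemma KLweak_eq_0: "KLweak n w p \<Longrightarrow> u \<notin> Sym n \<Longrightarrow> p u = 0"
proof -
  assume "KLweak n w p" "u \<notin> Sym n"
  then have "coeff (p u) k = 0" for k unfolding KLweak_def by blast
  then show "p u = 0" by (simp add: poly_eq_iff)
qed

lemma KLelt_Hecke: "KLweak n w p \<Longrightarrow> KLelt n w p \<in> Hecke n"
  using KLweak_eq_0 [of n w p] by (simp add: KLelt_def Hecke_def)

lemma len_adj_cases:
  assumes "u \<in> Sym n" "1 \<le> i" "i < n"
  obtains "left_ascent i u" "len n (adj i \<circ> u) = Suc (len n u)" | "\<not> left_ascent i u" "len n u = Suc (len n (adj i \<circ> u))"
  using len_up [OF assms] len_down [OF assms] by blast

text \<open>The classical recursion: \<open>C'\<^sub>s C'\<^sub>v\<close> minus a combination of shorter basis elements which removes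
  the coefficients of too large degree.\<close>

lemma KLpoly_step:
  assumes i: "1 \<le> i" "i < n" and v: "v \<in> Sym n" "left_ascent i v" and p: "KLpoly n v p"
    and r: "\<And>z. z \<in> Sym n \<Longrightarrow> len n z < len n v \<Longrightarrow> KLpoly n z (r z)"
  shows "\<exists>p'. KLpoly n (adj i \<circ> v) p'"
proof -
  let ?w = "adj i \<circ> v"
  have lw: "len n ?w = Suc (len n v)" using len_up [OF v(1) i v(2)] .
  have w: "?w \<in> Sym n" "\<not> left_ascent i ?w" using v i by (auto simp: Sym_adj_left left_ascent_adj Sym_bij)
  \<comment> \<open>These are the coefficients of \<open>T (adj i) + 1\<close> applied to the
    element with coefficients \<open>p\<close>; \<open>[:0, 1:]\<close> is the variable
    \<open>q\<close>.\<close>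
  define P where "P x = (if x \<in> Sym n then if left_ascent i x then p x + [:0, 1:] * p (adj i \<circ> x)
    else p (adj i \<circ> x) + [:0, 1:] * p x else 0)" for x
  \<comment> \<open>The \<open>z\<close> with descent \<open>i\<close> whose polynomial attains the
    maximal degree allowed below \<open>v\<close>; \<open>m z\<close> is then the Kazhdan--Lusztig
    coefficient usually written mu(z, v).\<close>
  define Z where "Z = {z \<in> Sym n. p z \<noteq> 0 \<and> \<not> left_ascent i z \<and> 2 * degree (p z) + len n z + 1 = len n v}"
  define m where "m z = lead_coeff (p z)" for z
  \<comment> \<open>For \<open>z\<close> in \<open>Z\<close>, \<open>Suc (degree (p z))\<close> is
    half of \<open>len n ?w - len n z\<close>, which balances the normalisations of the two
    elements.\<close>
  define p' where "p' x = P x - (\<Sum>z\<in>Z. monom (m z) (Suc (degree (p z))) * r z x)" for x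
  have fin: "finite Z" by (rule finite_subset [OF _ finite_Sym [of n]]) (auto simp: Z_def)
  have pv: "p v = 1" and psup: "coeff (p u) k \<noteq> 0 \<Longrightarrow> u \<in> Sym n \<and> (u = v \<or> 2 * k + len n u + 1 \<le> len n v)"
    and ple: "p u \<noteq> 0 \<Longrightarrow> bruhat_le n u v" and p0: "coeff (p u) 0 \<in> {0, 1}" for u k
    using p by (auto simp: KLpoly_def KLweak_def)
  have rz: "KLpoly n z (r z)" "len n z < len n v" "z \<in> Sym n" if "z \<in> Z" for z
    using r [of z] that by (auto simp: Z_def)
  have vw: "bruhat_le n v ?w" using bruhat_step_le [OF bruhat_step_adj [OF v(1) i v(2)]] .
  have coeffP: "coeff (P x) k = (if x \<in> Sym n then
      if left_ascent i x then coeff (p x) k + (if k = 0 then 0 else coeff (p (adj i \<circ> x)) (k - 1))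
      else coeff (p (adj i \<circ> x)) k + (if k = 0 then 0 else coeff (p x) (k - 1)) else 0)" for x k
    by (cases k) (auto simp: P_def)
  have coeffp': "coeff (p' x) k = coeff (P x) k -
      (\<Sum>z\<in>Z. if Suc (degree (p z)) \<le> k then m z * coeff (r z x) (k - Suc (degree (p z))) else 0)" for x k
  proof -
    have "(if k < a then 0 else y) = (if a \<le> k then y else (0::int))" for a y by auto
    then show ?thesis by (simp only: p'_def coeff_diff coeff_sum coeff_monom_mult)
  qed
  have elt: "KLelt n ?w p' = (\<lambda>u. left_KL n i (KLelt n v p) u - (\<Sum>z\<in>Z. of_int (m z) * KLelt n z (r z) u))"
  proof
    fix u
    have "coeff (p u) k = 0" if "u \<notin> Sym n" for k
      using psup [of u k] that by blast
    then have out: "p u = 0" if "u \<notin> Sym n"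
      using that by (simp add: poly_eq_iff)
    have "left_KL n i (KLelt n v p) u = qp (- int (len n ?w)) * at_q (P u)"
      using out
      by (simp add: left_KL_def KLelt_def left_T_def P_def lw at_q_add at_q_mult at_q_pCons algebra_simps)
    moreover have "of_int (m z) * KLelt n z (r z) u =
        qp (- int (len n ?w)) * at_q (monom (m z) (Suc (degree (p z))) * r z u)" if "z \<in> Z" for z
    proof -
      have "int (len n v) = 2 * int (degree (p z)) + int (len n z) + 1" using that by (auto simp: Z_def)
      then show ?thesis
        by (simp add: KLelt_def at_q_mult at_q_monom lw mult.left_commute [of "of_int _"] mult.assoc)
    qed
    ultimately show "KLelt n ?w p' u =
        left_KL n i (KLelt n v p) u - (\<Sum>z\<in>Z. of_int (m z) * KLelt n z (r z) u)"
      by (simp add: KLelt_def [of n ?w] p'_def at_q_diff at_q_sum right_diff_distrib sum_distrib_left)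
  qed
  have bar: "hbar n (KLelt n ?w p') = KLelt n ?w p'"
  proof -
    have "hbar n (left_KL n i (KLelt n v p)) = left_KL n i (KLelt n v p)"
      using p by (intro hbar_left_KL i KLelt_Hecke) (auto simp: KLpoly_def KLweak_def)
    moreover have "hbar n (KLelt n z (r z)) = KLelt n z (r z)" if "z \<in> Z" for z
      using rz [OF that] by (simp add: KLpoly_def KLweak_def)
    ultimately show ?thesis
      unfolding elt by (simp add: semilinear_diff [OF semilinear_hbar] semilinear_sum [OF semilinear_hbar fin])
  qed
  have rle: "bruhat_le n x v" if "z \<in> Z" "r z x \<noteq> 0" for z x
    using rz [OF that(1)] that ple [of z] bruhat_le_trans by (auto simp: KLpoly_def Z_def)
  have p'w: "p' ?w = 1"
  proof -
    have nle: "\<not> bruhat_le n ?w v" using bruhat_le_len [of n ?w v] lw by auto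
    then have "p ?w = 0" "r z ?w = 0" if "z \<in> Z" for z using ple rle that by blast+
    moreover have "p ?w = 0" using ple nle by blast
    ultimately show ?thesis using w by (simp add: p'_def P_def pv)
  qed
  have le: "bruhat_le n x ?w" if "p' x \<noteq> 0" for x
  proof (rule ccontr)
    assume n: "\<not> bruhat_le n x ?w"
    then have "\<not> bruhat_le n x v" using vw bruhat_le_trans by blast
    moreover have "\<not> bruhat_le n (adj i \<circ> x) v"
      using bruhat_le_lift [of n "adj i \<circ> x" v i] v i n by auto
    ultimately have "p x = 0" "p (adj i \<circ> x) = 0" using ple by blast+
    then have "P x = 0" by (simp add: P_def)
    moreover have "r z x = 0" if "z \<in> Z" for z
      using rle [OF that] \<open>\<not> bruhat_le n x v\<close> by blast
    ultimately show False using that by (simp add: p'_def)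
  qed
  have inSym: "x \<in> Sym n" if "p' x \<noteq> 0" for x
  proof (rule ccontr)
    assume n: "x \<notin> Sym n"
    then have "r z x = 0" if "z \<in> Z" for z
      using rz [OF that] n KLweak_eq_0 by (auto simp: KLpoly_def)
    then show False using that n by (simp add: p'_def P_def)
  qed
  \<comment> \<open>As \<open>len n ?w = Suc (len n v)\<close>, the assumption on \<open>k\<close>
    is the negation of the degree condition for \<open>?w\<close>.\<close>
  have deg: "coeff (p' x) k = 0" if x: "x \<in> Sym n" "x \<noteq> ?w" and k: "len n v < 2 * k + len n x" for x k
  proof -
    have other: "coeff (r z x) (k - Suc (degree (p z))) = 0"
      if "z \<in> Z" "z \<noteq> x" "Suc (degree (p z)) \<le> k" for z
    proof (rule ccontr)
      assume "coeff (r z x) (k - Suc (degree (p z))) \<noteq> 0"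
      then have "2 * (k - Suc (degree (p z))) + len n x + 1 \<le> len n z"
        using rz [OF that(1)] that by (auto simp: KLpoly_def KLweak_def)
      then show False using that k by (auto simp: Z_def)
    qed
    have "(\<Sum>z\<in>Z. if Suc (degree (p z)) \<le> k then m z * coeff (r z x) (k - Suc (degree (p z))) else 0) =
      (\<Sum>z\<in>Z. if z = x then if k = Suc (degree (p x)) then m x else 0 else 0)"
    proof (rule sum.cong [OF refl])
      fix z assume z: "z \<in> Z"
      have "r z z = 1" using rz [OF z] by (simp add: KLpoly_def KLweak_def)
      then show "(if Suc (degree (p z)) \<le> k then m z * coeff (r z x) (k - Suc (degree (p z))) else 0) =
        (if z = x then if k = Suc (degree (p x)) then m x else 0 else 0)"
        using other [OF z] by (auto simp: coeff_1)
    qed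
    also have "\<dots> = (if x \<in> Z \<and> k = Suc (degree (p x)) then m x else 0)"
      using fin by (simp add: sum.delta)
    finally have "coeff (p' x) k = coeff (P x) k - (if x \<in> Z \<and> k = Suc (degree (p x)) then m x else 0)"
      by (simp add: coeffp')
    moreover have "coeff (P x) k = (if x \<in> Z \<and> k = Suc (degree (p x)) then m x else 0)"
      using x(1) i
    proof (cases rule: len_adj_cases)
      case 1
      have "coeff (p x) k = 0"
        using psup [of x k] k by (cases "x = v") (auto simp: pv coeff_1)
      moreover have "coeff (p (adj i \<circ> x)) (k - 1) = 0" if "k \<noteq> 0"
      proof -
        have ne: "adj i \<circ> x \<noteq> v" using x(2) by auto
        show ?thesis
        proof (rule ccontr)
          assume "coeff (p (adj i \<circ> x)) (k - 1) \<noteq> 0"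
          from psup [OF this] ne have "2 * (k - 1) + len n (adj i \<circ> x) + 1 \<le> len n v" by blast
          then show False using k 1 that by arith
        qed
      qed
      ultimately show ?thesis using 1 x(1) by (simp add: coeffP Z_def)
    next
      case 2
      have "adj i \<circ> x \<noteq> v" using x(2) by auto
      then have "coeff (p (adj i \<circ> x)) k = 0" using psup [of "adj i \<circ> x" k] k 2 by force
      then have c: "coeff (P x) k = (if k = 0 then 0 else coeff (p x) (k - 1))"
        using 2 x(1) by (simp add: coeffP)
      \<comment> \<open>Only the summand shifted by the variable can reach the forbidden degree, and
        it does so exactly through the leading term of a \<open>p x\<close> of maximal degree, that
        is, for \<open>x\<close> in \<open>Z\<close>.\<close>
      show ?thesis
      proof (cases "k \<noteq> 0 \<and> coeff (p x) (k - 1) \<noteq> 0")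
        case True
        have "x \<noteq> v" using 2 v by auto
        then have top: "2 * j + len n x + 1 \<le> len n v" if "coeff (p x) j \<noteq> 0" for j
          using psup [OF that] by auto
        then have eq: "2 * (k - 1) + len n x + 1 = len n v" using True k by force
        have "degree (p x) = k - 1"
        proof (rule antisym)
          show "k - 1 \<le> degree (p x)" using True by (intro le_degree) simp
          have "p x \<noteq> 0" using True by auto
          then show "degree (p x) \<le> k - 1" using top [of "degree (p x)"] eq by simp
        qed
        then show ?thesis using True eq 2 x(1) by (auto simp: c Z_def m_def)
      next
        case False
        then have "\<not> (x \<in> Z \<and> k = Suc (degree (p x)))" by (auto simp: Z_def)
        then show ?thesis using False by (auto simp: c)
      qed
    qed
    ultimately show ?thesis by simp
  qed
  \<comment> \<open>The subtracted terms start in degree at least 1, and the constant coefficient of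
    \<open>P u\<close> is that of \<open>p u\<close> or of \<open>p (adj i \<circ> u)\<close>, or 0
    off \<open>Sym n\<close>.\<close>
  have "coeff (p' u) 0 \<in> {0, 1}" for u
    using p0 by (simp add: coeffp' coeffP)
  moreover have "u \<in> Sym n \<and> (u = ?w \<or> 2 * k + len n u + 1 \<le> len n ?w)" if "coeff (p' u) k \<noteq> 0" for u k
    using that inSym [of u] deg [of u k] lw by fastforce
  ultimately have "KLpoly n ?w p'"
    using bar p'w le unfolding KLpoly_def KLweak_def by blast
  then show ?thesis by blast
qed

lemma exists_descent:
  assumes "w \<in> Sym n" "w \<noteq> id"
  obtains i where "1 \<le> i" "i < n" "\<not> left_ascent i w"
proof -
  have "inv w \<noteq> id"
    using assms by (metis Sym_def inv_id mem_Collect_eq permutes_inv_inv)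
  then show thesis
    using that ascending_permutes_id [of "inv w" 1 n] Sym_inv [OF assms(1)] by (auto simp: Sym_def left_ascent_def)
qed

lemma KLpoly_id: "KLpoly n id (\<lambda>u. if u = id then 1 else 0)"
proof -
  have "KLelt n id (\<lambda>u. if u = id then 1 else 0) = T id"
    by (auto simp: KLelt_def len_id T_def)
  then show ?thesis
    using hbar_T [OF Sym_id, of n] by (auto simp: KLpoly_def KLweak_def barT_id Sym_id coeff_1 split: if_splits)
qed

lemma KLpoly_exists: "w \<in> Sym n \<Longrightarrow> \<exists>p. KLpoly n w p"
proof (induction "len n w" arbitrary: w rule: less_induct)
  case less
  show ?case
  proof (cases "w = id")
    case True
    then show ?thesis using KLpoly_id by blast
  next
    case False
    then obtain i where i: "1 \<le> i" "i < n" "\<not> left_ascent i w" using exists_descent less.prems by blast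
    let ?v = "adj i \<circ> w"
    have v: "?v \<in> Sym n" "left_ascent i ?v" "len n w = Suc (len n ?v)"
      using i less.prems by (auto simp: Sym_adj_left left_ascent_adj Sym_bij len_down)
    then obtain p where p: "KLpoly n ?v p" using less.hyps [of ?v] by auto
    have "\<exists>p. KLpoly n z p" if "z \<in> Sym n" "len n z < len n ?v" for z
      using less.hyps [of z] that v by simp
    then obtain r where "\<And>z. z \<in> Sym n \<Longrightarrow> len n z < len n ?v \<Longrightarrow> KLpoly n z (r z)" by metis
    from KLpoly_step [OF i(1,2) v(1,2) p this] show ?thesis by simp
  qed
qed

section \<open>Uniqueness of the Kazhdan--Lusztig basis and triangular families\<close>

lemma exists_max_len:
  assumes "u \<in> Sym n" "Q u"
  obtains v where "v \<in> Sym n" "Q v" "\<And>w. w \<in> Sym n \<Longrightarrow> Q w \<Longrightarrow> len n w \<le> len n v"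
proof -
  let ?S = "{v \<in> Sym n. Q v}"
  have "finite ?S" "?S \<noteq> {}" using finite_Sym assms by auto
  then have "Max (len n ` ?S) \<in> len n ` ?S" "\<And>w. w \<in> ?S \<Longrightarrow> len n w \<le> Max (len n ` ?S)" by auto
  then show thesis using that by force
qed

lemma Hecke_neq_in_Sym:
  assumes "x \<in> Hecke n" "y \<in> Hecke n" "x u \<noteq> y u" shows "u \<in> Sym n"
proof (rule ccontr)
  assume "u \<notin> Sym n"
  then have "x u = 0" "y u = 0" using assms by (simp_all add: Hecke_def)
  then show False using assms by simp
qed

text \<open>The bar involution is triangular with respect to the length alone, so no Bruhat condition enters.\<close>

lemma bar_invariant_eqI:
  assumes X: "X \<in> Hecke n" "hbar n X = X" and Y: "Y \<in> Hecke n" "hbar n Y = Y"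
    and eq: "\<And>u k. u \<in> Sym n \<Longrightarrow> 0 \<le> k \<Longrightarrow> coef (qp (int (len n u)) * X u) k = coef (qp (int (len n u)) * Y u) k"
  shows "X = Y"
proof (rule ccontr)
  assume "X \<noteq> Y"
  define D where "D = (\<lambda>u. X u - Y u)"
  have D: "hbar n D = D" unfolding D_def using X Y by (simp add: semilinear_diff [OF semilinear_hbar])
  from \<open>X \<noteq> Y\<close> obtain u where "X u \<noteq> Y u" by blast
  then have "u \<in> Sym n" "D u \<noteq> 0" using Hecke_neq_in_Sym [OF X(1) Y(1)] by (simp_all add: D_def)
  then obtain v where v: "v \<in> Sym n" "D v \<noteq> 0" "\<And>w. w \<in> Sym n \<Longrightarrow> D w \<noteq> 0 \<Longrightarrow> len n w \<le> len n v"
    using exists_max_len [of u n "\<lambda>v. D v \<noteq> 0"] by blast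
  let ?l = "int (len n v)"
  have barT: "barT n w v \<noteq> 0 \<Longrightarrow> v = w \<or> len n v < len n w" "barT n w w = qp (- 2 * int (len n w))"
    if "w \<in> Sym n" for w
    using barT_support [of 1 n n w] that by (auto simp: Sym_def)
  have "D v = (\<Sum>w\<in>Sym n. laurent_bar (D w) * barT n w v)"
    using D by (metis hbar_eq lincomb_def)
  \<comment> \<open>\<open>v\<close> is longest in the support of \<open>D\<close>, and
    \<open>barT n w\<close> reaches only \<open>w\<close> and shorter elements, so the diagonal term
    alone survives.\<close>
  also have "\<dots> = (\<Sum>w\<in>Sym n. if w = v then laurent_bar (D v) * qp (- 2 * ?l) else 0)"
    using v barT by (intro sum.cong refl) (force simp: not_le [symmetric])
  also have "\<dots> = qp (- 2 * ?l) * laurent_bar (D v)"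
    using v finite_Sym by (simp add: mult.commute)
  finally have "qp ?l * D v = qp ?l * (qp (- 2 * ?l) * laurent_bar (D v))" by (rule arg_cong)
  then have 1: "qp ?l * D v = qp (- ?l) * laurent_bar (D v)" by simp
  have 2: "laurent_bar (qp ?l * D v) = qp (- ?l) * laurent_bar (D v)" by (simp add: laurent_bar_mult)
  have Dv: "qp ?l * D v = laurent_bar (qp ?l * D v)"
    by (rule trans [OF 1 2 [symmetric]])
  have pos: "coef (qp ?l * D v) k = 0" if "0 \<le> k" for k
    using eq [OF v(1) that] by (simp add: D_def right_diff_distrib lookup_minus)
  \<comment> \<open>Invariance under the bar reflects exponents, so vanishing at the nonnegative
    ones is vanishing everywhere.\<close>
  have "coef (qp ?l * D v) k = 0" for k
    using pos [of k] pos [of "- k"] lookup_laurent_bar [of "qp ?l * D v" k] Dv by (cases "0 \<le> k") auto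
  then have "qp ?l * D v = 0" by (intro poly_mapping_eqI) simp
  then show False using v(2) by simp
qed

text \<open>After multiplication by \<open>qp (int (len n u))\<close> the degree bound leaves only
  negative exponents at \<open>u \<noteq> w\<close>, and the value at \<open>w\<close> is 1. So both
  elements have the same part in nonnegative exponents.\<close>

lemma KLweak_unique:
  assumes p: "KLweak n w p" and r: "KLweak n w r"
  shows "p = r"
proof -
  have c: "coef (qp (int (len n u)) * KLelt n w s u) k = (if u = w then coef 1 k else 0)"
    if "KLweak n w s" "0 \<le> k" for s u k
  proof (cases "u = w")
    case True
    then show ?thesis using that by (simp add: KLelt_def KLweak_def)
  next
    case False
    let ?j = "k - int (len n u) + int (len n w)"
    have "coeff (s u) (nat (?j div 2)) = 0" if "even ?j" "0 \<le> ?j"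
    proof (rule ccontr)
      assume "coeff (s u) (nat (?j div 2)) \<noteq> 0"
      then have "2 * nat (?j div 2) + len n u + 1 \<le> len n w"
        using \<open>KLweak n w s\<close> False by (auto simp: KLweak_def)
      then have "2 * (?j div 2) + int (len n u) + 1 \<le> int (len n w)" using that(2) by linarith
      then show False using \<open>even ?j\<close> \<open>0 \<le> k\<close> by simp
    qed
    then have "coef (at_q (s u)) ?j = 0" by (auto simp: coef_at_q)
    moreover have "qp (int (len n u)) * KLelt n w s u = qp (int (len n u) - int (len n w)) * at_q (s u)"
      by (simp add: KLelt_def)
    moreover have "k - (int (len n u) - int (len n w)) = ?j" by simp
    ultimately have "coef (qp (int (len n u)) * KLelt n w s u) k = 0"
      by (metis lookup_qp_mult)
    then show ?thesis using False by simp
  qed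
  have "hbar n (KLelt n w p) = KLelt n w p" "hbar n (KLelt n w r) = KLelt n w r"
    using p r unfolding KLweak_def by blast+
  then have "KLelt n w p = KLelt n w r"
    using c [OF p] c [OF r]
    by (intro bar_invariant_eqI [OF KLelt_Hecke [OF p] _ KLelt_Hecke [OF r]]) simp_all
  then have "qp (int (len n w)) * KLelt n w p u = qp (int (len n w)) * KLelt n w r u" for u by simp
  then show ?thesis by (simp add: KLelt_def fun_eq_iff at_q_inject)
qed

definition klpol :: "nat \<Rightarrow> perm \<Rightarrow> perm \<Rightarrow> int poly" where
  "klpol n w = (SOME p. KLpoly n w p)"

lemma KLpoly_klpol: "w \<in> Sym n \<Longrightarrow> KLpoly n w (klpol n w)"
  unfolding klpol_def using KLpoly_exists by (rule someI_ex)

text \<open>The diagonal entries are powers of \<open>q_half\<close>, hence units, so a family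
  triangular for length can be inverted over the Laurent polynomials.\<close>

lemma is_basis_triangular:
  assumes H: "\<And>w. w \<in> Sym n \<Longrightarrow> B w \<in> Hecke n"
    and tri: "\<And>w u. w \<in> Sym n \<Longrightarrow> B w u \<noteq> 0 \<Longrightarrow> u = w \<or> len n u < len n w"
    and diag: "\<And>w. w \<in> Sym n \<Longrightarrow> B w w = qp (e w)"
  shows "is_basis n B"
proof -
  have inj: "c = d" if c: "c \<in> Hecke n" and d: "d \<in> Hecke n" and eq: "lincomb n c B = lincomb n d B" for c d
  proof (rule ccontr)
    assume "c \<noteq> d"
    then obtain u where "c u \<noteq> d u" by blast
    then have "u \<in> Sym n" by (rule Hecke_neq_in_Sym [OF c d])
    with \<open>c u \<noteq> d u\<close> obtain v where v: "v \<in> Sym n" "c v \<noteq> d v"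
      "\<And>w. w \<in> Sym n \<Longrightarrow> c w \<noteq> d w \<Longrightarrow> len n w \<le> len n v"
      using exists_max_len [of u n "\<lambda>v. c v \<noteq> d v"] by blast
    have "0 = lincomb n c B v - lincomb n d B v" using eq by simp
    also have "\<dots> = (\<Sum>w\<in>Sym n. (c w - d w) * B w v)"
      by (simp add: lincomb_def sum_subtractf left_diff_distrib)
    also have "\<dots> = (\<Sum>w\<in>Sym n. if w = v then (c v - d v) * qp (e v) else 0)"
      using v tri diag by (intro sum.cong refl) (force simp: not_le [symmetric])
    also have "\<dots> = qp (e v) * (c v - d v)"
      using v finite_Sym by (simp add: mult.commute)
    finally have "qp (- e v) * (qp (e v) * (c v - d v)) = 0" by simp
    then have "c v - d v = 0" unfolding qp_mult_left by simp
    then show False using v by simp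
  qed
  let ?span = "\<lambda>h. \<exists>c\<in>Hecke n. h = lincomb n c B"
  have span_add: "?span (\<lambda>u. x u + y u)" if "?span x" "?span y" for x y
  proof -
    from that obtain c d where "c \<in> Hecke n" "d \<in> Hecke n" "x = lincomb n c B" "y = lincomb n d B" by blast
    then show ?thesis
      by (intro bexI [of _ "\<lambda>u. c u + d u"]) (simp_all add: Hecke_add lincomb_def distrib_right sum.distrib)
  qed
  have span_scale: "?span (\<lambda>u. a * x u)" if "?span x" for a x
  proof -
    from that obtain c where "c \<in> Hecke n" "x = lincomb n c B" by blast
    then show ?thesis
      using Hecke_scale [of c n a]
      by (intro bexI [of _ "scale a c"]) (simp_all add: scale_def lincomb_def sum_distrib_left mult.assoc)
  qed
  have span_B: "?span (B w)" if "w \<in> Sym n" for w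
    using T_Hecke [OF that] lincomb_T [OF that, of B] by metis
  have span_0: "?span (\<lambda>u. 0)"
    by (rule bexI [of _ "\<lambda>u. 0"]) (simp_all add: lincomb_def Hecke_def)
  have span_sum: "?span (\<lambda>u. \<Sum>w\<in>S. a w * x w u)" if "finite S" "\<And>w. w \<in> S \<Longrightarrow> ?span (x w)" for S a x
    using that by (induction S) (simp_all add: span_0 span_add span_scale)
  have span_T: "?span (T w)" if "w \<in> Sym n" for w
    using that
  proof (induction "len n w" arbitrary: w rule: less_induct)
    case (less w)
    let ?S = "Sym n - {w}"
    have "?span (\<lambda>u. \<Sum>v\<in>?S. - (qp (- e w) * B w v) * T v u)"
    proof -
      let ?S' = "{v \<in> ?S. B w v \<noteq> 0}"
      have "?span (\<lambda>u. \<Sum>v\<in>?S'. - (qp (- e w) * B w v) * T v u)"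
      proof (rule span_sum)
        show "finite ?S'" using finite_Sym by simp
        fix v assume "v \<in> ?S'"
        then have "v \<in> Sym n" "len n v < len n w" using tri [OF less.prems, of v] by auto
        then show "?span (T v)" using less.hyps by blast
      qed
      also have "(\<lambda>u. \<Sum>v\<in>?S'. - (qp (- e w) * B w v) * T v u) = (\<lambda>u. \<Sum>v\<in>?S. - (qp (- e w) * B w v) * T v u)"
        by (intro ext sum.mono_neutral_left) (use finite_Sym in auto)
      finally show ?thesis .
    qed
    moreover have "?span (\<lambda>u. qp (- e w) * B w u)" using span_scale span_B less.prems by blast
    ultimately have "?span (\<lambda>u. qp (- e w) * B w u + (\<Sum>v\<in>?S. - (qp (- e w) * B w v) * T v u))"
      by (rule span_add [rotated])
    also have "(\<lambda>u. qp (- e w) * B w u + (\<Sum>v\<in>?S. - (qp (- e w) * B w v) * T v u)) = T w"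
    proof
      fix u
      have "B w u = (\<Sum>v\<in>Sym n. B w v * T v u)"
        using Hecke_expand [OF H [OF less.prems]] by metis
      also have "\<dots> = B w w * T w u + (\<Sum>v\<in>?S. B w v * T v u)"
        using finite_Sym less.prems by (simp add: sum.remove)
      finally have "qp (- e w) * B w u = T w u + (\<Sum>v\<in>?S. qp (- e w) * B w v * T v u)"
        using diag [OF less.prems] by (simp add: distrib_left sum_distrib_left mult.assoc)
      then show "qp (- e w) * B w u + (\<Sum>v\<in>?S. - (qp (- e w) * B w v) * T v u) = T w u"
        by (simp add: sum_negf)
    qed
    finally show ?case .
  qed
  have "?span h" if "h \<in> Hecke n" for h
    by (subst Hecke_expand [OF that]) (rule span_sum [OF finite_Sym span_T])
  then show ?thesis unfolding is_basis_def using H inj by metis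
qed

lemma is_KL_basis_klpol:
  "is_KL_basis n (\<lambda>w. if w \<in> Sym n then KLelt n w (klpol n w) else (\<lambda>_. 0))" (is "is_KL_basis n ?C")
  unfolding is_KL_basis_def
proof (intro conjI exI [of _ "\<lambda>v w. klpol n w v"] ballI allI impI)
  show "is_basis n ?C"
  proof (rule is_basis_triangular)
    fix w assume w: "w \<in> Sym n"
    have k: "KLweak n w (klpol n w)" using KLpoly_klpol [OF w] by (simp add: KLpoly_def)
    show "?C w \<in> Hecke n" using KLelt_Hecke [OF k] w by simp
    show "?C w w = qp (- int (len n w))" using k w by (simp add: KLelt_def KLweak_def)
    fix u assume "?C w u \<noteq> 0"
    then have "klpol n w u \<noteq> 0" using w by (auto simp: KLelt_def)
    then show "u = w \<or> len n u < len n w"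
      using k leading_coeff_neq_0 [of "klpol n w u"] unfolding KLweak_def by fastforce
  qed
next
  fix w :: perm assume "w \<notin> Sym n" then show "?C w = (\<lambda>_. 0)" by simp
next
  fix w assume w: "w \<in> Sym n"
  have k: "KLpoly n w (klpol n w)" using KLpoly_klpol [OF w] .
  then have k': "KLweak n w (klpol n w)" by (simp add: KLpoly_def)
  show "hbar n (?C w) = ?C w" using k' w by (simp add: KLweak_def)
  show "klpol n w w = 1" using k' by (simp add: KLweak_def)
  have out: "klpol n w u = 0" if "\<not> (u \<in> Sym n \<and> bruhat_le n u w)" for u
  proof (cases "u \<in> Sym n")
    case True
    then show ?thesis using k that by (auto simp: KLpoly_def)
  next
    case False
    then show ?thesis by (rule KLweak_eq_0 [OF k'])
  qed
  show "scale (q_half ^ len n w) (?C w) =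
      (\<lambda>u. \<Sum>v\<in>{v \<in> Sym n. bruhat_le n v w}. at_q (klpol n w v) * T v u)"
  proof
    fix u
    have "(\<Sum>v\<in>{v \<in> Sym n. bruhat_le n v w}. at_q (klpol n w v) * T v u) =
      (\<Sum>v\<in>{v \<in> Sym n. bruhat_le n v w}. if v = u then at_q (klpol n w u) else 0)"
      by (rule sum.cong) (auto simp: T_def)
    also have "\<dots> = at_q (klpol n w u)"
      using out [of u] finite_Sym by (auto simp: sum.delta)
    finally show "scale (q_half ^ len n w) (?C w) u = (\<Sum>v\<in>{v \<in> Sym n. bruhat_le n v w}. at_q (klpol n w v) * T v u)"
      using w by (simp add: scale_def KLelt_def q_half_power)
  qed
  fix v assume v: "v \<in> Sym n" "bruhat_less n v w"
  have "2 * degree (klpol n w v) + len n v + 1 \<le> len n w"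
  proof (cases "klpol n w v = 0")
    case True
    then show ?thesis using bruhat_less_len [OF v(2)] by simp
  next
    case False
    then show ?thesis
      using k' leading_coeff_neq_0 [OF False] v(2) unfolding KLweak_def bruhat_less_def by blast
  qed
  then show "real (degree (klpol n w v)) \<le> (real (len n w) - real (len n v) - 1) / 2" by simp
qed

lemma is_KL_basis_unique:
  assumes C: "is_KL_basis n C"
  shows "C = (\<lambda>w. if w \<in> Sym n then KLelt n w (klpol n w) else (\<lambda>_. 0))"
proof
  fix w
  show "C w = (if w \<in> Sym n then KLelt n w (klpol n w) else (\<lambda>_. 0))"
  proof (cases "w \<in> Sym n")
    case False
    then show ?thesis using C by (auto simp: is_KL_basis_def)
  next
    case w: True
    from C obtain P where
      P: "scale (q_half ^ len n w) (C w) = (\<lambda>u. \<Sum>v\<in>{v \<in> Sym n. bruhat_le n v w}. at_q (P v w) * T v u)"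
      "P w w = 1" "\<And>v. v \<in> Sym n \<Longrightarrow> bruhat_less n v w \<Longrightarrow>
         real (degree (P v w)) \<le> (real (len n w) - real (len n v) - 1) / 2"
      and bar: "hbar n (C w) = C w"
      using w by (auto simp: is_KL_basis_def)
    \<comment> \<open>\<open>P\<close> is arbitrary off the Bruhat interval, so it is cut to 0 there
      before uniqueness can be applied.\<close>
    define p where "p u = (if u \<in> Sym n \<and> bruhat_le n u w then P u w else 0)" for u
    have "qp (int (len n w)) * C w u = at_q (p u)" for u
    proof -
      have "qp (int (len n w)) * C w u = (\<Sum>v\<in>{v \<in> Sym n. bruhat_le n v w}. at_q (P v w) * T v u)"
        using fun_cong [OF P(1), of u] by (simp add: scale_def q_half_power)
      also have "\<dots> = (\<Sum>v\<in>{v \<in> Sym n. bruhat_le n v w}. if v = u then at_q (P u w) else 0)"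
        by (rule sum.cong) (auto simp: T_def)
      also have "\<dots> = at_q (p u)" using finite_Sym by (simp add: p_def)
      finally show ?thesis .
    qed
    then have "qp (- int (len n w)) * (qp (int (len n w)) * C w u) = KLelt n w p u" for u
      by (simp add: KLelt_def)
    then have elt: "C w = KLelt n w p" unfolding qp_mult_left by (simp add: fun_eq_iff)
    have "u = w \<or> 2 * k + len n u + 1 \<le> len n w" if "coeff (p u) k \<noteq> 0" for u k
    proof (cases "u = w")
      case False
      have u: "u \<in> Sym n" "bruhat_less n u w" "p u = P u w"
        using that False by (auto simp: p_def bruhat_less_def split: if_splits)
      have "k \<le> degree (P u w)" using that u by (simp add: le_degree)
      then show ?thesis using P(3) [OF u(1,2)] by simp
    qed simp
    then have "KLweak n w p"
      using bar elt w P(2) by (auto simp: KLweak_def p_def split: if_splits)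
    then have "p = klpol n w" using KLweak_unique KLpoly_klpol [OF w] by (auto simp: KLpoly_def)
    then show ?thesis using elt w by simp
  qed
qed

lemma KL_tilde_eq:
  assumes "w \<in> Sym n"
  shows "KL_tilde n w = (\<lambda>u. at_q (klpol n w u))"
proof -
  have "KL_basis n = (\<lambda>w. if w \<in> Sym n then KLelt n w (klpol n w) else (\<lambda>_. 0))"
    unfolding KL_basis_def using is_KL_basis_klpol is_KL_basis_unique by (rule the_equality)
  then show ?thesis using assms by (simp add: KL_tilde_def scale_def KLelt_def q_half_power)
qed

section \<open>Products of parabolic sums\<close>

definition parabolic_sum :: "nat \<Rightarrow> nat \<Rightarrow> hecke" where
  "parabolic_sum a b = (\<lambda>u. if u permutes {a..b} then 1 else 0)"

lemma reversal_reversal: "a \<le> b \<Longrightarrow> reversal a b (reversal a b x) = x"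
  by (auto simp: reversal_def)

lemma reversal_permutes: "a \<le> b \<Longrightarrow> reversal a b permutes {a..b}"
proof (rule bij_imp_permutes)
  assume "a \<le> b"
  then show "bij_betw (reversal a b) {a..b} {a..b}"
    by (intro bij_betw_byWitness [where f' = "reversal a b"]) (auto simp: reversal_reversal, auto simp: reversal_def)
qed (auto simp: reversal_def)

lemma parabolic_inversion:
  fixes u :: perm
  assumes u: "u permutes {a..b}" and "i < j" "u j < u i"
  shows "i \<in> {a..b} \<and> j \<in> {a..b}"
proof -
  have rng: "a \<le> u x \<and> u x \<le> b" if "a \<le> x" "x \<le> b" for x
    using permutes_in_image [OF u, of x] that by auto
  have fixed: "u x = x" if "x < a \<or> b < x" for x
    using that by (intro permutes_not_in [OF u]) auto
  have "a \<le> i \<and> j \<le> b"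
    using assms(2,3) rng [of i] rng [of j] fixed [of i] fixed [of j] by linarith
  then show ?thesis using assms(2) by simp
qed

lemma inversions_parabolic:
  assumes "u permutes {a..b}" "1 \<le> a" "b \<le> n"
  shows "inversions n u = {(i, j). a \<le> i \<and> i < j \<and> j \<le> b \<and> u j < u i}"
  using parabolic_inversion [OF assms(1)] assms(2,3) by (force simp: inversions_def)

text \<open>Composition with the reversal reflects pairs of positions and exchanges inversions with
  non-inversions inside the interval.\<close>

lemma len_comp_reversal:
  assumes u: "u permutes {a..b}" and ab: "1 \<le> a" "a \<le> b" "b \<le> n"
  shows "len n (u \<circ> reversal a b) + len n u = card {(i, j). a \<le> i \<and> i < j \<and> j \<le> b}"
proof -
  let ?P = "{(i, j). a \<le> i \<and> i < j \<and> j \<le> b}" and ?r = "reversal a b"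
  have ur: "u \<circ> ?r permutes {a..b}" using permutes_compose [OF reversal_permutes u] ab by simp
  have inj: "u i = u j \<longleftrightarrow> i = j" for i j using u permutes_inj by (metis injD)
  have fin: "finite ?P" by (rule finite_subset [of _ "{..b} \<times> {..b}"]) auto
  have "bij_betw (\<lambda>(i, j). (a + b - j, a + b - i)) (inversions n (u \<circ> ?r)) (?P - inversions n u)"
    unfolding inversions_parabolic [OF u ab(1,3)] inversions_parabolic [OF ur ab(1,3)]
  proof (rule bij_betw_byWitness [where f' = "\<lambda>(i, j). (a + b - j, a + b - i)"])
    show "(\<lambda>(i, j). (a + b - j, a + b - i)) ` {(i, j). a \<le> i \<and> i < j \<and> j \<le> b \<and> (u \<circ> ?r) j < (u \<circ> ?r) i}
      \<subseteq> ?P - {(i, j). a \<le> i \<and> i < j \<and> j \<le> b \<and> u j < u i}"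
      by (auto simp: reversal_def)
    show "(\<lambda>(i, j). (a + b - j, a + b - i)) ` (?P - {(i, j). a \<le> i \<and> i < j \<and> j \<le> b \<and> u j < u i})
      \<subseteq> {(i, j). a \<le> i \<and> i < j \<and> j \<le> b \<and> (u \<circ> ?r) j < (u \<circ> ?r) i}"
    proof
      fix x assume "x \<in> (\<lambda>(i, j). (a + b - j, a + b - i)) ` (?P - {(i, j). a \<le> i \<and> i < j \<and> j \<le> b \<and> u j < u i})"
      then obtain i j where ij: "x = (a + b - j, a + b - i)" "a \<le> i" "i < j" "j \<le> b" "\<not> u j < u i" by auto
      then have "u i < u j" using inj [of i j] by linarith
      then show "x \<in> {(i, j). a \<le> i \<and> i < j \<and> j \<le> b \<and> (u \<circ> ?r) j < (u \<circ> ?r) i}"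
        using ij by (auto simp: reversal_def)
    qed
  qed auto
  then have "card (inversions n (u \<circ> ?r)) = card (?P - inversions n u)" by (rule bij_betw_same_card)
  moreover have "inversions n u \<subseteq> ?P" unfolding inversions_parabolic [OF u ab(1,3)] by auto
  ultimately show ?thesis
    using fin permutes_subset_Sym [OF u ab(1,3)] permutes_subset_Sym [OF ur ab(1,3)]
    by (simp add: len_eq_card_inversions card_Diff_subset finite_inversions card_mono)
qed

lemma len_reversal:
  assumes "1 \<le> a" "a \<le> b" "b \<le> n"
  shows "len n (reversal a b) = card {(i, j). a \<le> i \<and> i < j \<and> j \<le> b}"
  using len_comp_reversal [OF permutes_id assms] by (simp add: len_id)

lemma len_eq_0D:
  assumes "w \<in> Sym n" "len n w = 0" shows "w = id"
proof (rule ccontr)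
  assume "w \<noteq> id"
  then obtain i where "1 \<le> i" "i < n" "\<not> left_ascent i w" using exists_descent assms by blast
  then show False using len_down [OF assms(1)] assms(2) by simp
qed

lemma len_less_reversal:
  assumes u: "u permutes {a..b}" and ab: "1 \<le> a" "a \<le> b" "b \<le> n" and "u \<noteq> reversal a b"
  shows "len n u < len n (reversal a b)"
proof (rule ccontr)
  assume "\<not> len n u < len n (reversal a b)"
  then have "len n (u \<circ> reversal a b) = 0"
    using len_comp_reversal [OF u ab] len_reversal [OF ab] by simp
  moreover have "u \<circ> reversal a b \<in> Sym n"
    using permutes_compose [OF reversal_permutes u] permutes_subset_Sym ab by blast
  ultimately have "u \<circ> reversal a b = id" using len_eq_0D by blast
  from fun_cong [OF this] have "u (reversal a b y) = y" for y by simp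
  from this [of "reversal a b _"] have "u = reversal a b"
    by (simp add: reversal_reversal [OF ab(2)] fun_eq_iff)
  then show False using assms by blast
qed

lemma parabolic_sum_Hecke: "1 \<le> a \<Longrightarrow> b \<le> n \<Longrightarrow> parabolic_sum a b \<in> Hecke n"
  using permutes_subset_Sym [of _ a b n] by (auto simp: parabolic_sum_def Hecke_def)

lemma permutes_adj_iff:
  assumes "a \<le> i" "i < b" shows "adj i \<circ> u permutes {a..b} \<longleftrightarrow> u permutes {a..b}"
  using permutes_compose [OF _ permutes_adj [OF assms], of u]
    permutes_compose [OF _ permutes_adj [OF assms], of "adj i \<circ> u"] by auto

lemma left_T_parabolic_sum:
  assumes "1 \<le> a" "b \<le> n" "a \<le> i" "i < b"
  shows "left_T n i (parabolic_sum a b) = scale q (parabolic_sum a b)"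
  using permutes_subset_Sym [of _ a b n] assms permutes_adj_iff [OF assms(3,4)]
  by (auto simp: left_T_def parabolic_sum_def scale_def)

text \<open>The parabolic sum is an eigenvector with eigenvalue \<open>q\<close> of the generators
  of its subgroup, and so is its bar. Such an eigenvector is constant on the subgroup; the constant
  is read off at the reversal, where only the longest element contributes.\<close>

lemma hbar_parabolic_sum:
  assumes ab: "1 \<le> a" "a \<le> b" "b \<le> n"
  shows "hbar n (parabolic_sum a b) = scale (qp (- 2 * int (len n (reversal a b)))) (parabolic_sum a b)"
proof -
  let ?h = "hbar n (parabolic_sum a b)" and ?r = "reversal a b"
  have h: "?h u = (\<Sum>w\<in>Sym n. laurent_bar (parabolic_sum a b w) * barT n w u)" for u
    by (simp add: hbar_eq lincomb_def)
  have supp: "u permutes {a..b}" if nz: "?h u \<noteq> 0" for u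
  proof (rule ccontr)
    assume nu: "\<not> u permutes {a..b}"
    have "?h u = 0" unfolding h
    proof (intro sum.neutral ballI)
      fix w
      show "laurent_bar (parabolic_sum a b w) * barT n w u = 0"
        using barT_support [OF ab(1,3), of w] nu by (auto simp: parabolic_sum_def)
    qed
    then show False using nz by simp
  qed
  have LH: "left_T n i ?h = scale q ?h" if "a \<le> i" "i < b" for i
  proof -
    have i: "1 \<le> i" "i < n" using that ab by auto
    have "left_T_inv n i ?h = hbar n (scale q (parabolic_sum a b))"
      using hbar_left_T [OF i parabolic_sum_Hecke [OF ab(1,3)]] left_T_parabolic_sum [OF ab(1,3) that] by simp
    also have "\<dots> = scale (qp (- 2)) ?h"
      unfolding semilinearD(2) [OF semilinear_hbar] by (simp add: q_eq)
    finally have "left_T n i (left_T_inv n i ?h) = scale (qp (- 2)) (left_T n i ?h)"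
      by (simp add: semilinearD(2) [OF linear_left_T])
    then have "?h = scale (qp (- 2)) (left_T n i ?h)" using left_T_left_T_inv(1) [OF i hbar_Hecke] by simp
    then have "scale q ?h = scale q (scale (qp (- 2)) (left_T n i ?h))" by (rule arg_cong)
    then show ?thesis by (simp add: scale_def q_eq)
  qed
  have const: "?h u = ?h id" if "u permutes {a..b}" for u
    using that ab(1,3)
  proof (induction rule: permutes_left_induct)
    case id show "?h id = ?h id" ..
  next
    case (step i v)
    have v: "v \<in> Sym n" using step ab permutes_subset_Sym by blast
    have "q * ?h (adj i \<circ> v) = q * ?h v"
      using fun_cong [OF LH [OF step(1,2)], of v] v step by (simp add: left_T_def scale_def)
    then have "qp (- 2) * (qp 2 * ?h (adj i \<circ> v)) = qp (- 2) * (qp 2 * ?h v)" by (simp add: q_eq)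
    then have "?h (adj i \<circ> v) = ?h v" unfolding qp_mult_left by simp
    also have "?h v = ?h id" by (rule step.IH)
    finally show "?h (adj i \<circ> v) = ?h id" .
  qed
  have r: "?r permutes {a..b}" using reversal_permutes [OF ab(2)] .
  then have r': "?r \<in> Sym n" using permutes_subset_Sym ab(1,3) by simp
  have "?h ?r = (\<Sum>w\<in>Sym n. if w = ?r then qp (- 2 * int (len n ?r)) else 0)"
    unfolding h
  proof (rule sum.cong [OF refl])
    fix w assume "w \<in> Sym n"
    show "laurent_bar (parabolic_sum a b w) * barT n w ?r = (if w = ?r then qp (- 2 * int (len n ?r)) else 0)"
    proof (cases "w permutes {a..b}")
      case True
      have "barT n w ?r = 0" if ne: "w \<noteq> ?r"
      proof (rule ccontr)
        assume "barT n w ?r \<noteq> 0"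
        then have "?r = w \<or> len n ?r < len n w" using barT_support [OF ab(1,3) True] by blast
        then show False using len_less_reversal [OF True ab ne] ne by auto
      qed
      moreover have "barT n ?r ?r = qp (- 2 * int (len n ?r))"
        using barT_support [OF ab(1,3) r] by blast
      ultimately show ?thesis using True by (auto simp: parabolic_sum_def)
    next
      case False
      then show ?thesis using r by (auto simp: parabolic_sum_def)
    qed
  qed
  also have "\<dots> = qp (- 2 * int (len n ?r))" using r' finite_Sym by simp
  finally have hid: "?h id = qp (- 2 * int (len n ?r))" unfolding const [OF r] .
  show ?thesis
  proof
    fix u
    show "?h u = scale (qp (- 2 * int (len n ?r))) (parabolic_sum a b) u"
    proof (cases "u permutes {a..b}")
      case True
      from const [OF this] hid show ?thesis using True by (simp only: scale_def parabolic_sum_def if_True mult_1_right)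
    next
      case False
      then show ?thesis using supp [of u] by (auto simp: scale_def parabolic_sum_def)
    qed
  qed
qed

text \<open>The polynomials equal to 1 on the subgroup satisfy \<open>KLweak\<close>: their degree
  is 0, and every other element of the subgroup is shorter than the reversal. Uniqueness does the
  rest.\<close>

lemma KL_tilde_reversal:
  assumes ab: "1 \<le> a" "a \<le> b" "b \<le> n"
  shows "KL_tilde n (reversal a b) = parabolic_sum a b"
proof -
  let ?r = "reversal a b" and ?p = "\<lambda>u. if u permutes {a..b} then 1 else 0 :: int poly"
  have r: "?r permutes {a..b}" using reversal_permutes [OF ab(2)] .
  then have r': "?r \<in> Sym n" using permutes_subset_Sym ab(1,3) by simp
  have elt: "KLelt n ?r ?p = scale (qp (- int (len n ?r))) (parabolic_sum a b)"
    by (auto simp: KLelt_def scale_def parabolic_sum_def)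
  have "hbar n (KLelt n ?r ?p) = KLelt n ?r ?p"
    unfolding elt semilinearD(2) [OF semilinear_hbar] hbar_parabolic_sum [OF ab] by (simp add: scale_def)
  moreover have "u \<in> Sym n \<and> (u = ?r \<or> 2 * k + len n u + 1 \<le> len n ?r)" if nz: "coeff (?p u) k \<noteq> 0" for u k
  proof -
    have u: "u permutes {a..b}" "k = 0" using nz by (auto simp: coeff_1 split: if_splits)
    have "len n u + 1 \<le> len n ?r" if "u \<noteq> ?r"
      using len_less_reversal [OF u(1) ab that] by simp
    then show ?thesis using permutes_subset_Sym [OF u(1) ab(1,3)] u(2) by (cases "u = ?r") auto
  qed
  ultimately have "KLweak n ?r ?p" using r r' unfolding KLweak_def by simp
  then have p: "?p = klpol n ?r"
    using KLweak_unique KLpoly_klpol [OF r'] by (auto simp: KLpoly_def)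
  show ?thesis
  proof
    fix u
    have "klpol n ?r u = ?p u" using fun_cong [OF p, of u] by simp
    then show "KL_tilde n ?r u = parabolic_sum a b u" by (simp add: KL_tilde_eq [OF r'] parabolic_sum_def)
  qed
qed

text \<open>The index character of the algebra: \<open>T (adj i) \<mapsto> q\<close> respects the
  quadratic relation since \<open>q\<close> is a root of \<open>x^2 = (q - 1) x + q\<close>. Hence
  it is multiplicative, see \<open>poincare_hmult\<close>.\<close>

definition poincare :: "nat \<Rightarrow> hecke \<Rightarrow> laurent" where
  "poincare n h = (\<Sum>w\<in>Sym n. h w * q ^ len n w)"

lemma poincare_lincomb: "poincare n (lincomb n c B) = (\<Sum>w\<in>Sym n. c w * poincare n (B w))"
proof -
  have "poincare n (lincomb n c B) = (\<Sum>u\<in>Sym n. \<Sum>w\<in>Sym n. c w * (B w u * q ^ len n u))"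
    by (simp add: poincare_def lincomb_def sum_distrib_right mult.assoc)
  also have "\<dots> = (\<Sum>w\<in>Sym n. c w * poincare n (B w))"
    by (subst sum.swap) (simp add: poincare_def sum_distrib_left)
  finally show ?thesis .
qed

lemma poincare_T: "w \<in> Sym n \<Longrightarrow> poincare n (T w) = q ^ len n w"
  by (simp add: poincare_def T_def finite_Sym if_distrib [of "\<lambda>c. c * _"] cong: if_cong)

lemma poincare_add: "poincare n (\<lambda>u. c * x u + d * y u) = c * poincare n x + d * poincare n y"
  by (simp add: poincare_def distrib_right sum.distrib sum_distrib_left mult.assoc)

lemma poincare_scale: "poincare n (scale c x) = c * poincare n x"
  by (simp add: poincare_def scale_def sum_distrib_left mult.assoc)

lemma poincare_left_T:
  assumes i: "1 \<le> i" "i < n"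
  shows "poincare n (left_T n i h) = q * poincare n h"
proof -
  have "poincare n (gen_T n i w) = q * q ^ len n w" if w: "w \<in> Sym n" for w
  proof (cases "left_ascent i w")
    case True
    then show ?thesis
      using w i by (simp add: gen_T_def bruhat_less_adj_iff poincare_T Sym_adj_left len_up)
  next
    case False
    then have "len n w = Suc (len n (adj i \<circ> w))" using len_down w i by blast
    then show ?thesis
      using w i False by (simp add: gen_T_def bruhat_less_adj_iff poincare_add poincare_T Sym_adj_left) (simp add: algebra_simps)
  qed
  then show ?thesis
    unfolding gen_mult_eq [OF i, symmetric] gen_mult_def poincare_lincomb
    by (simp add: poincare_def sum_distrib_left mult.left_commute)
qed

lemma poincare_T_mult:
  assumes "w \<in> Sym n" "h \<in> Hecke n"
  shows "poincare n (T_mult n w h) = q ^ len n w * poincare n h"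
proof -
  from reduced_word_exists [OF assms(1)] obtain "is" where r: "reduced_word n w is" ..
  have "poincare n (foldr (left_T n) js h) = q ^ length js * poincare n h" if "set js \<subseteq> {1..<n}" for js
    using that by (induction js) (simp_all add: poincare_left_T mult.assoc)
  then show ?thesis using T_mult_eq [OF r assms(2)] r by (simp add: reduced_word_def word_for_def)
qed

lemma poincare_hmult:
  assumes "y \<in> Hecke n" shows "poincare n (hmult n x y) = poincare n x * poincare n y"
  unfolding hmult_def poincare_lincomb
  by (simp add: poincare_T_mult assms poincare_def [of n x] sum_distrib_right mult.assoc)

lemma hprod_Hecke: "(\<And>x. x \<in> set xs \<Longrightarrow> x \<in> Hecke n) \<Longrightarrow> hprod n xs \<in> Hecke n"
  by (induction xs) (simp_all add: hprod_def hone_Hecke hmult_Hecke)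

lemma poincare_hprod:
  "(\<And>x. x \<in> set xs \<Longrightarrow> x \<in> Hecke n) \<Longrightarrow> poincare n (hprod n xs) = prod_list (map (poincare n) xs)"
proof (induction xs)
  case Nil
  show ?case by (simp add: hprod_def hone_def poincare_T Sym_id len_id)
next
  case (Cons x xs)
  then show ?case using poincare_hmult [of "hprod n xs" n x] hprod_Hecke [of xs n] by (simp add: hprod_def)
qed

text \<open>Nonnegativity is tested at \<open>q = 2\<close>, where the structure constants \<open>q\<close> and \<open>q - 1\<close> are both
  positive, so that no cancellation occurs in a product of parabolic sums.\<close>

definition nonneg_at_2 :: "laurent \<Rightarrow> bool" where
  "nonneg_at_2 x \<longleftrightarrow> (\<exists>p. x = at_q p \<and> 0 \<le> poly p 2)"

definition pos_at_2 :: "laurent \<Rightarrow> bool" where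
  "pos_at_2 x \<longleftrightarrow> (\<exists>p. x = at_q p \<and> 0 < poly p 2)"

lemma at_q_X: "at_q [:0, 1:] = q" "at_q [:-1, 1:] = q - 1"
  by (simp_all add: at_q_pCons)

lemma nonneg_at_2I: "0 \<le> poly p 2 \<Longrightarrow> nonneg_at_2 (at_q p)"
  unfolding nonneg_at_2_def by blast

lemma pos_at_2I: "0 < poly p 2 \<Longrightarrow> pos_at_2 (at_q p)"
  unfolding pos_at_2_def by blast

lemma pos_at_2_nonneg_at_2: "pos_at_2 x \<Longrightarrow> nonneg_at_2 x"
  unfolding pos_at_2_def by (auto intro: nonneg_at_2I)

lemma pos_at_2_neq_0: "pos_at_2 x \<Longrightarrow> x \<noteq> 0"
proof
  assume "pos_at_2 x" "x = 0"
  then obtain p where "at_q p = at_q 0" "0 < poly p 2" by (auto simp: pos_at_2_def)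
  then show False unfolding at_q_inject by simp
qed

lemma nonneg_at_2_0: "nonneg_at_2 0"
  using nonneg_at_2I [of 0] by simp

lemma pos_at_2_1: "pos_at_2 1"
  using pos_at_2I [of 1] by simp

lemma nonneg_at_2_add: "nonneg_at_2 x \<Longrightarrow> nonneg_at_2 y \<Longrightarrow> nonneg_at_2 (x + y)"
  unfolding nonneg_at_2_def [of x] nonneg_at_2_def [of y] by (auto simp flip: at_q_add intro!: nonneg_at_2I)

lemma pos_at_2_add: "pos_at_2 x \<Longrightarrow> nonneg_at_2 y \<Longrightarrow> pos_at_2 (x + y)"
  unfolding pos_at_2_def [of x] nonneg_at_2_def [of y] by (auto simp flip: at_q_add intro!: pos_at_2I)

lemma nonneg_at_2_mult_q:
  assumes "nonneg_at_2 x" shows "nonneg_at_2 (q * x)" "nonneg_at_2 ((q - 1) * x)"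
proof -
  from assms obtain p where p: "x = at_q p" "0 \<le> poly p 2" by (auto simp: nonneg_at_2_def)
  have "q * x = at_q ([:0, 1:] * p)" "(q - 1) * x = at_q ([:-1, 1:] * p)"
    unfolding at_q_mult at_q_X p by simp_all
  then show "nonneg_at_2 (q * x)" "nonneg_at_2 ((q - 1) * x)"
    using p(2) nonneg_at_2I [of "[:0, 1:] * p"] nonneg_at_2I [of "[:-1, 1:] * p"] by simp_all
qed

lemma pos_at_2_mult_q: "pos_at_2 x \<Longrightarrow> pos_at_2 (q * x)"
proof -
  assume "pos_at_2 x"
  then obtain p where p: "x = at_q p" "0 < poly p 2" by (auto simp: pos_at_2_def)
  have "q * x = at_q ([:0, 1:] * p)" unfolding at_q_mult at_q_X p by simp
  then show "pos_at_2 (q * x)" using p(2) pos_at_2I [of "[:0, 1:] * p"] by simp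
qed

lemma nonneg_at_2_sum: "(\<And>x. x \<in> S \<Longrightarrow> nonneg_at_2 (f x)) \<Longrightarrow> nonneg_at_2 (sum f S)"
  by (induction S rule: infinite_finite_induct) (simp_all add: nonneg_at_2_0 nonneg_at_2_add)

lemma pos_at_2_sum: "finite S \<Longrightarrow> (\<And>x. x \<in> S \<Longrightarrow> nonneg_at_2 (f x)) \<Longrightarrow> y \<in> S \<Longrightarrow> pos_at_2 (f y) \<Longrightarrow> pos_at_2 (sum f S)"
  unfolding sum.remove [of S y f] by (intro pos_at_2_add nonneg_at_2_sum) auto

lemma left_T_nonneg_at_2:
  assumes h: "\<And>v. nonneg_at_2 (h v)"
  shows "nonneg_at_2 (left_T n i h v)"
  using h by (auto simp: left_T_def nonneg_at_2_0 intro!: nonneg_at_2_add nonneg_at_2_mult_q)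

text \<open>The product of \<open>T (adj i)\<close> and \<open>T v\<close> contains
  \<open>T (adj i \<circ> v)\<close> with coefficient 1 or \<open>q\<close>, whether or not
  \<open>i\<close> is an ascent.\<close>

lemma left_T_pos_at_2:
  assumes h: "\<And>v. nonneg_at_2 (h v)" and i: "1 \<le> i" "i < n" and v: "v \<in> Sym n" "pos_at_2 (h v)"
  shows "pos_at_2 (left_T n i h (adj i \<circ> v))"
  using v h by (auto simp: left_T_def Sym_adj_left [OF i] intro!: pos_at_2_add pos_at_2_mult_q nonneg_at_2_mult_q)

lemma foldr_left_T_nonneg_at_2: "(\<And>v. nonneg_at_2 (h v)) \<Longrightarrow> nonneg_at_2 (foldr (left_T n) is h v)"
  by (induction "is" arbitrary: v) (simp_all add: left_T_nonneg_at_2)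

lemma word_perm_Sym: "set is \<subseteq> {1..<n} \<Longrightarrow> word_perm is \<in> Sym n"
  using word_forD(1) [of n "word_perm is" "is"] by (simp add: word_for_def)

lemma foldr_left_T_pos_at_2:
  assumes h: "\<And>v. nonneg_at_2 (h v)" and v: "v \<in> Sym n" "pos_at_2 (h v)"
  shows "set is \<subseteq> {1..<n} \<Longrightarrow> pos_at_2 (foldr (left_T n) is h (word_perm is \<circ> v))"
proof (induction "is")
  case Nil
  then show "pos_at_2 (foldr (left_T n) [] h (word_perm [] \<circ> v))" using v by (simp add: word_perm_def)
next
  case (Cons i "is")
  have "pos_at_2 (foldr (left_T n) is h (word_perm is \<circ> v))" using Cons.prems by (intro Cons.IH) simp
  then have "pos_at_2 (left_T n i (foldr (left_T n) is h) (adj i \<circ> (word_perm is \<circ> v)))"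
    using Cons.prems Sym_comp [OF word_perm_Sym v(1), of "is"]
    by (intro left_T_pos_at_2 foldr_left_T_nonneg_at_2 h) auto
  then show "pos_at_2 (foldr (left_T n) (i # is) h (word_perm (i # is) \<circ> v))"
    by (simp add: word_perm_Cons comp_assoc)
qed

lemma left_T_support: "left_T n i g v \<noteq> 0 \<Longrightarrow> g v \<noteq> 0 \<or> g (adj i \<circ> v) \<noteq> 0"
  by (auto simp: left_T_def split: if_splits)

lemma foldr_left_T_support:
  "set is \<subseteq> {a..<b} \<Longrightarrow> foldr (left_T n) is h v \<noteq> 0 \<Longrightarrow> \<exists>x. x permutes {a..b} \<and> h (x \<circ> v) \<noteq> 0"
proof (induction "is" arbitrary: v)
  case Nil
  then show ?case using permutes_id by (metis foldr_Nil id_apply id_comp)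
next
  case (Cons i "is")
  have i: "a \<le> i" "i < b" using Cons.prems by auto
  have "foldr (left_T n) is h v \<noteq> 0 \<or> foldr (left_T n) is h (adj i \<circ> v) \<noteq> 0"
    using Cons.prems(2) left_T_support [of n i "foldr (left_T n) is h" v] by simp
  then show ?case
  proof
    assume "foldr (left_T n) is h v \<noteq> 0"
    then show ?thesis using Cons by simp
  next
    assume nz: "foldr (left_T n) is h (adj i \<circ> v) \<noteq> 0"
    have "set is \<subseteq> {a..<b}" using Cons.prems(1) by simp
    from Cons.IH [OF this nz]
    obtain x where x: "x permutes {a..b}" "h (x \<circ> (adj i \<circ> v)) \<noteq> 0" by blast
    then have "(x \<circ> adj i) permutes {a..b}" using permutes_compose [OF permutes_adj [OF i]] by blast
    then show "\<exists>x. x permutes {a..b} \<and> h (x \<circ> v) \<noteq> 0"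
      using x(2) by (intro exI [of _ "x \<circ> adj i"]) (simp add: comp_assoc)
  qed
qed

section \<open>The support of a product of parabolic sums\<close>

fun prods :: "(nat \<times> nat) list \<Rightarrow> perm set" where
  "prods [] = {id}"
| "prods ((a, b) # A) = {u \<circ> v |u v. u permutes {a..b} \<and> v \<in> prods A}"

abbreviation intervals_in :: "nat \<Rightarrow> (nat \<times> nat) list \<Rightarrow> bool" where
  "intervals_in n A \<equiv> \<forall>(a, b)\<in>set A. 1 \<le> a \<and> a \<le> b \<and> b \<le> n"

abbreviation parabolic_prod :: "nat \<Rightarrow> (nat \<times> nat) list \<Rightarrow> hecke" where
  "parabolic_prod n A \<equiv> hprod n (map (\<lambda>(a, b). parabolic_sum a b) A)"

lemma prods_Sym: "intervals_in n A \<Longrightarrow> prods A \<subseteq> Sym n"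
proof (induction A rule: prods.induct)
  case 1
  then show ?case by (simp add: Sym_id)
next
  case (2 a b A)
  then have "u \<in> Sym n" if "u permutes {a..b}" for u
    using that permutes_subset_Sym by auto
  with 2 show ?case by (auto intro!: Sym_comp)
qed

text \<open>Without cancellation the support is the setwise product of the subgroups. One inclusion
  places \<open>w\<close> in that product, the other forces every element of the product into the
  support of \<open>KL_tilde n w\<close>.\<close>

lemma hprod_support:
  "intervals_in n A \<Longrightarrow>
    (\<forall>v. nonneg_at_2 (parabolic_prod n A v)) \<and> (\<forall>v\<in>prods A. pos_at_2 (parabolic_prod n A v)) \<and> (\<forall>v. parabolic_prod n A v \<noteq> 0 \<longrightarrow> v \<in> prods A)"
proof (induction A rule: prods.induct)
  case 1
  show ?case by (auto simp: hprod_def hone_def T_def nonneg_at_2_0 pos_at_2_1 pos_at_2_nonneg_at_2)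
next
  case (2 a b A)
  let ?h = "parabolic_prod n A"
  have ab: "1 \<le> a" "a \<le> b" "b \<le> n" and A: "intervals_in n A" using "2.prems" by auto
  have IH: "\<And>v. nonneg_at_2 (?h v)" "\<And>v. v \<in> prods A \<Longrightarrow> pos_at_2 (?h v)" "\<And>v. ?h v \<noteq> 0 \<Longrightarrow> v \<in> prods A"
    using "2.IH" [OF A] by blast+
  have H: "?h \<in> Hecke n" using A parabolic_sum_Hecke by (intro hprod_Hecke) auto
  have val: "parabolic_prod n ((a, b) # A) v = (\<Sum>u\<in>Sym n. parabolic_sum a b u * T_mult n u ?h v)" for v
    by (simp add: hprod_def hmult_def lincomb_def)
  have word: "\<exists>is. set is \<subseteq> {a..<b} \<and> word_perm is = u \<and> T_mult n u ?h = foldr (left_T n) is ?h"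
    if "u permutes {a..b}" for u
    using reduced_word_parabolic [OF that ab(1,3)] T_mult_eq [OF _ H] by (auto simp: reduced_word_def word_for_def)
  have sub: "set is \<subseteq> {1..<n}" if "set is \<subseteq> {a..<b}" for "is" using that ab by auto
  have nn: "nonneg_at_2 (parabolic_sum a b u * T_mult n u ?h v)" for u v
    using word [of u] foldr_left_T_nonneg_at_2 [of ?h n _ v] IH(1) by (auto simp: parabolic_sum_def nonneg_at_2_0)
  then have "nonneg_at_2 (parabolic_prod n ((a, b) # A) v)" for v unfolding val by (rule nonneg_at_2_sum)
  moreover have "pos_at_2 (parabolic_prod n ((a, b) # A) x)" if "x \<in> prods ((a, b) # A)" for x
  proof -
    from that obtain u v where x: "x = u \<circ> v" and u: "u permutes {a..b}" and v: "v \<in> prods A" by auto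
    from word [OF u] obtain "is" where "is": "set is \<subseteq> {a..<b}" "word_perm is = u"
      "T_mult n u ?h = foldr (left_T n) is ?h" by blast
    have "pos_at_2 (foldr (left_T n) is ?h (word_perm is \<circ> v))"
      using IH v prods_Sym [OF A] sub [OF "is"(1)] by (intro foldr_left_T_pos_at_2) auto
    then have "pos_at_2 (parabolic_sum a b u * T_mult n u ?h x)" using "is" u by (simp add: parabolic_sum_def x)
    then show ?thesis
      unfolding val using permutes_subset_Sym [OF u ab(1,3)] nn by (intro pos_at_2_sum [OF finite_Sym]) auto
  qed
  moreover have "v \<in> prods ((a, b) # A)" if nz: "parabolic_prod n ((a, b) # A) v \<noteq> 0" for v
  proof -
    obtain u where "parabolic_sum a b u * T_mult n u ?h v \<noteq> 0" using nz unfolding val by (meson sum.neutral)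
    then have "u permutes {a..b}" "T_mult n u ?h v \<noteq> 0" by (auto simp: parabolic_sum_def split: if_splits)
    then obtain x where x: "x permutes {a..b}" "x \<circ> v \<in> prods A"
      using word [of u] foldr_left_T_support IH(3) by metis
    have "v = inv x \<circ> (x \<circ> v)" using permutes_inv_o(2) [OF x(1)] by (simp add: o_assoc)
    then show ?thesis using x permutes_inv by auto
  qed
  ultimately show ?case by blast
qed

section \<open>Coatoms and the patterns 4231 and 3412\<close>

text \<open>The inversions \<open>(a, b)\<close> for which \<open>w \<circ> transpose a b\<close>
  can be a coatom of \<open>w\<close>: no value strictly between occurs at a position strictly
  between.\<close>

definition covers :: "nat \<Rightarrow> perm \<Rightarrow> (nat \<times> nat) set" where
  "covers n w = {(a, b). 1 \<le> a \<and> a < b \<and> b \<le> n \<and> w b < w a \<and> \<not> (\<exists>c. a < c \<and> c < b \<and> w b < w c \<and> w c < w a)}"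

lemma matches_3412:
  "matches [x1, x2, x3, x4] [3, 4, 1, 2] \<longleftrightarrow> x3 < x4 \<and> x4 < x1 \<and> x1 < x2"
  by (auto simp: matches_def All_less_Suc numeral_eq_Suc)

lemma matches_4231:
  "matches [x1, x2, x3, x4] [4, 2, 3, 1] \<longleftrightarrow> x4 < x2 \<and> x2 < x3 \<and> x3 < x1"
  by (auto simp: matches_def All_less_Suc numeral_eq_Suc)

lemma avoids_4231D:
  assumes "avoids n w [4, 2, 3, 1]" "1 \<le> i" "i < j" "j < k" "k < l" "l \<le> n"
  shows "\<not> (w l < w j \<and> w j < w k \<and> w k < w i)"
proof
  assume "w l < w j \<and> w j < w k \<and> w k < w i"
  then have "matches (map w [i, j, k, l]) [4, 2, 3, 1]"
    unfolding list.map matches_4231 .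
  moreover have "set [i, j, k, l] \<subseteq> {1..n}" "sorted_wrt (<) [i, j, k, l]" using assms by auto
  ultimately show False using assms(1) unfolding avoids_def by blast
qed

lemma not_avoids_3412D:
  assumes "\<not> avoids n w [3, 4, 1, 2]"
  obtains i j k l where "1 \<le> i" "i < j" "j < k" "k < l" "l \<le> n" "w k < w l" "w l < w i" "w i < w j"
proof -
  from assms obtain "is" where "is": "set is \<subseteq> {1..n}" "sorted_wrt (<) is" "matches (map w is) [3, 4, 1, 2]"
    by (auto simp: avoids_def)
  then have "length is = 4" by (simp add: matches_def)
  then obtain i j k l where "is = [i, j, k, l]"
    by (auto simp: length_Suc_conv numeral_eq_Suc)
  then have "matches [w i, w j, w k, w l] [3, 4, 1, 2]" using "is"(3) by (simp only: list.map)
  then have "w k < w l" "w l < w i" "w i < w j" unfolding matches_3412 by blast+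
  then show thesis using that [of i j k l] "is"(1,2) \<open>is = _\<close> by simp
qed

lemma gap3412_D:
  assumes "gap3412 n w > 1" "1 \<le> i" "i < j" "j < k" "k < l" "l \<le> n" "w k < w l" "w l < w i" "w i < w j"
  shows "w i \<noteq> Suc (w l)"
proof -
  let ?S = "{int (w i1) - int (w i4) | i1 i2 i3 i4.
     1 \<le> i1 \<and> i1 < i2 \<and> i2 < i3 \<and> i3 < i4 \<and> i4 \<le> n \<and>
     matches [w i1, w i2, w i3, w i4] [3, 4, 1, 2]}"
  have "?S \<subseteq> (\<lambda>(a, b). int (w a) - int (w b)) ` ({..n} \<times> {..n})" by force
  then have "finite ?S" by (rule finite_subset) simp
  moreover have "matches [w i, w j, w k, w l] [3, 4, 1, 2]" using assms unfolding matches_3412 by blast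
  then have "int (w i) - int (w l) \<in> ?S" using assms(2-6) by blast
  ultimately have "Min ?S \<le> int (w i) - int (w l)" by (rule Min_le)
  then show ?thesis using assms(1) by (simp add: gap3412_def)
qed

context
  fixes n :: nat and w :: perm
  assumes w: "w \<in> Sym n"
    and no_4231: "\<And>i j k l. 1 \<le> i \<Longrightarrow> i < j \<Longrightarrow> j < k \<Longrightarrow> k < l \<Longrightarrow> l \<le> n \<Longrightarrow> \<not> (w l < w j \<and> w j < w k \<and> w k < w i)"
    and gap: "\<And>i j k l. 1 \<le> i \<Longrightarrow> i < j \<Longrightarrow> j < k \<Longrightarrow> k < l \<Longrightarrow> l \<le> n \<Longrightarrow>
      w k < w l \<Longrightarrow> w l < w i \<Longrightarrow> w i < w j \<Longrightarrow> w i \<noteq> Suc (w l)"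
begin

text \<open>The positions \<open>a, z, p, b\<close> form a pattern 3412. By the cover condition
  every value strictly between \<open>w b\<close> and \<open>w a\<close> sits left of
  \<open>a\<close> or right of \<open>b\<close>. From \<open>w b\<close> up to \<open>w a\<close>
  the side switches at some pair of values \<open>t\<close>, \<open>Suc t\<close>, with
  \<open>t\<close> at or right of \<open>b\<close> and \<open>Suc t\<close> at or left of
  \<open>a\<close>; together with \<open>z\<close> and \<open>p\<close> these form a pattern 3412 of
  gap 1.\<close>

lemma no_3412_over_covers:
  assumes ab: "(a, b) \<in> covers n w" and "a < z" "z < p" "p < b" "w a < w z" "w p < w b"
  shows False
proof -
  have empty: "\<not> (w b < w c \<and> w c < w a)" if "a < c" "c < b" for c
    using ab that by (auto simp: covers_def)
  have ab': "1 \<le> a" "a < b" "b \<le> n" "w b < w a" using ab by (auto simp: covers_def)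
  have bij: "bij w" using w by (rule Sym_bij)
  have winv: "w (inv w t) = t" for t using bij by (simp add: bij_def surj_f_inv_f)
  have invw: "inv w (w x) = x" for x using bij by (simp add: bij_def inv_f_f)
  let ?S = "{t. w b \<le> t \<and> t < w a \<and> b \<le> inv w t}"
  have fin: "finite ?S" by (rule finite_subset [of _ "{..w a}"]) auto
  have "w b \<in> ?S" using ab' by (simp add: invw)
  then have "?S \<noteq> {}" by blast
  define t where "t = Max ?S"
  have t: "w b \<le> t" "t < w a" "b \<le> inv w t"
    using Max_in [OF fin \<open>?S \<noteq> {}\<close>] unfolding t_def by auto
  have k: "inv w (Suc t) \<le> a"
  proof (cases "Suc t = w a")
    case True
    then show ?thesis by (simp add: invw)
  next
    case False
    then have *: "Suc t < w a" using t by simp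
    have "Suc t \<notin> ?S" using Max_ge [OF fin, of "Suc t"] unfolding t_def by (meson Suc_n_not_le_n)
    then have "inv w (Suc t) < b" using * t by auto
    moreover have "w b < w (inv w (Suc t))" "w (inv w (Suc t)) < w a" using * t by (simp_all add: winv)
    ultimately show ?thesis using empty [of "inv w (Suc t)"] by linarith
  qed
  have wn: "w x \<in> {1..n} \<longleftrightarrow> x \<in> {1..n}" for x using w by (simp add: Sym_def permutes_in_image del: atLeastAtMost_iff)
  have "w a \<in> {1..n}" "w b \<in> {1..n}" unfolding wn using ab' by auto
  then have "inv w t \<in> {1..n}" "inv w (Suc t) \<in> {1..n}"
    using t unfolding wn [of "inv w t", symmetric] wn [of "inv w (Suc t)", symmetric] winv by auto
  then have "1 \<le> inv w (Suc t)" "inv w (Suc t) < z" "z < p" "p < inv w t" "inv w t \<le> n"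
    using assms k t by auto
  from gap [OF this] show False using t assms by (simp add: winv)
qed

text \<open>The point \<open>p\<close> splits the prefix \<open>w 1, \<dots>, w (b - 1)\<close> into a lower and an upper part; adding \<open>w b\<close>
  destroys the split. As a split is destroyed at most once, this makes \<open>(a, b) \<mapsto> p\<close> injective.\<close>

lemma covers_cut:
  assumes ab: "(a, b) \<in> covers n w"
  shows "\<exists>p. a \<le> p \<and> p < b \<and> (\<forall>i j. 1 \<le> i \<longrightarrow> i \<le> p \<longrightarrow> p < j \<longrightarrow> j < b \<longrightarrow> w i < w j) \<and>
    (\<forall>a'. a < a' \<longrightarrow> a' \<le> p \<longrightarrow> (a', b) \<notin> covers n w)"
proof -
  have ab': "1 \<le> a" "a < b" "b \<le> n" "w b < w a" using ab by (auto simp: covers_def)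
  have inj: "w x = w y \<longleftrightarrow> x = y" for x y using Sym_bij [OF w] by (auto simp: bij_def dest: injD)
  let ?S = "{c. a < c \<and> c < b \<and> w b < w c}"
  have S: "w a < w c" if "c \<in> ?S" for c
  proof -
    have "\<not> w c < w a" using ab that by (auto simp: covers_def)
    then show ?thesis using inj [of a c] that by force
  qed
  have fin: "finite ?S" by (rule finite_subset [of _ "{..b}"]) auto
  have CovS: "a' \<in> ?S" if "(a', b) \<in> covers n w" "a < a'" for a' using that by (auto simp: covers_def)
  show ?thesis
  proof (cases "?S = {}")
    case True
    have "\<forall>i j. 1 \<le> i \<longrightarrow> i \<le> b - 1 \<longrightarrow> b - 1 < j \<longrightarrow> j < b \<longrightarrow> w i < w j" by auto
    moreover have "(a', b) \<notin> covers n w" if "a < a'" for a' using CovS True that by blast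
    ultimately show ?thesis using ab' by (intro exI [of _ "b - 1"]) auto
  next
    case False
    then have "Min (w ` ?S) \<in> w ` ?S" using fin by (intro Min_in) auto
    \<comment> \<open>The cut is made just after the last position before \<open>b\<close> whose
      value is below \<open>w y\<close>, where \<open>w y\<close> is the least value over
      \<open>?S\<close>.\<close>
    then obtain y where y: "y \<in> ?S" "w y = Min (w ` ?S)" by force
    have ymin: "w y \<le> w c" if "c \<in> ?S" for c unfolding y(2) using fin that by (intro Min_le) auto
    let ?P = "{c. 1 \<le> c \<and> c < b \<and> w c < w y}"
    have finP: "finite ?P" by (rule finite_subset [of _ "{..b}"]) auto
    have aP: "a \<in> ?P" using ab' S [OF y(1)] by auto
    define p where "p = Max ?P"
    have "p \<in> ?P" unfolding p_def using finP aP by (intro Max_in) auto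
    then have p: "1 \<le> p" "p < b" "w p < w y" by auto
    have pmax: "c \<le> p" if "c \<in> ?P" for c unfolding p_def using finP that by (rule Max_ge)
    have "a \<le> p" using pmax aP by blast
    have below: "w p < w b" if "a < p"
    proof -
      have "p \<notin> ?S" using ymin [of p] p(3) by auto
      then show ?thesis using that p inj [of p b] by force
    qed
    have "p < y"
    proof (rule ccontr)
      assume "\<not> p < y"
      then have "y < p" using p(3) by (metis linorder_neqE_nat less_irrefl)
      then show False using no_3412_over_covers [OF ab, of y p] below y(1) S [OF y(1)] p by auto
    qed
    \<comment> \<open>A larger value at \<open>i < a\<close> completes \<open>a, y, b\<close> to a
      pattern 4231; at \<open>a < i < p\<close> it gives, with \<open>p\<close>, a pattern 3412 over
      the cover \<open>(a, b)\<close>.\<close>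
    have left: "w i < w y" if i: "1 \<le> i" "i \<le> p" for i
    proof (rule ccontr)
      assume "\<not> w i < w y"
      moreover have "i \<noteq> y" using i \<open>p < y\<close> by auto
      ultimately have wi: "w y < w i" using inj [of i y] by linarith
      have "i \<noteq> a" using wi S [OF y(1)] by auto
      then consider "i < a" | "a < i" by linarith
      then show False
      proof cases
        case 1
        then show False using no_4231 [of i a y b] i y(1) ab' wi S [OF y(1)] by auto
      next
        case 2
        have "i \<noteq> p" using wi p by auto
        then have "i < p" using i by simp
        then show False using no_3412_over_covers [OF ab 2, of p] below p 2 wi S [OF y(1)] by auto
      qed
    qed
    have "w i < w j" if "1 \<le> i" "i \<le> p" "p < j" "j < b" for i j
    proof -
      have "j \<notin> ?P" using pmax [of j] that by auto
      then have "w y \<le> w j" using that by auto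
      then show ?thesis using left that by force
    qed
    moreover have "(a', b) \<notin> covers n w" if "a < a'" "a' \<le> p" for a'
      using CovS [of a'] ymin [of a'] left [of a'] that ab' by force
    ultimately show ?thesis using \<open>a \<le> p\<close> p by blast
  qed
qed

text \<open>The right-hand side counts the simple reflections occurring in \<open>w\<close>. Two
  covers with the same cut \<open>p\<close> agree: if \<open>b < b'\<close>, the split for
  \<open>b'\<close> would give \<open>w a < w b\<close>, and for equal \<open>b\<close> the last
  clause of \<open>covers_cut\<close> fixes \<open>a\<close>. The cut counts because
  \<open>w\<close> inverts \<open>a \<le> p < b\<close>: were \<open>{1..p}\<close> stable,
  \<open>w b < w a \<le> p\<close> would force \<open>b \<le> p\<close>.\<close>

lemma card_covers_le: "card (covers n w) \<le> card {p. 1 \<le> p \<and> p < n \<and> \<not> w ` {1..p} \<subseteq> {1..p}}"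
proof -
  define good where "good a b p \<longleftrightarrow> a \<le> p \<and> p < b \<and>
    (\<forall>i j. 1 \<le> i \<longrightarrow> i \<le> p \<longrightarrow> p < j \<longrightarrow> j < b \<longrightarrow> w i < w j) \<and>
    (\<forall>a'. a < a' \<longrightarrow> a' \<le> p \<longrightarrow> (a', b) \<notin> covers n w)" for a b p
  define f where "f x = (SOME p. good (fst x) (snd x) p)" for x
  have good: "good a b (f (a, b))" if "(a, b) \<in> covers n w" for a b
  proof -
    have "\<exists>p. good a b p" using covers_cut [OF that] unfolding good_def .
    then show ?thesis unfolding f_def fst_conv snd_conv by (rule someI_ex)
  qed
  have f1: "a \<le> f (a, b)" "f (a, b) < b" if "(a, b) \<in> covers n w" for a b
    using good [OF that] unfolding good_def by simp_all
  have f2: "w i < w j" if "(a, b) \<in> covers n w" "1 \<le> i" "i \<le> f (a, b)" "f (a, b) < j" "j < b" for a b i j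
    using good [OF that(1)] that(2-) unfolding good_def by simp
  have f3: "(a', b) \<notin> covers n w" if "(a, b) \<in> covers n w" "a < a'" "a' \<le> f (a, b)" for a b a'
    using good [OF that(1)] that(2-) unfolding good_def by simp
  have C: "1 \<le> a \<and> a < b \<and> b \<le> n \<and> w b < w a" if "(a, b) \<in> covers n w" for a b
    using that by (auto simp: covers_def)
  have not_less: "\<not> b < b'" if "(a, b) \<in> covers n w" "(a', b') \<in> covers n w" "f (a, b) = f (a', b')" for a b a' b'
  proof
    assume "b < b'"
    then have "w a < w b" using f2 [OF that(2), of a b] f1 [OF that(1)] C [OF that(1)] that(3) by simp
    then show False using C [OF that(1)] by simp
  qed
  have "inj_on f (covers n w)"
  proof (rule inj_onI, clarify)
    fix a b a' b' assume *: "(a, b) \<in> covers n w" "(a', b') \<in> covers n w" "f (a, b) = f (a', b')"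
    then have "b = b'" using not_less [of a b a' b'] not_less [of a' b' a b] by simp
    moreover from this have "\<not> a < a'" "\<not> a' < a"
      using f3 [OF *(1), of a'] f3 [OF *(2), of a] f1 [OF *(1)] f1 [OF *(2)] * by auto
    ultimately show "a = a' \<and> b = b'" by simp
  qed
  moreover have "f ` covers n w \<subseteq> {p. 1 \<le> p \<and> p < n \<and> \<not> w ` {1..p} \<subseteq> {1..p}}"
  proof clarify
    fix a b assume ab: "(a, b) \<in> covers n w"
    let ?p = "f (a, b)"
    note f' = f1 [OF ab] and C' = C [OF ab]
    have "\<not> w ` {1..?p} \<subseteq> {1..?p}"
    proof
      assume sub: "w ` {1..?p} \<subseteq> {1..?p}"
      have inj: "inj w" using Sym_bij [OF w] by (simp add: bij_def)
      then have eq: "w ` {1..?p} = {1..?p}"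
        using sub by (intro endo_inj_surj) (auto intro: inj_on_subset)
      have wn: "w x \<in> {1..n} \<longleftrightarrow> x \<in> {1..n}" for x
        using w by (simp add: Sym_def permutes_in_image del: atLeastAtMost_iff)
      have "w a \<in> {1..?p}" by (rule subsetD [OF sub], rule imageI) (use f' C' in simp)
      moreover have "w b \<in> {1..n}" unfolding wn using C' by auto
      ultimately have "w b \<in> w ` {1..?p}" unfolding eq using C' by auto
      then have "b \<in> {1..?p}" by (simp only: inj_image_mem_iff [OF inj])
      then show False using f' by simp
    qed
    then show "1 \<le> ?p \<and> ?p < n \<and> \<not> w ` {1..?p} \<subseteq> {1..?p}" using f' C' by simp
  qed
  moreover have "finite {p. 1 \<le> p \<and> p < n \<and> \<not> w ` {1..p} \<subseteq> {1..p}}"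
    by (rule finite_subset [of _ "{..n}"]) auto
  ultimately show ?thesis by (rule card_inj_on_le)
qed

end

section \<open>Coatoms as length-decreasing transpositions\<close>

lemma coatom_in_covers:
  assumes w: "w \<in> Sym n" and u: "bruhat_le n u w" "Suc (len n u) = len n w"
  shows "u \<in> (\<lambda>(a, b). w \<circ> transpose a b) ` covers n w"
proof -
  have "u \<noteq> w" using u(2) by auto
  moreover have "(bruhat_step n)\<^sup>*\<^sup>* u w" using u(1) by (simp add: bruhat_le_def)
  then have "u = w \<or> (\<exists>x. bruhat_le n u x \<and> bruhat_step n x w)"
    unfolding bruhat_le_def by (cases rule: rtranclp.cases) blast+
  ultimately obtain x where x: "bruhat_le n u x" "bruhat_step n x w" by blast
  have "u = x"
  proof (rule ccontr)
    assume "u \<noteq> x"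
    then have "len n u < len n x" using x(1) bruhat_less_len by (simp add: bruhat_less_def)
    then show False using x(2) u(2) by (simp add: bruhat_step_def)
  qed
  with x(2) obtain a b where ab: "1 \<le> a" "a < b" "b \<le> n" "w = u \<circ> transpose a b" "u \<in> Sym n"
    by (auto simp: bruhat_step_def)
  then have uw: "u = w \<circ> transpose a b" by (simp add: comp_assoc)
  have lt: "w b < w a" using len_transpose_iff [OF ab(5,1,2,3)] u(2) ab(4) by simp
  have "\<not> (\<exists>c. a < c \<and> c < b \<and> w b < w c \<and> w c < w a)"
  proof
    assume "\<exists>c. a < c \<and> c < b \<and> w b < w c \<and> w c < w a"
    then obtain c where "a < c" "c < b" "w b < w c" "w c < w a" by blast
    from len_transpose_not_cover [OF w ab(1) this(1,2) ab(3) this(3,4)] show False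
      using u(2) uw by simp
  qed
  then have "(a, b) \<in> covers n w" using ab lt by (simp add: covers_def)
  then show ?thesis using uw by (intro image_eqI [of _ _ "(a, b)"]) simp_all
qed

lemma finite_covers: "finite (covers n w)"
  by (rule finite_subset [of _ "{..n} \<times> {..n}"]) (auto simp: covers_def)

lemma card_coatoms_le:
  assumes "w \<in> Sym n"
  shows "card {u. bruhat_le n u w \<and> Suc (len n u) = len n w} \<le> card (covers n w)"
proof -
  have "card {u. bruhat_le n u w \<and> Suc (len n u) = len n w} \<le> card ((\<lambda>(a, b). w \<circ> transpose a b) ` covers n w)"
    using coatom_in_covers [OF assms] finite_covers by (intro card_mono) auto
  also have "\<dots> \<le> card (covers n w)" by (rule card_image_le [OF finite_covers])
  finally show ?thesis .
qed

section \<open>The linear coefficient of the Poincare polynomial\<close>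

text \<open>The constant term 1 is included because it makes linear coefficients additive under
  products.\<close>

definition palindromic :: "int poly \<Rightarrow> bool" where
  "palindromic p \<longleftrightarrow> reflect_poly p = p \<and> coeff p 0 = 1"

lemma palindromic_1: "palindromic 1"
  by (simp add: palindromic_def)

lemma palindromic_mult: "palindromic p \<Longrightarrow> palindromic r \<Longrightarrow> palindromic (p * r)"
  by (simp add: palindromic_def reflect_poly_mult coeff_mult_0)

lemma coeff_mult_1: "coeff (p * r) (Suc 0) = coeff p 0 * coeff r (Suc 0) + coeff p (Suc 0) * coeff r 0"
  by (simp add: coeff_mult)

lemma palindromic_prod:
  "(\<And>x. x \<in> S \<Longrightarrow> palindromic (f x)) \<Longrightarrow>
    palindromic (prod f S) \<and> (finite S \<longrightarrow> coeff (prod f S) (Suc 0) = (\<Sum>x\<in>S. coeff (f x) (Suc 0)))"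
proof (induction S rule: infinite_finite_induct)
  case (insert x S)
  then have "palindromic (f x)" "palindromic (prod f S)"
    "coeff (prod f S) (Suc 0) = (\<Sum>x\<in>S. coeff (f x) (Suc 0))" by auto
  then show ?case using insert.hyps
    by (simp add: palindromic_mult coeff_mult_1) (simp add: palindromic_def)
qed (simp_all add: palindromic_1)

lemma palindromic_prod_list:
  "(\<And>x. x \<in> set xs \<Longrightarrow> palindromic (f x)) \<Longrightarrow>
    palindromic (prod_list (map f xs)) \<and>
    coeff (prod_list (map f xs)) (Suc 0) = (\<Sum>x\<leftarrow>xs. coeff (f x) (Suc 0))"
proof (induction xs)
  case (Cons x xs)
  then have "palindromic (f x)" "palindromic (prod_list (map f xs))"
    "coeff (prod_list (map f xs)) (Suc 0) = (\<Sum>x\<leftarrow>xs. coeff (f x) (Suc 0))" by auto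
  then show ?case
    by (simp add: palindromic_mult coeff_mult_1) (simp add: palindromic_def)
qed (simp add: palindromic_1)

lemma palindromicI:
  assumes "\<And>k. coeff p k = (if k \<le> d then coeff p (d - k) else 0)" "coeff p 0 = 1"
  shows "palindromic p"
proof -
  have d: "coeff p d = 1" using assms(1) [of d] assms(2) by simp
  have "degree p = d"
  proof (rule antisym)
    show "degree p \<le> d" using assms(1) by (intro degree_le allI impI) simp
    show "d \<le> degree p" using d by (intro le_degree) simp
  qed
  then have "coeff (reflect_poly p) k = coeff p k" for k
    using assms(1) [of k] by (cases "k \<le> d") (simp_all add: coeff_reflect_poly)
  then have "reflect_poly p = p" by (intro poly_eqI)
  then show ?thesis using assms(2) by (simp add: palindromic_def)
qed

definition qfact_poly :: "nat \<Rightarrow> int poly" where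
  "qfact_poly k = (\<Prod>i=1..k. \<Sum>j<i. monom 1 j)"

lemma q_power: "q ^ k = qp (2 * int k)"
  by (induction k) (simp_all add: q_eq)

lemma at_q_qfact_poly: "at_q (qfact_poly k) = q_fact k"
  by (simp add: qfact_poly_def q_fact_def at_q_prod at_q_sum at_q_monom q_power)

lemma coeff_qint: "coeff (\<Sum>j<i. monom 1 j) k = (if k < i then 1 else 0 :: int)"
  by (simp add: coeff_sum)

lemma palindromic_qfact:
  "palindromic (qfact_poly k)" "coeff (qfact_poly k) (Suc 0) = int (k - 1)"
proof -
  have "palindromic (\<Sum>j<i. monom 1 j)" if "i \<in> {1..k}" for i
    using that by (intro palindromicI [where d = "i - 1"]) (auto simp: coeff_qint)
  from palindromic_prod [of "{1..k}", OF this]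
  have p: "palindromic (qfact_poly k)"
    "coeff (qfact_poly k) (Suc 0) = (\<Sum>i=1..k. if 1 < i then 1 else 0)"
    by (simp_all add: qfact_poly_def coeff_qint)
  then show "palindromic (qfact_poly k)" by simp
  have "(\<Sum>i=1..k. if 1 < i then 1 else 0) = int (k - 1)"
    by (induction k) auto
  then show "coeff (qfact_poly k) (Suc 0) = int (k - 1)" using p by simp
qed

definition par_poly :: "nat \<Rightarrow> nat \<Rightarrow> nat \<Rightarrow> int poly" where
  "par_poly n a b = (\<Sum>u\<in>{u. u permutes {a..b}}. monom 1 (len n u))"

lemma coeff_par_poly: "coeff (par_poly n a b) k = int (card {u. u permutes {a..b} \<and> len n u = k})"
proof -
  have "coeff (par_poly n a b) k = (\<Sum>u\<in>{u. u permutes {a..b}}. if len n u = k then 1 else 0)"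
    by (simp add: par_poly_def coeff_sum)
  also have "\<dots> = int (card {u. u permutes {a..b} \<and> len n u = k})"
    by (simp add: sum.If_cases finite_permutations Collect_conj_eq [symmetric] Int_def)
  finally show ?thesis .
qed

lemma poincare_parabolic_sum:
  assumes "1 \<le> a" "b \<le> n"
  shows "poincare n (parabolic_sum a b) = at_q (par_poly n a b)"
proof -
  have "poincare n (parabolic_sum a b) = (\<Sum>u\<in>{u. u permutes {a..b}}. q ^ len n u)"
    unfolding poincare_def using permutes_subset_Sym [OF _ assms]
    by (intro sum.mono_neutral_cong_right finite_Sym) (auto simp: parabolic_sum_def)
  then show ?thesis by (simp add: par_poly_def at_q_sum at_q_monom q_power)
qed

text \<open>Composition with the reversal complements lengths. The elements of length 1 are the
  \<open>b - a\<close> simple reflections of the interval.\<close>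

lemma palindromic_par_poly:
  assumes ab: "1 \<le> a" "a \<le> b" "b \<le> n"
  shows "palindromic (par_poly n a b)" "coeff (par_poly n a b) (Suc 0) = int (b - a)"
proof -
  let ?r = "reversal a b" and ?W = "\<lambda>k. {u. u permutes {a..b} \<and> len n u = k}"
  let ?d = "len n ?r"
  have r: "?r permutes {a..b}" using reversal_permutes ab by blast
  have comp: "len n (u \<circ> ?r) + len n u = ?d" if "u permutes {a..b}" for u
    using len_comp_reversal [OF that ab] len_reversal [OF ab] by simp
  have rr: "(u \<circ> ?r) \<circ> ?r = u" for u :: perm
    using reversal_reversal [OF ab(2)] by (simp add: fun_eq_iff)
  have perm_r: "u \<circ> ?r permutes {a..b}" if "u permutes {a..b}" for u
    using permutes_compose [OF r that] .
  have W0: "?W 0 = {id}"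
    using len_eq_0D permutes_subset_Sym [OF _ ab(1,3)] by (auto simp: permutes_id len_id)
  show "palindromic (par_poly n a b)"
  proof (rule palindromicI [where d = ?d])
    show "coeff (par_poly n a b) 0 = 1" by (simp add: coeff_par_poly W0)
    fix k
    show "coeff (par_poly n a b) k = (if k \<le> ?d then coeff (par_poly n a b) (?d - k) else 0)"
    proof (cases "k \<le> ?d")
      case True
      have "bij_betw (\<lambda>u. u \<circ> ?r) (?W k) (?W (?d - k))"
      proof (rule bij_betw_byWitness [where f' = "\<lambda>u. u \<circ> ?r"])
        show "(\<lambda>u. u \<circ> ?r) ` ?W k \<subseteq> ?W (?d - k)" using perm_r comp by fastforce
        show "(\<lambda>u. u \<circ> ?r) ` ?W (?d - k) \<subseteq> ?W k"
        proof clarify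
          fix u assume u: "u permutes {a..b}" "len n u = ?d - k"
          then show "u \<circ> ?r permutes {a..b} \<and> len n (u \<circ> ?r) = k"
            using perm_r [OF u(1)] comp [OF u(1)] True by simp
        qed
      qed (use rr in auto)
      then show ?thesis using True by (simp add: coeff_par_poly bij_betw_same_card)
    next
      case False
      have "?W k = {}"
      proof (rule ccontr)
        assume "?W k \<noteq> {}"
        then obtain u where u: "u permutes {a..b}" "len n u = k" by blast
        then show False using comp [OF u(1)] False by simp
      qed
      then have "coeff (par_poly n a b) k = 0"
        unfolding coeff_par_poly by (simp only: card.empty of_nat_0)
      then show ?thesis using False by simp
    qed
  qed
  have "?W (Suc 0) = adj ` {a..<b}"
  proof (intro equalityI subsetI)
    fix u assume "u \<in> ?W (Suc 0)"
    then have u: "u permutes {a..b}" "len n u = Suc 0" by auto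
    from reduced_word_parabolic [OF u(1) ab(1,3)]
    obtain "is" where "is": "set is \<subseteq> {a..<b}" "word_perm is = u" "length is = Suc 0"
      using u(2) by (auto simp: reduced_word_def word_for_def)
    then obtain i where "is = [i]" by (auto simp: length_Suc_conv)
    then show "u \<in> adj ` {a..<b}" using "is" by (auto simp: word_perm_def)
  next
    fix u assume "u \<in> adj ` {a..<b}"
    then obtain i where i: "u = adj i" "a \<le> i" "i < b" by auto
    have "len n (adj i \<circ> id) = Suc (len n id)"
      using i ab by (intro len_up Sym_id) (auto simp: left_ascent_def)
    then have "len n u = Suc 0" using i by (simp add: len_id)
    then show "u \<in> ?W (Suc 0)" using i permutes_adj by auto
  qed
  moreover have "card (adj ` {a..<b}) = b - a"
    by (subst card_image) (auto simp: inj_on_def adj_eq_iff)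
  ultimately show "coeff (par_poly n a b) (Suc 0) = int (b - a)" by (simp add: coeff_par_poly)
qed

section \<open>Consequences of a parabolic factorization\<close>

abbreviation pairs :: "(nat \<times> nat) list \<Rightarrow> (nat \<times> nat) set" where
  "pairs A \<equiv> {(i, j). i < j \<and> j < length A}"

lemma finite_pairs: "finite (pairs A)"
  by (rule finite_subset [of _ "{..length A} \<times> {..length A}"]) auto

context
  fixes n :: nat and w :: perm and A :: "(nat \<times> nat) list"
  assumes w: "w \<in> Sym n" and A: "intervals_in n A"
    and fact: "scale (f_poly A) (KL_tilde n w) =
      hprod n (map (\<lambda>(a, b). KL_tilde n (reversal a b)) A)"
begin

lemma factorization_parabolic_prod: "scale (f_poly A) (KL_tilde n w) = parabolic_prod n A"
proof -
  have m: "map (\<lambda>(a, b). KL_tilde n (reversal a b)) A = map (\<lambda>(a, b). parabolic_sum a b) A"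
    using A KL_tilde_reversal by (intro map_cong) auto
  show ?thesis by (rule fact [unfolded m])
qed

lemma klpol_props:
  "klpol n w w = 1" "coeff (klpol n w u) k \<noteq> 0 \<Longrightarrow> u = w \<or> 2 * k + len n u + 1 \<le> len n w"
  "klpol n w u \<noteq> 0 \<Longrightarrow> bruhat_le n u w" "coeff (klpol n w u) 0 \<in> {0, 1}"
  using KLpoly_klpol [OF w] unfolding KLpoly_def KLweak_def by blast+

definition fpol :: "int poly" where
  "fpol = (\<Prod>(i, j)\<in>pairs A. qfact_poly (card (overlap A i j)))"

lemma at_q_fpol: "at_q fpol = f_poly A"
  by (simp add: fpol_def f_poly_def at_q_prod case_prod_unfold at_q_qfact_poly)

lemma palindromic_fpol:
  "palindromic fpol" "coeff fpol (Suc 0) = int (\<Sum>(i, j)\<in>pairs A. card (overlap A i j) - 1)"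
  using palindromic_prod [of "pairs A" "\<lambda>x. qfact_poly (card (overlap A (fst x) (snd x)))"] finite_pairs [of A]
  by (simp_all add: fpol_def case_prod_unfold palindromic_qfact)

text \<open>The coefficient of \<open>T w\<close> in the product is \<open>f_poly A\<close>, which
  is not 0.\<close>

lemma w_in_prods: "w \<in> prods A"
proof -
  have "fpol \<noteq> 0" using palindromic_fpol(1) by (auto simp: palindromic_def)
  then have "f_poly A \<noteq> 0" using at_q_inject [of fpol 0] by (simp add: at_q_fpol)
  then have "parabolic_prod n A w \<noteq> 0"
    unfolding factorization_parabolic_prod [symmetric] by (simp add: scale_def KL_tilde_eq [OF w] klpol_props)
  then show ?thesis using hprod_support [OF A] by blast
qed

text \<open>Every element of \<open>prods A\<close> survives in the product, so its Kazhdan--Lusztig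
  polynomial is not 0 and it lies below \<open>w\<close>.\<close>

lemma prods_len_le: "v \<in> prods A \<Longrightarrow> len n v \<le> len n w"
proof -
  assume "v \<in> prods A"
  then have "parabolic_prod n A v \<noteq> 0" using hprod_support [OF A] pos_at_2_neq_0 by blast
  then have "klpol n w v \<noteq> 0"
    unfolding factorization_parabolic_prod [symmetric] by (auto simp: scale_def KL_tilde_eq [OF w])
  then show ?thesis using klpol_props(3) bruhat_le_len by blast
qed

lemma poincare_identity:
  "fpol * (\<Sum>u\<in>Sym n. klpol n w u * monom 1 (len n u)) = prod_list (map (\<lambda>(a, b). par_poly n a b) A)"
proof -
  let ?Q = "\<Sum>u\<in>Sym n. klpol n w u * monom 1 (len n u)"
  have "at_q (fpol * ?Q) = poincare n (parabolic_prod n A)"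
    unfolding factorization_parabolic_prod [symmetric] poincare_scale
    by (simp add: at_q_mult at_q_fpol poincare_def at_q_sum at_q_monom q_power KL_tilde_eq [OF w])
  also have "\<dots> = prod_list (map (poincare n) (map (\<lambda>(a, b). parabolic_sum a b) A))"
    using A parabolic_sum_Hecke by (intro poincare_hprod) auto
  also have "\<dots> = prod_list (map (\<lambda>(a, b). at_q (par_poly n a b)) A)"
    using A poincare_parabolic_sum by (intro arg_cong [of _ _ prod_list]) auto
  also have "\<dots> = at_q (prod_list (map (\<lambda>(a, b). par_poly n a b) A))"
    by (induction A) (auto simp: at_q_mult)
  finally show ?thesis by (simp only: at_q_inject)
qed

text \<open>The right-hand side of the Poincare identity is palindromic, hence so is the intersection
  Poincare polynomial of \<open>w\<close>. Its linear coefficient is therefore the number of coatoms.\<close>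

lemma linear_coefficient_bound:
  assumes "w \<noteq> id"
  shows "(\<Sum>(a, b)\<leftarrow>A. b - a) \<le> (\<Sum>(i, j)\<in>pairs A. card (overlap A i j) - 1) + card (covers n w)"
proof -
  define Q where "Q = (\<Sum>u\<in>Sym n. klpol n w u * monom 1 (len n u))"
  define G where "G = prod_list (map (\<lambda>(a, b). par_poly n a b) A)"
  have FQ: "fpol * Q = G" unfolding Q_def G_def by (rule poincare_identity)
  have "len n w \<noteq> 0" using len_eq_0D [OF w] assms by blast
  then obtain l where l: "len n w = Suc l" using not0_implies_Suc by blast
  have pp: "palindromic (case x of (a, b) \<Rightarrow> par_poly n a b)" if "x \<in> set A" for x
    using A that palindromic_par_poly by auto
  have pG: "palindromic G" "coeff G (Suc 0) = (\<Sum>x\<leftarrow>A. coeff (case x of (a, b) \<Rightarrow> par_poly n a b) (Suc 0))"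
    unfolding G_def using palindromic_prod_list [of A "\<lambda>(a, b). par_poly n a b", OF pp] by auto
  have "(\<Sum>x\<leftarrow>A. coeff (case x of (a, b) \<Rightarrow> par_poly n a b) (Suc 0)) = (\<Sum>x\<leftarrow>A. int (snd x - fst x))"
    using A palindromic_par_poly(2) by (intro arg_cong [of _ _ sum_list] map_cong) auto
  also have "\<dots> = int (\<Sum>(a, b)\<leftarrow>A. b - a)"
    by (induction A) (auto simp: case_prod_unfold)
  finally have G1: "coeff G (Suc 0) = int (\<Sum>(a, b)\<leftarrow>A. b - a)" using pG by simp
  have "fpol \<noteq> 0" using palindromic_fpol(1) by (auto simp: palindromic_def)
  have "fpol * reflect_poly Q = fpol * Q"
    using pG(1) palindromic_fpol(1) reflect_poly_mult [of fpol Q] unfolding FQ by (simp add: palindromic_def)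
  then have rQ: "reflect_poly Q = Q" using \<open>fpol \<noteq> 0\<close> by simp
  have Q0: "coeff Q 0 = 1"
    using pG(1) palindromic_fpol(1) coeff_mult_0 [of fpol Q] unfolding FQ by (simp add: palindromic_def)
  have coeffQ: "coeff Q k = (\<Sum>u\<in>Sym n. if len n u \<le> k then coeff (klpol n w u) (k - len n u) else 0)" for k
  proof -
    have "coeff (p * monom 1 m) k = (if m \<le> k then coeff p (k - m) else 0)" for p :: "int poly" and m
      using coeff_monom_mult [of 1 m p k] by (simp add: mult.commute)
    then show ?thesis by (simp add: Q_def coeff_sum)
  qed
  \<comment> \<open>A term of \<open>u \<noteq> w\<close> in degree \<open>len n u + j\<close>
    satisfies \<open>2 * j + len n u + 1 \<le> len n w\<close>, hence stays below degree
    \<open>len n w\<close>. So \<open>Q\<close> has degree \<open>Suc l\<close> with leading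
    coefficient 1.\<close>
  have high: "(if len n u \<le> k then coeff (klpol n w u) (k - len n u) else 0) = (if u = w \<and> k = Suc l then 1 else 0)"
    if "Suc l \<le> k" for u k
  proof (cases "u = w")
    case True
    then show ?thesis using that l by (auto simp: klpol_props coeff_1)
  next
    case False
    have "coeff (klpol n w u) (k - len n u) = 0" if "len n u \<le> k"
    proof (rule ccontr)
      assume "coeff (klpol n w u) (k - len n u) \<noteq> 0"
      then have "2 * (k - len n u) + len n u + 1 \<le> Suc l" using klpol_props(2) False l by metis
      then show False using \<open>Suc l \<le> k\<close> that by linarith
    qed
    then show ?thesis using False by simp
  qed
  have "coeff Q k = (if k = Suc l then 1 else 0)" if "Suc l \<le> k" for k
    unfolding coeffQ high [OF that] using w finite_Sym by (simp add: sum.delta)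
  then have "degree Q = Suc l"
    by (intro antisym degree_le le_degree allI impI) auto
  then have "coeff Q (Suc 0) = coeff Q l"
    using coeff_reflect_poly [of Q "Suc 0"] rQ by simp
  also have "\<dots> \<le> (\<Sum>u\<in>Sym n. if bruhat_le n u w \<and> Suc (len n u) = len n w then 1 else 0)"
    unfolding coeffQ
  proof (rule sum_mono)
    fix u
    show "(if len n u \<le> l then coeff (klpol n w u) (l - len n u) else 0)
      \<le> (if bruhat_le n u w \<and> Suc (len n u) = len n w then 1 else 0)"
    proof (cases "len n u \<le> l \<and> coeff (klpol n w u) (l - len n u) \<noteq> 0")
      case True
      \<comment> \<open>In degree \<open>l\<close> the same inequality leaves only the exponent 0
        and \<open>len n u = l\<close>: a constant coefficient at a coatom, which is at most
        1.\<close>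
      then have "u \<noteq> w" using l by auto
      then have "2 * (l - len n u) + len n u + 1 \<le> Suc l" using klpol_props(2) True l by metis
      then have lu: "len n u = l" using True by linarith
      moreover have "klpol n w u \<noteq> 0" using True by auto
      ultimately show ?thesis using klpol_props(3,4) [of u] l by auto
    qed auto
  qed
  also have "\<dots> = int (card (Sym n \<inter> {u. bruhat_le n u w \<and> Suc (len n u) = len n w}))"
    by (simp add: sum.If_cases finite_Sym)
  also have "\<dots> \<le> int (card (covers n w))"
  proof -
    have "{u. bruhat_le n u w \<and> Suc (len n u) = len n w} \<subseteq> (\<lambda>(a, b). w \<circ> transpose a b) ` covers n w"
      using coatom_in_covers [OF w] by auto
    then have "finite {u. bruhat_le n u w \<and> Suc (len n u) = len n w}"
      by (rule finite_subset) (simp add: finite_covers)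
    then show ?thesis using card_coatoms_le [OF w]
      by (meson card_mono Int_lower2 of_nat_mono order_trans)
  qed
  finally have Q1: "coeff Q (Suc 0) \<le> int (card (covers n w))" .
  have "coeff G (Suc 0) = coeff Q (Suc 0) + coeff fpol (Suc 0)"
    using palindromic_fpol(1) Q0 unfolding FQ [symmetric] coeff_mult_1 by (simp add: palindromic_def)
  then show ?thesis using Q1 G1 palindromic_fpol(2) by linarith
qed

end

section \<open>Wires through a product of parabolic subgroups\<close>

definition consecutive :: "nat set \<Rightarrow> nat \<Rightarrow> nat \<Rightarrow> bool" where
  "consecutive V k l \<longleftrightarrow> k \<in> V \<and> l \<in> V \<and> k < l \<and> (\<forall>j. k < j \<longrightarrow> j < l \<longrightarrow> j \<notin> V)"

lemma greatest_below:
  fixes k l :: nat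
  assumes "P k" "k < l"
  obtains m where "P m" "k \<le> m" "m < l" "\<And>j. m < j \<Longrightarrow> j < l \<Longrightarrow> \<not> P j"
proof -
  let ?S = "{j. P j \<and> j < l}"
  have fin: "finite ?S" by simp
  have k: "k \<in> ?S" using assms by simp
  then have "Max ?S \<in> ?S" using Max_in [OF fin] by blast
  moreover have le: "j \<le> Max ?S" if "j \<in> ?S" for j using fin that by (rule Max_ge)
  moreover have "\<not> P j" if "Max ?S < j" "j < l" for j
  proof
    assume "P j"
    then have "j \<le> Max ?S" using that by (intro le) simp
    then show False using that by simp
  qed
  ultimately show thesis using that [of "Max ?S"] k by blast
qed

lemma const_along_consecutive:
  fixes f :: "nat \<Rightarrow> 'b"
  assumes step: "\<And>k l. consecutive V k l \<Longrightarrow> f k = f l" and kl: "k \<in> V" "l \<in> V"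
  shows "f k = f l"
proof -
  have "f k = f l" if "k \<in> V" "l \<in> V" "k < l" for k l
    using that
  proof (induction l rule: less_induct)
    case (less l)
    obtain m where m: "m \<in> V" "k \<le> m" "m < l" "\<And>j. m < j \<Longrightarrow> j < l \<Longrightarrow> j \<notin> V"
      using greatest_below [of "\<lambda>j. j \<in> V" k l] less.prems by auto
    then have "f m = f l" using less.prems by (intro step) (simp add: consecutive_def)
    moreover have "f k = f m" using m less by (cases "k = m") auto
    ultimately show ?case by simp
  qed
  then show ?thesis using kl by (metis linorder_neqE_nat)
qed

text \<open>Starting from the identity labelling, each edge merges at most two labels, so at most
  \<open>card E\<close> labels are lost.\<close>

lemma contracting_function:
  assumes "finite E" "E \<subseteq> {..<m} \<times> {..<m}"
  shows "\<exists>f :: nat \<Rightarrow> nat. (\<forall>(i, j)\<in>E. f i = f j) \<and> m \<le> card (f ` {..<m}) + card E"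
  using assms
proof (induction E)
  case empty
  have "m \<le> card (id ` {..<m}) + card {}" by simp
  then show ?case by blast
next
  case (insert e E)
  then obtain f :: "nat \<Rightarrow> nat" where f: "\<forall>(i, j)\<in>E. f i = f j" "m \<le> card (f ` {..<m}) + card E" by auto
  obtain i j where e: "e = (i, j)" by (cases e)
  define g where "g z = (if f z = f i then f j else f z)" for z
  have "f ` {..<m} \<subseteq> insert (f i) (g ` {..<m})" by (auto simp: g_def)
  then have "card (f ` {..<m}) \<le> card (insert (f i) (g ` {..<m}))" by (intro card_mono) auto
  also have "\<dots> \<le> Suc (card (g ` {..<m}))" by (rule card_insert_le_m1) simp_all
  finally have "m \<le> card (g ` {..<m}) + card (insert e E)"
    using f(2) insert.hyps by simp
  moreover have "\<forall>(i, j)\<in>insert e E. g i = g j" using f(1) by (auto simp: e g_def)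
  ultimately show ?case by blast
qed

text \<open>Four paths whose pattern of intersections is a four-cycle: one edge of the third path lies on a cycle.\<close>

lemma four_paths_cycle_aux:
  fixes V1 V2 V3 V4 :: "nat set"
  assumes disj: "V1 \<inter> V2 = {}" "V3 \<inter> V4 = {}"
    and meet: "V1 \<inter> V4 \<noteq> {}" "V2 \<inter> V4 \<noteq> {}"
    and a: "a \<in> V1 \<inter> V3" and b: "b \<in> V2 \<inter> V3" and "a < b"
  shows "\<exists>s t. consecutive V3 s t \<and> (\<forall>f :: nat \<Rightarrow> nat.
    (\<forall>V\<in>{V1, V2, V3, V4}. \<forall>k l. consecutive V k l \<longrightarrow> (k, l) \<noteq> (s, t) \<longrightarrow> f k = f l) \<longrightarrow> f s = f t)"
proof -
  let ?S = "{k \<in> V3 \<inter> V1. k < b}"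
  \<comment> \<open>\<open>s\<close> is the last vertex of \<open>V3\<close> on \<open>V1\<close>
    before \<open>b\<close>, and \<open>t\<close> is its successor on \<open>V3\<close>; the edge
    from \<open>s\<close> to \<open>t\<close> leaves \<open>V1\<close> for good on the way to
    \<open>b\<close>.\<close>
  define s where "s = Max ?S"
  have "finite ?S" by (rule finite_subset [of _ "{..b}"]) auto
  moreover have "a \<in> ?S" using a \<open>a < b\<close> by simp
  ultimately have "s \<in> ?S" and smax: "\<And>k. k \<in> ?S \<Longrightarrow> k \<le> s"
    unfolding s_def using Max_in [of ?S] Max_ge [of ?S] by blast+
  then have s: "s \<in> V3" "s \<in> V1" "s < b" by auto
  define t where "t = (LEAST k. k \<in> V3 \<and> s < k)"
  have "b \<in> V3 \<and> s < b" using b s by simp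
  then have t: "t \<in> V3" "s < t" "t \<le> b" and tmin: "\<And>k. k \<in> V3 \<Longrightarrow> s < k \<Longrightarrow> t \<le> k"
    unfolding t_def using LeastI [of "\<lambda>k. k \<in> V3 \<and> s < k" b] Least_le [of "\<lambda>k. k \<in> V3 \<and> s < k"] by blast+
  have t1: "t \<notin> V1"
  proof
    assume "t \<in> V1"
    then have "t \<noteq> b" using b disj by auto
    then have "t \<in> ?S" using t \<open>t \<in> V1\<close> by simp
    then show False using smax t by force
  qed
  have cons: "consecutive V3 s t"
    using s t tmin unfolding consecutive_def by (meson not_le)
  moreover have "f s = f t"
    if f: "\<forall>V\<in>{V1, V2, V3, V4}. \<forall>k l. consecutive V k l \<longrightarrow> (k, l) \<noteq> (s, t) \<longrightarrow> f k = f l" for f :: "nat \<Rightarrow> nat"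
  proof -
    \<comment> \<open>The edge is not on \<open>V1\<close>, as \<open>t\<close> is not, nor on
      \<open>V2\<close> or \<open>V4\<close>, as \<open>s\<close> is not. So \<open>s\<close>
      reaches \<open>b\<close> along \<open>V1\<close>, \<open>V4\<close>, \<open>V2\<close>, and
      \<open>b\<close> reaches \<open>t\<close> back along \<open>V3\<close>.\<close>
    have const: "f k = f l" if "V \<in> {V1, V2, V4}" "k \<in> V" "l \<in> V" for V k l
    proof (rule const_along_consecutive [where f = f, OF _ that(2,3)])
      fix k l assume kl: "consecutive V k l"
      have "(k, l) \<noteq> (s, t)" using kl that(1) t1 s t disj by (auto simp: consecutive_def)
      then show "f k = f l" using f kl that(1) by blast
    qed
    have "f t = f b"
    proof (rule const_along_consecutive [where f = f and V = "{k \<in> V3. t \<le> k}"])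
      fix k l assume kl: "consecutive {k \<in> V3. t \<le> k} k l"
      then have "consecutive V3 k l" "(k, l) \<noteq> (s, t)"
        using t by (auto simp: consecutive_def)
      then show "f k = f l" using f by blast
    qed (use t b in auto)
    moreover obtain c d where c: "c \<in> V1" "c \<in> V4" and d: "d \<in> V2" "d \<in> V4" using meet by blast
    have "f s = f c" "f c = f d" "f d = f b"
      using const [of V1 s c] const [of V4 c d] const [of V2 d b] s c d b by simp_all
    ultimately show ?thesis by simp
  qed
  ultimately show ?thesis by blast
qed

lemma four_paths_cycle:
  fixes V1 V2 V3 V4 :: "nat set"
  assumes disj: "V1 \<inter> V2 = {}" "V3 \<inter> V4 = {}"
    and meet: "V1 \<inter> V3 \<noteq> {}" "V1 \<inter> V4 \<noteq> {}" "V2 \<inter> V3 \<noteq> {}" "V2 \<inter> V4 \<noteq> {}"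
  shows "\<exists>s t. consecutive V3 s t \<and> (\<forall>f :: nat \<Rightarrow> nat.
    (\<forall>V\<in>{V1, V2, V3, V4}. \<forall>k l. consecutive V k l \<longrightarrow> (k, l) \<noteq> (s, t) \<longrightarrow> f k = f l) \<longrightarrow> f s = f t)"
proof -
  obtain a b where a: "a \<in> V1 \<inter> V3" and b: "b \<in> V2 \<inter> V3" using meet by blast
  then have "a \<noteq> b" using disj by auto
  then consider "a < b" | "b < a" by linarith
  then show ?thesis
  proof cases
    case 1
    from four_paths_cycle_aux [OF disj meet(2,4) a b 1] show ?thesis .
  next
    case 2
    have "V2 \<inter> V1 = {}" using disj by blast
    from four_paths_cycle_aux [OF this disj(2) meet(4,2) b a 2]
    show ?thesis by (simp only: insert_commute [of V1 V2])
  qed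
qed

text \<open>\<open>pos us k x\<close> is the position of the wire starting at \<open>x\<close> after passing the factors with index at
  least \<open>k\<close>; the rightmost factor acts first.\<close>

definition pos :: "perm list \<Rightarrow> nat \<Rightarrow> perm" where
  "pos us k = foldr (\<circ>) (drop k us) id"

lemma pos_length: "pos us (length us) = id"
  by (simp add: pos_def)

lemma pos_step: "k < length us \<Longrightarrow> pos us k = us ! k \<circ> pos us (Suc k)"
  by (simp add: pos_def Cons_nth_drop_Suc [symmetric])

lemma in_prods_iff:
  "w \<in> prods A \<longleftrightarrow>
    (\<exists>us. length us = length A \<and> (\<forall>k<length A. us ! k permutes interval A k) \<and> w = pos us 0)"
proof (induction A arbitrary: w rule: prods.induct)
  case 1
  show ?case by (auto simp: pos_def)
next
  case (2 a b A)
  have int0: "interval ((a, b) # A) 0 = {a..b}" "interval ((a, b) # A) (Suc k) = interval A k" for k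
    by (simp_all add: interval_def)
  show ?case
  proof
    assume "w \<in> prods ((a, b) # A)"
    then obtain u v where w: "w = u \<circ> v" and u: "u permutes {a..b}" and "v \<in> prods A" by auto
    then obtain us where us: "length us = length A" "\<forall>k<length A. us ! k permutes interval A k" "v = pos us 0"
      using "2.IH" by blast
    show "\<exists>us. length us = length ((a, b) # A) \<and>
      (\<forall>k<length ((a, b) # A). us ! k permutes interval ((a, b) # A) k) \<and> w = pos us 0"
    proof (intro exI [of _ "u # us"] conjI allI impI)
      show "length (u # us) = length ((a, b) # A)" using us by simp
      show "w = pos (u # us) 0" using us w by (simp add: pos_def)
      fix k assume "k < length ((a, b) # A)"
      then show "(u # us) ! k permutes interval ((a, b) # A) k"
        using us u by (cases k) (simp_all add: int0)
    qed
  next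
    assume "\<exists>us. length us = length ((a, b) # A) \<and>
      (\<forall>k<length ((a, b) # A). us ! k permutes interval ((a, b) # A) k) \<and> w = pos us 0"
    then obtain us where us: "length us = length ((a, b) # A)"
      "\<forall>k<length ((a, b) # A). us ! k permutes interval ((a, b) # A) k" "w = pos us 0" by blast
    from us(1) obtain u vs where uv: "us = u # vs" by (cases us) auto
    have "u permutes {a..b}" using us(2)[rule_format, of 0] by (simp add: uv int0)
    moreover have "\<forall>k<length A. vs ! k permutes interval A k"
    proof (intro allI impI)
      fix k assume "k < length A"
      then show "vs ! k permutes interval A k" using us(2)[rule_format, of "Suc k"] by (simp add: uv int0)
    qed
    then have "pos vs 0 \<in> prods A" using "2.IH" [of "pos vs 0"] us(1) uv by auto
    moreover have "w = u \<circ> pos vs 0" using us(3) by (simp add: uv pos_def)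
    ultimately show "w \<in> prods ((a, b) # A)" by auto
  qed
qed

context
  fixes n :: nat and w :: perm and A :: "(nat \<times> nat) list" and us :: "perm list"
  assumes w: "w \<in> Sym n" and A: "intervals_in n A"
    and us: "length us = length A" "\<forall>k<length A. us ! k permutes interval A k" "w = pos us 0"
    and maximal: "\<forall>v\<in>prods A. len n v \<le> len n w"
begin

text \<open>The factors that the wire starting at \<open>x\<close> runs through:
  \<open>pos us (Suc k) x\<close> is its position just before factor \<open>k\<close> acts.\<close>

definition visits :: "nat \<Rightarrow> nat set" where
  "visits x = {k. k < length A \<and> pos us (Suc k) x \<in> interval A k}"

lemma inj_pos: "k \<le> length A \<Longrightarrow> inj (pos us k)"
proof (induction rule: inc_induct)
  case base
  have "pos us (length A) = id" using pos_length [of us] us(1) by simp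
  then show ?case by simp
next
  case (step k)
  have "inj (us ! k)" using us(2) [rule_format, of k] step permutes_inj by blast
  moreover have "pos us k = us ! k \<circ> pos us (Suc k)" using pos_step [of k us] step us(1) by simp
  ultimately show "inj (pos us k)" using inj_compose [OF _ step.IH, of "us ! k"] by presburger
qed

text \<open>Exchanging the two wires inside the common factor \<open>k\<close> stays in its
  subgroup, changes no other factor, and swaps the two final positions.\<close>

lemma swap_in_prods:
  assumes k: "k \<in> visits x" "k \<in> visits y"
  shows "w \<circ> transpose x y \<in> prods A"
proof -
  let ?P = "pos us (Suc k)"
  have kA: "k < length A" "?P x \<in> interval A k" "?P y \<in> interval A k" using k by (auto simp: visits_def)
  let ?u = "us ! k \<circ> transpose (?P x) (?P y)"
  let ?us = "us[k := ?u]"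
  have u: "?u permutes interval A k"
    using us(2) [rule_format, OF kA(1)] kA by (intro permutes_compose permutes_swap_id) auto
  have "transpose (?P x) (?P y) \<circ> ?P = ?P \<circ> transpose x y"
    using inj_pos [of "Suc k"] kA by (auto simp: fun_eq_iff transpose_def dest: injD)
  then have step: "pos ?us k = pos us k \<circ> transpose x y"
    using pos_step [of k us] pos_step [of k ?us] kA us(1) by (simp add: comp_assoc pos_def [of _ "Suc k"])
  have "pos ?us j = pos us j \<circ> transpose x y" if "j \<le> k" for j
    using that
  proof (induction rule: inc_induct)
    case base
    show ?case by (rule step)
  next
    case (step j)
    have "pos ?us (Suc j) = pos us (Suc j) \<circ> transpose x y" by (rule step.IH)
    then show "pos ?us j = pos us j \<circ> transpose x y"
      using pos_step [of j us] pos_step [of j ?us] step kA us(1) by (simp add: comp_assoc)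
  qed
  then have "w \<circ> transpose x y = pos ?us 0" using us(3) by simp
  moreover have "\<forall>j<length A. ?us ! j permutes interval A j"
  proof (intro allI impI)
    fix j assume "j < length A"
    then show "?us ! j permutes interval A j" using us(1,2) u by (cases "j = k") simp_all
  qed
  ultimately show ?thesis unfolding in_prods_iff using us(1) by (intro exI [of _ ?us]) simp
qed

text \<open>If two wires that are not inverted met, exchanging them would give a longer element of
  \<open>prods A\<close>.\<close>

lemma visits_disjoint:
  assumes "1 \<le> x" "x < y" "y \<le> n" "w x < w y"
  shows "visits x \<inter> visits y = {}"
proof (rule ccontr)
  assume "visits x \<inter> visits y \<noteq> {}"
  then have "w \<circ> transpose x y \<in> prods A" using swap_in_prods by blast
  then have "len n (w \<circ> transpose x y) \<le> len n w" using maximal by blast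
  then show False using len_transpose [OF w assms] by simp
qed

text \<open>Only a factor containing both wires can reverse their order.\<close>

lemma visits_meet:
  assumes "x < y" "w y < w x"
  shows "visits x \<inter> visits y \<noteq> {}"
proof
  assume disj: "visits x \<inter> visits y = {}"
  have "pos us k x < pos us k y" if "k \<le> length A" for k
    using that
  proof (induction rule: inc_induct)
    case base
    have "pos us (length A) = id" using pos_length [of us] us(1) by simp
    then show ?case using assms by simp
  next
    case (step k)
    let ?x = "pos us (Suc k) x" and ?y = "pos us (Suc k) y"
    have eq: "pos us k x = (us ! k) ?x" "pos us k y = (us ! k) ?y"
      using pos_step [of k us] step us(1) by simp_all
    have "\<not> (us ! k) ?y < (us ! k) ?x"
    proof
      assume "(us ! k) ?y < (us ! k) ?x"
      moreover have "us ! k permutes {fst (A ! k)..snd (A ! k)}"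
        using us(2) [rule_format, of k] step by (simp add: interval_def)
      ultimately have "k \<in> visits x \<inter> visits y"
        using parabolic_inversion [of "us ! k" _ _ ?x ?y] step by (simp add: visits_def interval_def)
      then show False using disj by simp
    qed
    moreover have "pos us k x \<noteq> pos us k y"
      using inj_pos [of k] step assms by (auto dest: injD)
    ultimately show "pos us k x < pos us k y" using eq by simp
  qed
  from this [of 0] show False using assms us(3) by simp
qed

text \<open>The wire passes factor \<open>l\<close> before factor \<open>k\<close> and is fixed by
  the factors in between, so its position there lies in both intervals and in none of the
  intermediate ones.\<close>

lemma overlap_visits:
  assumes "consecutive (visits x) k l"
  shows "overlap A k l \<noteq> {}" "l < length A" "k < l"
proof -
  from assms show kl: "l < length A" "k < l" by (auto simp: consecutive_def visits_def)
  have k: "pos us (Suc k) x \<in> interval A k" "pos us (Suc l) x \<in> interval A l"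
    using assms by (auto simp: consecutive_def visits_def)
  have not: "pos us (Suc j) x \<notin> interval A j" if "k < j" "j < l" for j
    using assms that by (auto simp: consecutive_def visits_def)
  have const: "pos us j x = pos us l x" if "j \<le> l" "k < j" for j
    using that
  proof (induction rule: inc_induct)
    case base show ?case ..
  next
    case (step j)
    have "pos us j x = (us ! j) (pos us (Suc j) x)" using pos_step [of j us] step kl us(1) by simp
    also have "\<dots> = pos us (Suc j) x"
      using us(2) [rule_format, of j] step kl not [of j] by (intro permutes_not_in) auto
    finally show ?case using step by simp
  qed
  let ?c = "pos us l x"
  have "?c = (us ! l) (pos us (Suc l) x)" using pos_step [of l us] kl us(1) by simp
  then have "?c \<in> interval A l" using us(2) [rule_format, OF kl(1)] k(2) by (simp add: permutes_in_image)
  moreover have "?c \<in> interval A k" using k(1) const [of "Suc k"] kl by simp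
  moreover have "?c \<notin> interval A j" if "k < j" "j < l" for j
    using not [OF that] const [of "Suc j"] that by simp
  ultimately have "?c \<in> overlap A k l" by (auto simp: overlap_def)
  then show "overlap A k l \<noteq> {}" by blast
qed

text \<open>A factor whose interval does not contain both \<open>p\<close> and \<open>Suc p\<close>
  preserves \<open>{1..p}\<close>, so if no interval does, \<open>w\<close> preserves it as
  well.\<close>

lemma moved_subset:
  "{p. 1 \<le> p \<and> p < n \<and> \<not> w ` {1..p} \<subseteq> {1..p}}
    \<subseteq> {p. \<exists>k<length A. p \<in> interval A k \<and> Suc p \<in> interval A k}"
proof (rule subsetI, rule ccontr)
  fix p assume p: "p \<in> {p. 1 \<le> p \<and> p < n \<and> \<not> w ` {1..p} \<subseteq> {1..p}}"
    and not: "p \<notin> {p. \<exists>k<length A. p \<in> interval A k \<and> Suc p \<in> interval A k}"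
  have "pos us k x \<in> {1..p}" if "k \<le> length A" "x \<in> {1..p}" for k x
    using that
  proof (induction rule: inc_induct)
    case base
    have "pos us (length A) = id" using pos_length [of us] us(1) by simp
    then show ?case using that by simp
  next
    case (step k)
    let ?y = "pos us (Suc k) x" and ?u = "us ! k"
    let ?a = "fst (A ! k)" and ?b = "snd (A ! k)"
    have ab: "1 \<le> ?a" using A step by (auto simp: case_prod_unfold)
    have u: "?u permutes {?a..?b}" using us(2) [rule_format, of k] step by (simp add: interval_def)
    have "?y \<in> {1..p}" using step by simp
    have "?u ?y \<in> {1..p}"
    proof (cases "?y \<in> {?a..?b}")
      case True
      then have "?u ?y \<in> {?a..?b}" using u permutes_in_image by metis
      moreover have "\<not> (p \<in> {?a..?b} \<and> Suc p \<in> {?a..?b})"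
        using not step by (auto simp: interval_def)
      ultimately show ?thesis using True \<open>?y \<in> {1..p}\<close> ab by auto
    next
      case False
      then have "?u ?y = ?y" using u by (rule permutes_not_in [rotated])
      then show ?thesis using \<open>?y \<in> {1..p}\<close> by simp
    qed
    then show ?case using pos_step [of k us] step us(1) by simp
  qed
  from this [of 0] have "w ` {1..p} \<subseteq> {1..p}" using us(3) by blast
  then show False using p by blast
qed

end

section \<open>Counting overlaps, blocks of positions and components\<close>

lemma sum_pairs:
  fixes g :: "nat \<Rightarrow> nat \<Rightarrow> 'b :: comm_monoid_add"
  shows "(\<Sum>(i, j)\<in>pairs A. g i j) = (\<Sum>j<length A. \<Sum>i<j. g i j)"
proof -
  have "(\<Sum>j<length A. \<Sum>i<j. g i j) = (\<Sum>(j, i)\<in>(SIGMA j:{..<length A}. {..<j}). g i j)"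
    by (rule sum.Sigma) auto
  also have "\<dots> = (\<Sum>(i, j)\<in>pairs A. g i j)"
    by (rule sum.reindex_bij_witness [of _ "\<lambda>(i, j). (j, i)" "\<lambda>(j, i). (i, j)"]) auto
  finally show ?thesis ..
qed

lemma finite_interval: "finite (interval A k)"
  by (simp add: interval_def)

lemma finite_overlap: "finite (overlap A i j)"
  by (simp add: overlap_def finite_interval)

text \<open>Each position in several intervals is counted by \<open>overlap\<close> once for every pair of successive intervals.\<close>

lemma sum_card_overlap:
  assumes "j < length A"
  shows "(\<Sum>i<j. card (overlap A i j)) = card (interval A j \<inter> (\<Union>i<j. interval A i))"
proof -
  have "card (\<Union>i\<in>{..<j}. overlap A i j) = (\<Sum>i<j. card (overlap A i j))"
  proof (rule card_UN_disjoint)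
    show "\<forall>i\<in>{..<j}. \<forall>i'\<in>{..<j}. i \<noteq> i' \<longrightarrow> overlap A i j \<inter> overlap A i' j = {}"
    proof (intro ballI impI)
      fix i i' assume "i \<in> {..<j}" "i' \<in> {..<j}" "i \<noteq> i'"
      then consider "i < i'" "i' < j" | "i' < i" "i < j" by (metis lessThan_iff linorder_neqE_nat)
      then show "overlap A i j \<inter> overlap A i' j = {}" by cases (auto simp: overlap_def)
    qed
  qed (simp_all add: finite_overlap)
  moreover have "(\<Union>i\<in>{..<j}. overlap A i j) = interval A j \<inter> (\<Union>i<j. interval A i)"
  proof (intro equalityI subsetI)
    fix x assume x: "x \<in> interval A j \<inter> (\<Union>i<j. interval A i)"
    from x obtain i where i: "x \<in> interval A i" "i < j" by blast
    obtain m where m: "x \<in> interval A m" "m < j" "\<And>k. m < k \<Longrightarrow> k < j \<Longrightarrow> x \<notin> interval A k"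
      using greatest_below [of "\<lambda>k. x \<in> interval A k", OF i] by blast
    then have "x \<in> overlap A m j" using x by (auto simp: overlap_def)
    then show "x \<in> (\<Union>i\<in>{..<j}. overlap A i j)" using m(2) by blast
  qed (auto simp: overlap_def)
  ultimately show ?thesis by simp
qed

lemma card_union_intervals:
  "card (\<Union>i<length A. interval A i) + (\<Sum>(i, j)\<in>pairs A. card (overlap A i j)) = (\<Sum>i<length A. card (interval A i))"
proof -
  have "m \<le> length A \<Longrightarrow> card (\<Union>i<m. interval A i) + (\<Sum>j<m. \<Sum>i<j. card (overlap A i j)) = (\<Sum>i<m. card (interval A i))" for m
  proof (induction m)
    case (Suc m)
    have "card (interval A m) + card (\<Union>i<m. interval A i) =
      card (interval A m \<union> (\<Union>i<m. interval A i)) + card (interval A m \<inter> (\<Union>i<m. interval A i))"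
      by (rule card_Un_Int) (auto simp: finite_interval)
    then show ?case using Suc sum_card_overlap [of m A] by (simp add: lessThan_Suc)
  qed simp
  then show ?thesis by (simp add: sum_pairs)
qed

text \<open>A function on the factors which is constant along overlaps descends to the positions, and is
  constant on each connected block of positions.\<close>

lemma card_image_blocks:
  fixes f :: "nat \<Rightarrow> nat"
  assumes A: "\<And>k. k < length A \<Longrightarrow> interval A k \<noteq> {}"
    and f: "\<And>i j. i < j \<Longrightarrow> j < length A \<Longrightarrow> overlap A i j \<noteq> {} \<Longrightarrow> f i = f j"
  shows "card (f ` {..<length A}) + card {p. \<exists>k<length A. p \<in> interval A k \<and> Suc p \<in> interval A k}
    \<le> card (\<Union>i<length A. interval A i)"
proof -
  let ?U = "\<Union>i<length A. interval A i"
  let ?D = "{p. \<exists>k<length A. p \<in> interval A k \<and> Suc p \<in> interval A k}"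
  have same: "f k = f l" if "k < length A" "l < length A" "x \<in> interval A k" "x \<in> interval A l" for k l x
  proof (rule const_along_consecutive [where f = f and V = "{k. k < length A \<and> x \<in> interval A k}"])
    fix i j assume "consecutive {k. k < length A \<and> x \<in> interval A k} i j"
    then have "x \<in> overlap A i j" "i < j" "j < length A" by (auto simp: consecutive_def overlap_def)
    then show "f i = f j" using f by blast
  qed (use that in auto)
  define g where "g x = f (SOME k. k < length A \<and> x \<in> interval A k)" for x
  have g: "g x = f k" if "k < length A" "x \<in> interval A k" for x k
  proof -
    have "(SOME k. k < length A \<and> x \<in> interval A k) < length A \<and> x \<in> interval A (SOME k. k < length A \<and> x \<in> interval A k)"
      using that by (intro someI [of "\<lambda>k. k < length A \<and> x \<in> interval A k"]) simp
    then show ?thesis unfolding g_def using same that by blast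
  qed
  have finU: "finite ?U" by (simp add: finite_interval)
  have DU: "Suc ` ?D \<subseteq> ?U" by auto
  have red: "x \<in> ?U \<longrightarrow> g x \<in> g ` (?U - Suc ` ?D)" for x
  proof (induction x)
    case (Suc x)
    show ?case
    proof
      assume SU: "Suc x \<in> ?U"
      show "g (Suc x) \<in> g ` (?U - Suc ` ?D)"
      proof (cases "x \<in> ?D")
        case True
        then obtain k where "k < length A" "x \<in> interval A k" "Suc x \<in> interval A k" by blast
        then have "g (Suc x) = g x" "x \<in> ?U" using g by auto
        then show ?thesis using Suc.IH by simp
      next
        case False
        then show ?thesis using SU by (intro imageI) auto
      qed
    qed
  qed (auto intro!: imageI)
  have "f ` {..<length A} \<subseteq> g ` ?U"
  proof
    fix y assume "y \<in> f ` {..<length A}"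
    then obtain k where k: "k < length A" "y = f k" by auto
    then obtain x where "x \<in> interval A k" using A by blast
    then show "y \<in> g ` ?U" using g k by (intro image_eqI [of _ _ x]) auto
  qed
  also have "\<dots> \<subseteq> g ` (?U - Suc ` ?D)" using red by blast
  finally have "card (f ` {..<length A}) \<le> card (g ` (?U - Suc ` ?D))"
    using finU by (intro card_mono finite_imageI finite_Diff)
  also have "\<dots> \<le> card (?U - Suc ` ?D)" using finU by (intro card_image_le finite_Diff)
  also have "\<dots> = card ?U - card ?D"
    using DU finU by (simp add: card_Diff_subset finite_subset card_image)
  finally show ?thesis
    using card_mono [OF finU DU] by (simp add: card_image)
qed

theorem theorem5p2:
  fixes n :: nat and w :: "nat \<Rightarrow> nat"
  assumes "n \<ge> 1"
    and "w permutes {1..n}"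
    and "avoids n w [4, 2, 3, 1]"
    and "\<not> avoids n w [3, 4, 1, 2]"
    and "gap3412 n w > 1"
  shows "\<not> has_parabolic_factorization n w"
proof
  assume "has_parabolic_factorization n w"
  then obtain A where A: "intervals_in n A"
    and fact: "scale (f_poly A) (KL_tilde n w) = hprod n (map (\<lambda>(a, b). KL_tilde n (reversal a b)) A)"
    unfolding has_parabolic_factorization_def by blast
  have w: "w \<in> Sym n" using assms(2) by (simp add: Sym_def)
  obtain x1 x2 x3 x4 where x: "1 \<le> x1" "x1 < x2" "x2 < x3" "x3 < x4" "x4 \<le> n"
    "w x3 < w x4" "w x4 < w x1" "w x1 < w x2"
    using assms(4) by (rule not_avoids_3412D)
  have "w \<noteq> id" using x by auto
  have maximal: "\<forall>v\<in>prods A. len n v \<le> len n w" using prods_len_le [OF w A fact] by blast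
  obtain us where us: "length us = length A" "\<forall>k<length A. us ! k permutes interval A k" "w = pos us 0"
    using w_in_prods [OF w A fact] unfolding in_prods_iff by blast
  let ?V = "visits A us"
  let ?E = "{(i, j). (i, j) \<in> pairs A \<and> overlap A i j \<noteq> {}}"
  let ?U = "\<Union>i<length A. interval A i"
  let ?D = "{p. \<exists>k<length A. p \<in> interval A k \<and> Suc p \<in> interval A k}"
  let ?O = "\<Sum>(i, j)\<in>pairs A. card (overlap A i j)"
  note disjoint = visits_disjoint [OF w A us maximal] and meet = visits_meet [OF w A us maximal]
    and edge = overlap_visits [OF w A us maximal]
  have "?V x1 \<inter> ?V x2 = {}" "?V x3 \<inter> ?V x4 = {}" 
    using disjoint [of x1 x2] disjoint [of x3 x4] x by simp_all
  moreover have "?V x1 \<inter> ?V x3 \<noteq> {}" "?V x1 \<inter> ?V x4 \<noteq> {}" "?V x2 \<inter> ?V x3 \<noteq> {}" "?V x2 \<inter> ?V x4 \<noteq> {}"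
    using meet [of x1 x3] meet [of x1 x4] meet [of x2 x3] meet [of x2 x4] x by simp_all
  ultimately obtain s t where st: "consecutive (?V x3) s t"
    and cycle: "\<And>f :: nat \<Rightarrow> nat. (\<And>V k l. V \<in> {?V x1, ?V x2, ?V x3, ?V x4} \<Longrightarrow> consecutive V k l \<Longrightarrow>
      (k, l) \<noteq> (s, t) \<Longrightarrow> f k = f l) \<Longrightarrow> f s = f t"
    using four_paths_cycle [of "?V x1" "?V x2" "?V x3" "?V x4"] by metis
  have stE: "(s, t) \<in> ?E" using edge [OF st] by simp
  have finE: "finite ?E" by (rule finite_subset [OF _ finite_pairs [of A]]) auto
  \<comment> \<open>Labels are chosen by contracting all edges except \<open>(s, t)\<close>; the
    cycle then equates the labels of \<open>s\<close> and \<open>t\<close> anyway. The resulting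
    labelling respects all of \<open>?E\<close> but has one label more than a forest with these
    edges would allow.\<close>
  have "?E - {(s, t)} \<subseteq> {..<length A} \<times> {..<length A}" by auto
  then obtain f :: "nat \<Rightarrow> nat" where f: "\<forall>(i, j)\<in>?E - {(s, t)}. f i = f j"
    "length A \<le> card (f ` {..<length A}) + card (?E - {(s, t)})"
    using contracting_function [of "?E - {(s, t)}" "length A"] finE by auto
  have "f s = f t"
  proof (rule cycle)
    fix V k l assume V: "V \<in> {?V x1, ?V x2, ?V x3, ?V x4}" and kl: "consecutive V k l" "(k, l) \<noteq> (s, t)"
    then obtain x where "V = ?V x" by blast
    then have "(k, l) \<in> ?E - {(s, t)}" using edge [of x k l] kl by simp
    then show "f k = f l" using f(1) by blast
  qed
  then have fE: "f i = f j" if "i < j" "j < length A" "overlap A i j \<noteq> {}" for i j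
    using f(1) that by (cases "(i, j) = (s, t)") auto
  have ne: "interval A k \<noteq> {}" if "k < length A" for k
    using A nth_mem [OF that] by (auto simp: interval_def case_prod_unfold)
  have blocks: "card (f ` {..<length A}) + card ?D \<le> card ?U"
    using card_image_blocks [OF ne fE] .
  from card_Suc_Diff1 [OF finE stE] have edges: "length A + 1 \<le> card (f ` {..<length A}) + card ?E" using f(2) by linarith
  have finD: "finite ?D"
    by (rule finite_subset [of _ ?U]) (auto simp: finite_interval)
  have cov: "card (covers n w) \<le> card ?D"
  proof -
    have "card (covers n w) \<le> card {p. 1 \<le> p \<and> p < n \<and> \<not> w ` {1..p} \<subseteq> {1..p}}"
      by (rule card_covers_le [OF w]) (use avoids_4231D [OF assms(3)] gap3412_D [OF assms(5)] in blast)+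
    also have "\<dots> \<le> card ?D" using moved_subset [OF w A us maximal] finD by (intro card_mono)
    finally show ?thesis .
  qed
  have bound: "(\<Sum>(a, b)\<leftarrow>A. b - a) \<le> (\<Sum>(i, j)\<in>pairs A. card (overlap A i j) - 1) + card (covers n w)"
    using linear_coefficient_bound [OF w A fact \<open>w \<noteq> id\<close>] .
  have "(\<Sum>(i, j)\<in>pairs A. card (overlap A i j) - 1) + card ?E = ?O"
  proof -
    \<comment> \<open>The truncated subtraction loses exactly 1 at each nonempty overlap and nothing
      at an empty one.\<close>
    have "card ?E = (\<Sum>(i, j)\<in>pairs A. if overlap A i j \<noteq> {} then 1 else 0)"
      using finite_pairs [of A] by (simp add: sum.If_cases case_prod_unfold Int_def)
    then have "(\<Sum>(i, j)\<in>pairs A. card (overlap A i j) - 1) + card ?E =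
      (\<Sum>(i, j)\<in>pairs A. (card (overlap A i j) - 1) + (if overlap A i j \<noteq> {} then 1 else 0))"
      by (simp add: sum.distrib case_prod_unfold)
    also have "\<dots> = ?O"
      by (rule sum.cong) (auto simp: Suc_diff_le card_gt_0_iff finite_overlap Suc_le_eq)
    finally show ?thesis .
  qed
  moreover have "(\<Sum>(a, b)\<leftarrow>A. b - a) + length A = card ?U + ?O"
  proof -
    have "(\<Sum>(a, b)\<leftarrow>A. b - a) + length A = (\<Sum>(a, b)\<leftarrow>A. Suc (b - a))" by (induction A) auto
    also have "\<dots> = (\<Sum>i<length A. card (interval A i))"
    proof -
      have "Suc (snd (A ! i) - fst (A ! i)) = card (interval A i)" if "i < length A" for i
        using A nth_mem [OF that] by (auto simp: interval_def case_prod_unfold)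
      then show ?thesis by (simp add: sum_list_sum_nth case_prod_unfold atLeast0LessThan)
    qed
    finally show ?thesis using card_union_intervals [of A] by simp
  qed
  \<comment> \<open>The linear coefficients give \<open>|U| - |D| \<le> m - |E|\<close> for the
    numbers of factors, edges, positions and adjacent pairs, whereas \<open>blocks\<close> and
    \<open>edges\<close> give \<open>|U| - |D| \<ge> m + 1 - |E|\<close>.\<close>
  ultimately show False using bound cov blocks edges by linarith
qed

end
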